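(* Let $m_0\ge 1$ and $n_0\ge 0$ be fixed integers. Then the Gross-Pitaevskii equation $$-iu_t-\Delta u+(x^2+y^2)u+|u|^2u=0\quad\text{on }\mathbb{R}^2$$ has a global bifurcation, starting from $\omega_0=2(m_0+2n_0+1)$, in the space $$F=\{u\in X: u(r,\theta)=e^{im_0\theta}u(r)\text{ with }u(r)\text{ real valued}\},$$ consisting of periodic solutions of the form $e^{-i\omega t}e^{im_0\theta}u(r)$, where $u(r)$ is a real-valued function. That is, let $\mathcal{S}$ be the closure in $F\times\mathbb{R}$ of the set of pairs $(u,\omega)\in F\times\mathbb{R}$ with $u\ne 0$ and $$-\Delta u+(r^2-\omega+|u|^2)u=0 .$$ Then there is a connected closed set $\mathcal{C}\subset\mathcal{S}$ containing $(0,\omega_0)$ such that either $\mathcal{C}$ is unbounded in $X\times\mathbb{R}$, or $\mathcal{C}$ contains a point $(0,\omega_1)$ with $\omega_1\neq\omega_0$.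
   Context: $(r,\theta)$ are polar coordinates on $\mathbb{R}^2$, so $r^2=x^2+y^2$, and $\Delta=\partial_r^2+r^{-1}\partial_r+r^{-2}\partial_\theta^2$ is the Laplacian on $\mathbb{R}^2$. $X$ is the space of functions $u\in H^2(\mathbb{R}^2;\mathbb{C})$ for which $\|u\|_X^2=\|u\|_{H^2}^2+\|r^2u\|_{L^2}^2$ is finite, with this norm. A function $e^{-i\omega t}u(r,\theta)$ with $u\in X$, $\omega\in\mathbb{R}$ solves the Gross-Pitaevskii equation exactly when $-\Delta u+(r^2-\omega+|u|^2)u=0$ (an equality in $L^2(\mathbb{R}^2;\mathbb{C})$); $u=0$ is a (trivial) solution for every $\omega$. A "global bifurcation" starting from $\omega_0$ in a subspace means a bifurcating branch of solutions $(u,\omega)$ in that subspace times $\mathbb{R}$, emanating from $(0,\omega_0)$, that is a continuum which is unbounded or returns to a different bifurcation point $(0,\omega_1)$. Here a bifurcation point is a point $(0,\omega_1)$ that is a limit of nontrivial solutions (so every point $(0,\omega_1)\in\mathcal{S}$ is one). *)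

theory Defs
  imports "HOL-Analysis.Analysis"
begin

subsection \<open>Smooth compactly supported functions\<close>

definition partial_deriv :: "'a::euclidean_space \<Rightarrow> ('a \<Rightarrow> real) \<Rightarrow> 'a \<Rightarrow> real" where
  "partial_deriv i f x = frechet_derivative f (at x) i"

text \<open>\<open>Ck k f\<close> says that \<open>f\<close> is of class \<open>C\<^sup>k\<close> on the whole space.\<close>

fun Ck :: "nat \<Rightarrow> ('a::euclidean_space \<Rightarrow> real) \<Rightarrow> bool" where
  "Ck 0 f \<longleftrightarrow> continuous_on UNIV f"
| "Ck (Suc k) f \<longleftrightarrow> (\<forall>x. f differentiable (at x)) \<and> (\<forall>i\<in>Basis. Ck k (partial_deriv i f))"

definition test_function :: "('a::euclidean_space \<Rightarrow> real) \<Rightarrow> bool" where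
  "test_function \<phi> \<longleftrightarrow> (\<forall>k. Ck k \<phi>) \<and> compact (closure {x. \<phi> x \<noteq> 0})"

subsection \<open>Square integrable functions and weak derivatives\<close>

text \<open>Functions are Borel representatives of their Lebesgue classes. Real valued test functions
  suffice for complex valued \<open>u\<close>, since the defining identity is linear in the test function.\<close>

definition L2 :: "('a::euclidean_space \<Rightarrow> complex) set" where
  "L2 = {u. u \<in> borel_measurable lborel \<and> integrable lborel (\<lambda>x. (norm (u x))\<^sup>2)}"

definition has_weak_deriv ::
  "'a::euclidean_space \<Rightarrow> ('a \<Rightarrow> complex) \<Rightarrow> ('a \<Rightarrow> complex) \<Rightarrow> bool" where
  "has_weak_deriv i u g \<longleftrightarrow> u \<in> L2 \<and> g \<in> L2 \<and>
     (\<forall>\<phi>. test_function \<phi> \<longrightarrow>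
        (\<integral>x. partial_deriv i \<phi> x *\<^sub>R u x \<partial>lborel) = - (\<integral>x. \<phi> x *\<^sub>R g x \<partial>lborel))"

text \<open>The choice is unique up to null sets (\<open>has_weak_deriv_unique\<close> below) and depends only on the
  almost everywhere class of \<open>u\<close> (\<open>weak_deriv_cong\<close> below).\<close>

definition weak_deriv :: "'a::euclidean_space \<Rightarrow> ('a \<Rightarrow> complex) \<Rightarrow> 'a \<Rightarrow> complex" where
  "weak_deriv i u = (SOME g. has_weak_deriv i u g)"

definition H1 :: "('a::euclidean_space \<Rightarrow> complex) set" where
  "H1 = {u \<in> L2. \<forall>i\<in>Basis. \<exists>g. has_weak_deriv i u g}"

definition H2 :: "('a::euclidean_space \<Rightarrow> complex) set" where
  "H2 = {u \<in> H1. \<forall>i\<in>Basis. weak_deriv i u \<in> H1}"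

lemma Ck_continuous: "Ck k f \<Longrightarrow> continuous_on UNIV f"
  by (cases k) (auto simp: continuous_on_eq_continuous_at differentiable_imp_continuous_within)

lemma Ck_Suc_D: "Ck (Suc k) f \<Longrightarrow> Ck k f"
proof (induction k arbitrary: f)
  case 0 then show ?case using Ck_continuous[of "Suc 0" f] by simp
next
  case (Suc k) then show ?case by (metis Ck.simps(2))
qed

lemma partial_deriv_eq:
  assumes "(f has_derivative D) (at x)" shows "partial_deriv i f x = D i"
  using frechet_derivative_at[OF assms] by (simp add: partial_deriv_def)

lemma has_derivative_partial:
  assumes "f differentiable (at x)"
  shows "(f has_derivative (\<lambda>h. partial_deriv h f x)) (at x)"
  using assms unfolding partial_deriv_def by (simp add: frechet_derivative_works)

lemma Ck_const: "Ck k (\<lambda>x::'a::euclidean_space. c)"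
proof (induction k arbitrary: c)
  case (Suc k)
  have "partial_deriv i (\<lambda>x::'a. c) = (\<lambda>x. 0)" for i
    by (rule ext) (rule partial_deriv_eq[of _ "\<lambda>_. 0"], simp)
  then show ?case using Suc by simp
qed simp

lemma Ck_add: "Ck k f \<Longrightarrow> Ck k g \<Longrightarrow> Ck k (\<lambda>x. f x + g x)"
proof (induction k arbitrary: f g)
  case 0 then show ?case by (auto intro: continuous_intros)
next
  case (Suc k)
  have "partial_deriv i (\<lambda>x. f x + g x) = (\<lambda>x. partial_deriv i f x + partial_deriv i g x)" for i
    by (rule ext, rule partial_deriv_eq, intro has_derivative_add has_derivative_partial)
       (use Suc.prems in auto)
  then show ?case using Suc by simp
qed

lemma Ck_mult: "Ck k f \<Longrightarrow> Ck k g \<Longrightarrow> Ck k (\<lambda>x. f x * g x)"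
proof (induction k arbitrary: f g)
  case 0 then show ?case by (auto intro: continuous_intros)
next
  case (Suc k)
  have eq: "partial_deriv i (\<lambda>x. f x * g x) = (\<lambda>x. f x * partial_deriv i g x + partial_deriv i f x * g x)" for i
    by (rule ext, rule partial_deriv_eq, intro has_derivative_mult has_derivative_partial)
       (use Suc.prems in auto)
  have "Ck k f" "Ck k g" using Suc.prems Ck_Suc_D by auto
  then show ?case using Suc by (simp add: eq Ck_add)
qed

lemma Ck_prod: "finite I \<Longrightarrow> (\<And>i. i \<in> I \<Longrightarrow> Ck k (f i)) \<Longrightarrow> Ck k (\<lambda>x. \<Prod>i\<in>I. f i x)"
  by (induction I rule: finite_induct) (auto intro: Ck_const Ck_mult)

lemma Ck_power: "Ck k f \<Longrightarrow> Ck k (\<lambda>x. f x ^ n)"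
  by (induction n) (auto intro: Ck_const Ck_mult)

text \<open>The functions \<open>exp (- 1/t) / t ^ n\<close>, extended by 0 to \<open>t \<le> 0\<close>; they are closed under
  differentiation up to linear combinations, and yield bump functions.\<close>

definition flat :: "nat \<Rightarrow> real \<Rightarrow> real" where
  "flat n t = (if t \<le> 0 then 0 else inverse t ^ n * exp (- inverse t))"

lemma flat_limit: "((\<lambda>t. flat n t) \<longlongrightarrow> 0) (at 0)"
proof (rule filterlim_split_at_real)
  have "\<forall>\<^sub>F t in at_left 0. flat n t = 0"
    by (auto simp: flat_def eventually_at_filter)
  then show "(flat n \<longlongrightarrow> 0) (at_left 0)" by (simp add: tendsto_eventually)
  have "((\<lambda>t::real. inverse t ^ n / exp (inverse t)) \<longlongrightarrow> 0) (at_right 0)"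
    by (rule filterlim_compose[OF tendsto_power_div_exp_0 filterlim_inverse_at_top_right])
  moreover have "\<forall>\<^sub>F t in at_right 0. inverse t ^ n / exp (inverse t) = flat n t"
    by (auto simp: flat_def eventually_at_filter exp_minus field_simps)
  ultimately show "(flat n \<longlongrightarrow> 0) (at_right 0)" using filterlim_cong by fast
qed

lemma flat_deriv:
  "(flat n has_real_derivative (flat (n+2) t - real n * flat (n+1) t)) (at t)"
proof -
  consider "t < 0" | "t = 0" | "t > 0" by linarith
  then show ?thesis
  proof cases
    case 1
    have "((\<lambda>t. 0::real) has_real_derivative 0) (at t)" by simp
    then have "(flat n has_real_derivative 0) (at t)"
      by (rule has_field_derivative_transform_within_open[where S="{..<0}"])
         (use 1 in \<open>auto simp: flat_def\<close>)
    then show ?thesis using 1 by (simp add: flat_def)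
  next
    case 2
    have "\<forall>\<^sub>F h in at (0::real). flat (Suc n) h = (flat n (0+h) - flat n 0) / h"
      by (auto simp: flat_def eventually_at_filter field_simps)
    then have "(flat n has_real_derivative 0) (at 0)"
      unfolding DERIV_def using flat_limit[of "Suc n"] filterlim_cong by fast
    then show ?thesis using 2 by (simp add: flat_def)
  next
    case 3
    have "((\<lambda>t. inverse t ^ n * exp (- inverse t)) has_real_derivative
        (flat (n+2) t - real n * flat (n+1) t)) (at t)"
    proof (cases n)
      case 0
      then show ?thesis using 3 by (auto intro!: derivative_eq_intros simp: flat_def)
    next
      case (Suc m)
      have "(inverse has_real_derivative - (inverse t)\<^sup>2) (at t)"
        using 3 by (auto intro!: derivative_eq_intros simp: power2_eq_square)
      note pw = DERIV_power_Suc[OF this, of m]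
      have ex: "((\<lambda>t. exp (- inverse t)) has_real_derivative exp (- inverse t) * (inverse t)\<^sup>2) (at t)"
        using 3 by (auto intro!: derivative_eq_intros simp: power2_eq_square)
      from DERIV_mult[OF pw ex]
      show ?thesis using 3 Suc by (simp add: flat_def field_simps power2_eq_square)
    qed
    then show ?thesis
      by (rule has_field_derivative_transform_within_open[where S="{0<..}"])
         (use 3 in \<open>auto simp: flat_def\<close>)
  qed
qed

lemma Ck_flat: "Ck k (\<lambda>x::'a::euclidean_space. flat n (c * (x \<bullet> b) + d))"
proof (induction k arbitrary: n)
  case 0
  have "isCont (flat n) t" for t using flat_deriv DERIV_isCont by blast
  then have "continuous_on UNIV (flat n)" by (simp add: continuous_on_eq_continuous_at)
  then have "continuous_on UNIV (\<lambda>x::'a. flat n (c * (x \<bullet> b) + d))"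
    by (rule continuous_on_compose2) (auto intro!: continuous_intros)
  then show ?case by simp
next
  case (Suc k)
  let ?a = "\<lambda>x::'a. c * (x \<bullet> b) + d"
  have D: "((\<lambda>x. flat n (?a x)) has_derivative
      (\<lambda>h. (flat (n+2) (?a x) - real n * flat (n+1) (?a x)) * (c * (h \<bullet> b)))) (at x)" for x
  proof -
    have "(?a has_derivative (\<lambda>h. c * (h \<bullet> b))) (at x)"
      by (auto intro!: derivative_eq_intros)
    from has_derivative_compose[OF this flat_deriv[of n "?a x", unfolded has_field_derivative_def]]
    show ?thesis .
  qed
  have eq: "partial_deriv i (\<lambda>x. flat n (?a x)) =
    (\<lambda>x. (flat (n+2) (?a x) + (- real n) * flat (n+1) (?a x)) * (c * (i \<bullet> b)))" for i
    by (rule ext) (simp add: partial_deriv_eq[OF D])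
  show ?case
    unfolding Ck.simps eq
    by (intro conjI allI ballI Ck_mult Ck_add Ck_const Suc) (use D in \<open>auto simp: differentiable_def\<close>)
qed

lemma partial_deriv_eq_0:
  assumes "x \<notin> closure {x. f x \<noteq> 0}" shows "partial_deriv i f x = 0"
proof -
  have "((\<lambda>x. 0) has_derivative (\<lambda>h. 0)) (at x)" by simp
  then have "(f has_derivative (\<lambda>h. 0)) (at x)"
    by (rule has_derivative_transform_within_open[where s="- closure {x. f x \<noteq> 0}"])
       (use assms closure_subset[of "{x. f x \<noteq> 0}"] in auto)
  then show ?thesis by (rule partial_deriv_eq)
qed

lemma compact_support_L2:
  fixes f :: "'a::euclidean_space \<Rightarrow> real"
  assumes "continuous_on UNIV f" "compact K" "\<And>x. x \<notin> K \<Longrightarrow> f x = 0"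
  shows "f \<in> borel_measurable lborel" "integrable lborel (\<lambda>x. (f x)\<^sup>2)"
proof -
  show "f \<in> borel_measurable lborel"
    using borel_measurable_continuous_onI[OF assms(1)] by simp
  have "continuous_on K (\<lambda>x. (f x)\<^sup>2)"
    by (intro continuous_intros continuous_on_subset[OF assms(1)]) auto
  then have "integrable lborel (\<lambda>x. indicator K x *\<^sub>R (f x)\<^sup>2)"
    by (rule borel_integrable_compact[OF assms(2)])
  moreover have "(\<lambda>x. indicator K x *\<^sub>R (f x)\<^sup>2) = (\<lambda>x. (f x)\<^sup>2)"
    by (rule ext) (use assms(3) in \<open>auto simp: indicator_def\<close>)
  ultimately show "integrable lborel (\<lambda>x. (f x)\<^sup>2)" by simp
qed

lemma test_function_L2:
  assumes "test_function \<phi>"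
  shows "\<phi> \<in> borel_measurable lborel" "integrable lborel (\<lambda>x. (\<phi> x)\<^sup>2)"
proof -
  have *: "continuous_on UNIV \<phi>" using assms Ck_continuous unfolding test_function_def by blast
  have "\<phi> x = 0" if "x \<notin> closure {x. \<phi> x \<noteq> 0}" for x
    using that closure_subset[of "{x. \<phi> x \<noteq> 0}"] by auto
  with compact_support_L2[OF *, of "closure {x. \<phi> x \<noteq> 0}"] assms
  show "\<phi> \<in> borel_measurable lborel" "integrable lborel (\<lambda>x. (\<phi> x)\<^sup>2)"
    unfolding test_function_def by blast+
qed

lemma test_function_partial_L2:
  assumes "test_function \<phi>" "i \<in> Basis"
  shows "partial_deriv i \<phi> \<in> borel_measurable lborel" "integrable lborel (\<lambda>x. (partial_deriv i \<phi> x)\<^sup>2)"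
proof -
  have "Ck (Suc 0) \<phi>" using assms(1) unfolding test_function_def by blast
  then have *: "continuous_on UNIV (partial_deriv i \<phi>)" using assms(2) by simp
  from compact_support_L2[OF *, of "closure {x. \<phi> x \<noteq> 0}"] assms(1) partial_deriv_eq_0
  show "partial_deriv i \<phi> \<in> borel_measurable lborel" "integrable lborel (\<lambda>x. (partial_deriv i \<phi> x)\<^sup>2)"
    unfolding test_function_def by blast+
qed

lemma L2_scaleR_integrable:
  fixes f :: "'a::euclidean_space \<Rightarrow> real"
  assumes "f \<in> borel_measurable lborel" "integrable lborel (\<lambda>x. (f x)\<^sup>2)" "u \<in> L2"
  shows "integrable lborel (\<lambda>x. f x *\<^sub>R u x)"
proof (rule Bochner_Integration.integrable_bound)
  show "integrable lborel (\<lambda>x. (f x)\<^sup>2 + (norm (u x))\<^sup>2)"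
    using assms by (auto simp: L2_def)
  show "(\<lambda>x. f x *\<^sub>R u x) \<in> borel_measurable lborel"
    using assms by (auto simp: L2_def)
  have "norm (f x *\<^sub>R u x) \<le> (f x)\<^sup>2 + (norm (u x))\<^sup>2" for x
  proof -
    have "0 \<le> (\<bar>f x\<bar> - norm (u x))\<^sup>2" by simp
    moreover have "0 \<le> \<bar>f x\<bar> * norm (u x)" by simp
    ultimately show ?thesis unfolding norm_scaleR power2_diff power2_abs by linarith
  qed
  then show "AE x in lborel. norm (f x *\<^sub>R u x) \<le> norm ((f x)\<^sup>2 + (norm (u x))\<^sup>2)" by simp
qed

lemma L2_integrable_inner:
  assumes "u \<in> L2" "v \<in> L2"
  shows "integrable lborel (\<lambda>x. u x \<bullet> v x)"
proof (rule Bochner_Integration.integrable_bound)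
  show "integrable lborel (\<lambda>x. (norm (u x))\<^sup>2 + (norm (v x))\<^sup>2)"
    using assms by (auto simp: L2_def)
  show "(\<lambda>x. u x \<bullet> v x) \<in> borel_measurable lborel"
    using assms by (auto simp: L2_def)
  have "norm (u x \<bullet> v x) \<le> (norm (u x))\<^sup>2 + (norm (v x))\<^sup>2" for x
  proof -
    have "0 \<le> (norm (u x) - norm (v x))\<^sup>2" by simp
    moreover have "0 \<le> norm (u x) * norm (v x)" by simp
    ultimately show ?thesis using Cauchy_Schwarz_ineq2[of "u x" "v x"]
      unfolding real_norm_def power2_diff by linarith
  qed
  then show "AE x in lborel. norm (u x \<bullet> v x) \<le> norm ((norm (u x))\<^sup>2 + (norm (v x))\<^sup>2)" by simp
qed

lemma L2_add: assumes "u \<in> L2" "v \<in> L2" shows "(\<lambda>x. u x + v x) \<in> L2"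
proof -
  have "integrable lborel (\<lambda>x. (norm (u x))\<^sup>2 + 2 * (u x \<bullet> v x) + (norm (v x))\<^sup>2)"
    using assms L2_integrable_inner[OF assms] by (auto simp: L2_def)
  moreover have "(\<lambda>x. (norm (u x))\<^sup>2 + 2 * (u x \<bullet> v x) + (norm (v x))\<^sup>2) = (\<lambda>x. (norm (u x + v x))\<^sup>2)"
    by (simp add: power2_norm_eq_inner inner_add_left inner_add_right inner_commute fun_eq_iff)
  ultimately show ?thesis using assms by (auto simp: L2_def)
qed

lemma L2_scaleR: "u \<in> L2 \<Longrightarrow> (\<lambda>x. c *\<^sub>R u x) \<in> L2"
  by (auto simp: L2_def power_mult_distrib)

lemma L2_zero: "(\<lambda>x. 0) \<in> L2"
  by (auto simp: L2_def)

lemma L2_cong_AE: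
  assumes "u \<in> L2" "v \<in> borel_measurable lborel" "AE x in lborel. u x = v x" shows "v \<in> L2"
proof -
  have [measurable]: "u \<in> borel_measurable lborel" "v \<in> borel_measurable lborel"
    using assms by (auto simp: L2_def)
  have "integrable lborel (\<lambda>x. (norm (u x))\<^sup>2) = integrable lborel (\<lambda>x. (norm (v x))\<^sup>2)"
    by (rule integrable_cong_AE) (use assms(3) in auto)
  then show ?thesis using assms by (auto simp: L2_def)
qed

text \<open>The fundamental lemma of the calculus of variations: weak derivatives are unique.\<close>

lemma box_bump_test_function:
  fixes a b :: "'a::euclidean_space"
  obtains h :: "nat \<Rightarrow> 'a \<Rightarrow> real" where
    "\<And>n. test_function (h n)" "\<And>n x. x \<notin> box a b \<Longrightarrow> h n x = 0"
    "\<And>n x. 0 \<le> h n x \<and> h n x \<le> 1" "\<And>x. x \<in> box a b \<Longrightarrow> (\<lambda>n. h n x) \<longlonglongrightarrow> 1"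
proof
  define g where "g x = (\<Prod>i\<in>Basis. flat 0 (1 * (x \<bullet> i) + (- (a \<bullet> i))) * flat 0 ((-1) * (x \<bullet> i) + b \<bullet> i))" for x :: 'a
  define h where "h n x = 1 + (-1) * (1 + (-1) * g x) ^ n" for n x
  have f01: "0 \<le> flat 0 t \<and> flat 0 t \<le> 1" for t by (auto simp: flat_def)
  have g01: "0 \<le> g x \<and> g x \<le> 1" for x unfolding g_def
    using f01 by (auto intro!: prod_nonneg prod_le_1 mult_nonneg_nonneg mult_le_one)
  have g0: "g x = 0" if "x \<notin> box a b" for x
  proof -
    from that obtain i where i: "i \<in> Basis" "\<not> (a \<bullet> i < x \<bullet> i \<and> x \<bullet> i < b \<bullet> i)"
      by (auto simp: mem_box)
    have "flat 0 (1 * (x \<bullet> i) + (- (a \<bullet> i))) * flat 0 ((-1) * (x \<bullet> i) + b \<bullet> i) = 0"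
      using i(2) by (auto simp: flat_def)
    then show ?thesis using i(1) unfolding g_def by (meson finite_Basis prod_zero_iff)
  qed
  have gpos: "g x > 0" if "x \<in> box a b" for x
    unfolding g_def by (rule prod_pos) (use that in \<open>auto simp: mem_box flat_def\<close>)
  show z: "h n x = 0" if "x \<notin> box a b" for n x
    using g0[OF that] by (simp add: h_def)
  show "0 \<le> h n x \<and> h n x \<le> 1" for n x
    using g01[of x] by (auto simp: h_def power_le_one)
  show "(\<lambda>n. h n x) \<longlonglongrightarrow> 1" if "x \<in> box a b" for x
  proof -
    have "(\<lambda>n. (1 - g x) ^ n) \<longlonglongrightarrow> 0"
      using gpos[OF that] g01[of x] by (intro LIMSEQ_realpow_zero) auto
    from tendsto_diff[OF tendsto_const[of 1] this] show ?thesis by (simp add: h_def)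
  qed
  show "test_function (h n)" for n
  proof -
    have "Ck k (h n)" for k unfolding h_def g_def
      by (intro Ck_add Ck_mult Ck_const Ck_power Ck_prod Ck_flat finite_Basis)
    moreover have "{x. h n x \<noteq> 0} \<subseteq> cbox a b" using z box_subset_cbox by blast
    then have "compact (closure {x. h n x \<noteq> 0})"
      by (metis bounded_cbox bounded_subset compact_closure)
    ultimately show ?thesis by (auto simp: test_function_def)
  qed
qed

lemma fundamental_lemma:
  fixes g :: "'a::euclidean_space \<Rightarrow> complex"
  assumes "g \<in> L2" "\<And>\<phi>. test_function \<phi> \<Longrightarrow> (\<integral>x. \<phi> x *\<^sub>R g x \<partial>lborel) = 0"
  shows "AE x in lborel. g x = 0"
proof -
  have [measurable]: "g \<in> borel_measurable lborel" using assms by (auto simp: L2_def)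
  have ind: "integrable lborel (\<lambda>x. indicator (box a b) x *\<^sub>R g x)" for a b :: 'a
  proof (rule L2_scaleR_integrable[OF _ _ assms(1)])
    have "(\<lambda>x. (indicator (box a b) x)\<^sup>2) = (indicator (box a b) :: 'a \<Rightarrow> real)"
      by (auto simp: indicator_def)
    then show "integrable lborel (\<lambda>x. (indicator (box a b) x :: real)\<^sup>2)"
      using emeasure_lborel_box_finite[of a b] by (simp add: integrable_indicator_iff less_top)
  qed simp
  have box0: "(\<integral>x. indicator (box a b) x *\<^sub>R g x \<partial>lborel) = 0" for a b :: 'a
  proof -
    obtain h :: "nat \<Rightarrow> 'a \<Rightarrow> real" where h: "\<And>n. test_function (h n)" "\<And>n x. x \<notin> box a b \<Longrightarrow> h n x = 0"
      "\<And>n x. 0 \<le> h n x \<and> h n x \<le> 1" "\<And>x. x \<in> box a b \<Longrightarrow> (\<lambda>n. h n x) \<longlonglongrightarrow> 1"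
      using box_bump_test_function by metis
    have [measurable]: "h n \<in> borel_measurable lborel" for n
      using test_function_L2 h(1) by blast
    have "(\<lambda>n. \<integral>x. h n x *\<^sub>R g x \<partial>lborel) \<longlonglongrightarrow> (\<integral>x. indicator (box a b) x *\<^sub>R g x \<partial>lborel)"
    proof (rule integral_dominated_convergence[where w="\<lambda>x. norm (indicator (box a b) x *\<^sub>R g x)"])
      show "integrable lborel (\<lambda>x. norm (indicator (box a b) x *\<^sub>R g x))"
        by (rule integrable_norm[OF ind])
      show "AE x in lborel. (\<lambda>n. h n x *\<^sub>R g x) \<longlonglongrightarrow> indicator (box a b) x *\<^sub>R g x"
      proof (rule AE_I2)
        fix x show "(\<lambda>n. h n x *\<^sub>R g x) \<longlonglongrightarrow> indicator (box a b) x *\<^sub>R g x"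
          using tendsto_scaleR[OF h(4)[of x] tendsto_const[of "g x"]] h(2)[of x]
          by (cases "x \<in> box a b") auto
      qed
      show "AE x in lborel. norm (h n x *\<^sub>R g x) \<le> norm (indicator (box a b) x *\<^sub>R g x)" for n
      proof (rule AE_I2)
        fix x show "norm (h n x *\<^sub>R g x) \<le> norm (indicator (box a b) x *\<^sub>R g x)"
          using h(2)[of x n] h(3)[of n x]
          by (cases "x \<in> box a b") (auto intro: mult_left_le_one_le)
      qed
    qed auto
    then show ?thesis using assms(2)[OF h(1)] LIMSEQ_unique[OF tendsto_const] by fastforce
  qed
  have local0: "AE x in lborel. x \<in> box a b \<longrightarrow> g x = 0" for a b :: 'a
  proof -
    define f where "f = (\<lambda>x. indicator (box a b) x *\<^sub>R g x)"
    have f: "integrable lborel f" unfolding f_def by (rule ind)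
    have fb: "set_lebesgue_integral lborel (box c d) f = 0" for c d
    proof -
      have "(\<lambda>x. indicator (box c d) x *\<^sub>R f x) = (\<lambda>x. indicator (box c d \<inter> box a b) x *\<^sub>R g x)"
        by (auto simp: f_def indicator_def)
      moreover obtain c' d' where "box c d \<inter> box a b = box c' d'" using box_Int_box[of c d a b] that by blast
      ultimately show ?thesis using box0 by (simp add: set_lebesgue_integral_def)
    qed
    have sets_eq: "sets lborel = sigma_sets UNIV (range (\<lambda>(a, b). box a b :: 'a set))"
      unfolding sets_lborel by (subst borel_eq_box) (simp)
    have fUN: "set_lebesgue_integral lborel (UNIV::'a set) f = 0"
      using box0 by (simp add: set_lebesgue_integral_def f_def)
    have si: "set_integrable lborel A f" if "A \<in> sets lborel" for A
      using f that by (simp add: set_integrable_def integrable_mult_indicator)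
    have stable: "Int_stable (range (\<lambda>(a, b). box a b :: 'a set))"
      by (auto simp: Int_stable_def box_Int_box)
    have "set_lebesgue_integral lborel A f = 0" if "A \<in> sets lborel" for A
      using stable subset_UNIV[of "range (\<lambda>(a, b). box a b :: 'a set)", folded Pow_UNIV] that[unfolded sets_eq]
    proof (induction A rule: sigma_sets_induct_disjoint)
      fix A assume "A \<in> range (\<lambda>(a, b). box a b :: 'a set)"
      then show "set_lebesgue_integral lborel A f = 0" using fb by auto
    next
      fix A :: "'a set" assume A: "A \<in> sigma_sets UNIV (range (\<lambda>(a, b). box a b))" "set_lebesgue_integral lborel A f = 0"
      then have "A \<in> sets lborel" using sets_eq by blast
      then have "set_lebesgue_integral lborel (A \<union> (UNIV - A)) f =
          set_lebesgue_integral lborel A f + set_lebesgue_integral lborel (UNIV - A) f"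
        by (intro set_integral_Un si) auto
      then show "set_lebesgue_integral lborel (UNIV - A) f = 0" using A fUN by simp
    next
      fix A :: "nat \<Rightarrow> 'a set"
      assume A: "disjoint_family A" "range A \<subseteq> sigma_sets UNIV (range (\<lambda>(a, b). box a b))"
        "\<And>i. set_lebesgue_integral lborel (A i) f = 0"
      then have "\<And>i. A i \<in> sets lborel" using sets_eq by blast
      then have "set_lebesgue_integral lborel (\<Union>i. A i) f = (\<Sum>i. set_lebesgue_integral lborel (A i) f)"
        using A(1) by (intro lebesgue_integral_countable_add si) (auto simp: disjoint_family_on_def)
      then show "set_lebesgue_integral lborel (\<Union>i. A i) f = 0" using A(3) by simp
    qed (auto simp: set_lebesgue_integral_def)
    then have "AE x in lborel. f x = (\<lambda>_. 0) x"
      by (intro sigma_finite_measure.density_unique_banach[OF lborel.sigma_finite_measure_axioms] f) (auto simp: set_lebesgue_integral_def)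
    then show ?thesis by (rule AE_mp) (auto simp: f_def indicator_def)
  qed
  have "AE x in lborel. \<forall>n::nat. x \<in> box (- (real n *\<^sub>R One)) (real n *\<^sub>R One) \<longrightarrow> g x = 0"
    unfolding AE_all_countable using local0 by blast
  then show ?thesis
  proof (rule AE_mp, intro AE_I2 impI)
    fix x :: 'a assume *: "\<forall>n::nat. x \<in> box (- (real n *\<^sub>R One)) (real n *\<^sub>R One) \<longrightarrow> g x = 0"
    have "x \<in> (\<Union>n::nat. box (- (real n *\<^sub>R One)) (real n *\<^sub>R One))"
      using UN_box_eq_UNIV by blast
    then show "g x = 0" using * by blast
  qed
qed

lemma has_weak_deriv_unique:
  assumes "has_weak_deriv i u g" "has_weak_deriv i u g'"
  shows "AE x in lborel. g x = g' x"
proof -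
  have L: "g \<in> L2" "g' \<in> L2" using assms by (auto simp: has_weak_deriv_def)
  have "AE x in lborel. g x + (-1) *\<^sub>R g' x = 0"
  proof (rule fundamental_lemma)
    show "(\<lambda>x. g x + (-1) *\<^sub>R g' x) \<in> L2" using L by (intro L2_add L2_scaleR)
    fix \<phi> :: "'a \<Rightarrow> real" assume t: "test_function \<phi>"
    note I = L2_scaleR_integrable[OF test_function_L2[OF t]]
    have "(\<integral>x. \<phi> x *\<^sub>R g x \<partial>lborel) = (\<integral>x. \<phi> x *\<^sub>R g' x \<partial>lborel)"
      using assms t unfolding has_weak_deriv_def by (metis neg_equal_iff_equal)
    then show "(\<integral>x. \<phi> x *\<^sub>R (g x + (-1) *\<^sub>R g' x) \<partial>lborel) = 0"
      using I[OF L(1)] I[OF L(2)] by (simp add: scaleR_diff_right)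
  qed
  then show ?thesis by auto
qed

lemma has_weak_deriv_cong:
  assumes "has_weak_deriv i u g" "AE x in lborel. u x = v x" "v \<in> L2"
    "AE x in lborel. g x = h x" "h \<in> L2" "i \<in> Basis"
  shows "has_weak_deriv i v h"
proof -
  have [measurable]: "u \<in> borel_measurable lborel" "v \<in> borel_measurable lborel"
     "g \<in> borel_measurable lborel" "h \<in> borel_measurable lborel"
    using assms by (auto simp: L2_def has_weak_deriv_def)
  show ?thesis
    unfolding has_weak_deriv_def
  proof (intro conjI allI impI assms)
    fix \<phi> :: "'a \<Rightarrow> real" assume t: "test_function \<phi>"
    have [measurable]: "\<phi> \<in> borel_measurable lborel" "partial_deriv i \<phi> \<in> borel_measurable lborel"
      using test_function_L2[OF t] test_function_partial_L2[OF t] assms by auto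
    have "(\<integral>x. partial_deriv i \<phi> x *\<^sub>R v x \<partial>lborel) = (\<integral>x. partial_deriv i \<phi> x *\<^sub>R u x \<partial>lborel)"
      by (rule integral_cong_AE) (use assms(2) in auto)
    moreover have "(\<integral>x. \<phi> x *\<^sub>R h x \<partial>lborel) = (\<integral>x. \<phi> x *\<^sub>R g x \<partial>lborel)"
      by (rule integral_cong_AE) (use assms(4) in auto)
    ultimately show "(\<integral>x. partial_deriv i \<phi> x *\<^sub>R v x \<partial>lborel) = - (\<integral>x. \<phi> x *\<^sub>R h x \<partial>lborel)"
      using assms(1) t by (simp add: has_weak_deriv_def)
  qed
qed

lemma has_weak_deriv_zero: "has_weak_deriv i (\<lambda>x. 0) (\<lambda>x. 0)"
  by (simp add: has_weak_deriv_def L2_zero)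

lemma has_weak_deriv_scaleR:
  assumes "has_weak_deriv i u g"
  shows "has_weak_deriv i (\<lambda>x. c *\<^sub>R u x) (\<lambda>x. c *\<^sub>R g x)"
  using assms unfolding has_weak_deriv_def
  by (simp add: L2_scaleR scaleR_left_commute[of _ c] del: scaleR_scaleR)

lemma has_weak_deriv_add:
  assumes "has_weak_deriv i u g" "has_weak_deriv i v h" "i \<in> Basis"
  shows "has_weak_deriv i (\<lambda>x. u x + v x) (\<lambda>x. g x + h x)"
proof -
  have L: "u \<in> L2" "v \<in> L2" "g \<in> L2" "h \<in> L2"
    using assms by (auto simp: has_weak_deriv_def)
  show ?thesis unfolding has_weak_deriv_def
  proof (intro conjI allI impI L2_add L)
    fix \<phi> :: "'a \<Rightarrow> real" assume t: "test_function \<phi>"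
    note I = L2_scaleR_integrable[OF test_function_L2[OF t]]
      L2_scaleR_integrable[OF test_function_partial_L2[OF t assms(3)]]
    show "(\<integral>x. partial_deriv i \<phi> x *\<^sub>R (u x + v x) \<partial>lborel) = - (\<integral>x. \<phi> x *\<^sub>R (g x + h x) \<partial>lborel)"
      using assms(1,2) t I L by (simp add: has_weak_deriv_def scaleR_add_right)
  qed
qed

lemma has_weak_deriv_weak_deriv:
  "u \<in> H1 \<Longrightarrow> i \<in> Basis \<Longrightarrow> has_weak_deriv i u (weak_deriv i u)"
  using someI_ex[of "has_weak_deriv i u"] by (simp add: H1_def weak_deriv_def)

lemma weak_deriv_L2: "u \<in> H1 \<Longrightarrow> i \<in> Basis \<Longrightarrow> weak_deriv i u \<in> L2"
  using has_weak_deriv_weak_deriv by (auto simp: has_weak_deriv_def)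

lemma weak_deriv_eqI:
  assumes "has_weak_deriv i u g" shows "AE x in lborel. weak_deriv i u x = g x"
  using has_weak_deriv_unique[OF someI[of "has_weak_deriv i u", OF assms] assms]
  by (simp add: weak_deriv_def)

lemma weak_deriv_cong:
  assumes "u \<in> L2" "v \<in> L2" "AE x in lborel. u x = v x" "i \<in> Basis"
  shows "weak_deriv i u = weak_deriv i v"
proof -
  have "has_weak_deriv i v g" if "has_weak_deriv i u g" "AE x in lborel. u x = v x" "v \<in> L2" for u v g
  proof -
    have "g \<in> L2" using that(1) by (simp add: has_weak_deriv_def)
    then show ?thesis using has_weak_deriv_cong[OF that] assms(4) by simp
  qed
  moreover have "AE x in lborel. v x = u x" using assms(3) by auto
  ultimately have "has_weak_deriv i u = has_weak_deriv i v"
    using assms(1,2,3) by (intro ext iffI) blast+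
  then show ?thesis by (simp add: weak_deriv_def)
qed

lemma H1_cong:
  assumes "u \<in> H1" "v \<in> L2" "AE x in lborel. u x = v x"
  shows "v \<in> H1"
proof -
  have "has_weak_deriv i v (weak_deriv i u)" if "i \<in> Basis" for i
    using has_weak_deriv_cong[OF has_weak_deriv_weak_deriv[OF assms(1) that] assms(3,2) _ _ that]
      weak_deriv_L2[OF assms(1) that] by simp
  then show ?thesis using assms(2) by (auto simp: H1_def)
qed

lemma H1_zero: "(\<lambda>x. 0) \<in> H1"
  using has_weak_deriv_zero by (auto simp: H1_def L2_zero)

lemma H1_add: "u \<in> H1 \<Longrightarrow> v \<in> H1 \<Longrightarrow> (\<lambda>x. u x + v x) \<in> H1"
  unfolding H1_def by (blast intro: L2_add has_weak_deriv_add)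

lemma H1_scaleR: "u \<in> H1 \<Longrightarrow> (\<lambda>x. c *\<^sub>R u x) \<in> H1"
  unfolding H1_def by (blast intro: L2_scaleR has_weak_deriv_scaleR)

lemma H1_L2: "u \<in> H1 \<Longrightarrow> u \<in> L2" by (simp add: H1_def)

lemma weak_deriv_zero: "i \<in> Basis \<Longrightarrow> AE x in lborel. weak_deriv i (\<lambda>x. 0) x = 0"
  using weak_deriv_eqI[OF has_weak_deriv_zero] .

lemma weak_deriv_add:
  "u \<in> H1 \<Longrightarrow> v \<in> H1 \<Longrightarrow> i \<in> Basis \<Longrightarrow>
    AE x in lborel. weak_deriv i (\<lambda>x. u x + v x) x = weak_deriv i u x + weak_deriv i v x"
  by (intro weak_deriv_eqI has_weak_deriv_add has_weak_deriv_weak_deriv)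

lemma weak_deriv_scaleR:
  "u \<in> H1 \<Longrightarrow> i \<in> Basis \<Longrightarrow>
    AE x in lborel. weak_deriv i (\<lambda>x. c *\<^sub>R u x) x = c *\<^sub>R weak_deriv i u x"
  by (intro weak_deriv_eqI has_weak_deriv_scaleR has_weak_deriv_weak_deriv)

lemma H2_H1: "u \<in> H2 \<Longrightarrow> u \<in> H1"
  and H2_weak_deriv: "u \<in> H2 \<Longrightarrow> i \<in> Basis \<Longrightarrow> weak_deriv i u \<in> H1"
  by (auto simp: H2_def)

lemma AE_sym: "AE x in M. f x = g x \<Longrightarrow> AE x in M. g x = f x"
  by auto

lemma weak_deriv_add_H1:
  "u \<in> H2 \<Longrightarrow> v \<in> H2 \<Longrightarrow> i \<in> Basis \<Longrightarrow> weak_deriv i (\<lambda>x. u x + v x) \<in> H1"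
  by (rule H1_cong[OF H1_add[of "weak_deriv i u" "weak_deriv i v"] _ AE_sym[OF weak_deriv_add]])
     (simp_all add: H2_H1 H2_weak_deriv H1_add weak_deriv_L2)

lemma weak_deriv_scaleR_H1:
  "u \<in> H2 \<Longrightarrow> i \<in> Basis \<Longrightarrow> weak_deriv i (\<lambda>x. c *\<^sub>R u x) \<in> H1"
  by (rule H1_cong[OF H1_scaleR[of "weak_deriv i u"] _ AE_sym[OF weak_deriv_scaleR]])
     (simp_all add: H2_H1 H2_weak_deriv H1_scaleR weak_deriv_L2)

lemma H2_zero: "(\<lambda>x. 0) \<in> H2"
  unfolding H2_def
  by (auto intro!: H1_zero H1_cong[OF H1_zero] weak_deriv_L2 AE_sym weak_deriv_zero)

lemma H2_add: "u \<in> H2 \<Longrightarrow> v \<in> H2 \<Longrightarrow> (\<lambda>x. u x + v x) \<in> H2"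
  using weak_deriv_add_H1 H1_add by (auto simp: H2_def)

lemma H2_scaleR: "u \<in> H2 \<Longrightarrow> (\<lambda>x. c *\<^sub>R u x) \<in> H2"
  using weak_deriv_scaleR_H1 H1_scaleR by (auto simp: H2_def)

lemma weak_deriv2_add:
  assumes "u \<in> H2" "v \<in> H2" "i \<in> Basis" "j \<in> Basis"
  shows "AE x in lborel. weak_deriv j (weak_deriv i (\<lambda>x. u x + v x)) x =
           weak_deriv j (weak_deriv i u) x + weak_deriv j (weak_deriv i v) x"
proof -
  note [simp] = assms H2_weak_deriv H2_H1 H1_add weak_deriv_add_H1
  have "weak_deriv j (weak_deriv i (\<lambda>x. u x + v x)) = weak_deriv j (\<lambda>x. weak_deriv i u x + weak_deriv i v x)"
    by (rule weak_deriv_cong) (auto intro!: H1_L2 weak_deriv_add)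
  then show ?thesis using weak_deriv_add[of "weak_deriv i u" "weak_deriv i v" j] by simp
qed

lemma weak_deriv2_scaleR:
  assumes "u \<in> H2" "i \<in> Basis" "j \<in> Basis"
  shows "AE x in lborel. weak_deriv j (weak_deriv i (\<lambda>x. c *\<^sub>R u x)) x = c *\<^sub>R weak_deriv j (weak_deriv i u) x"
proof -
  note [simp] = assms H2_weak_deriv H2_H1 H1_scaleR weak_deriv_scaleR_H1
  have "weak_deriv j (weak_deriv i (\<lambda>x. c *\<^sub>R u x)) = weak_deriv j (\<lambda>x. c *\<^sub>R weak_deriv i u x)"
    by (rule weak_deriv_cong) (auto intro!: H1_L2 weak_deriv_scaleR)
  then show ?thesis using weak_deriv_scaleR[of "weak_deriv i u" j c] by simp
qed

subsection \<open>The space X\<close>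

definition L2_inner :: "('a::euclidean_space \<Rightarrow> complex) \<Rightarrow> ('a \<Rightarrow> complex) \<Rightarrow> real" where
  "L2_inner u v = (\<integral>x. u x \<bullet> v x \<partial>lborel)"

definition L2_norm :: "('a::euclidean_space \<Rightarrow> complex) \<Rightarrow> real" where
  "L2_norm u = sqrt (\<integral>x. (norm (u x))\<^sup>2 \<partial>lborel)"

text \<open>All second derivatives, over ordered pairs of directions, enter the norm (the Frobenius norm of
  the Hessian); counting the mixed one once gives an equivalent norm.\<close>

definition H2_norm :: "('a::euclidean_space \<Rightarrow> complex) \<Rightarrow> real" where
  "H2_norm u = sqrt ((L2_norm u)\<^sup>2 + (\<Sum>i\<in>Basis. (L2_norm (weak_deriv i u))\<^sup>2) +
     (\<Sum>i\<in>Basis. \<Sum>j\<in>Basis. (L2_norm (weak_deriv j (weak_deriv i u)))\<^sup>2))"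

lemma L2_inner_cong:
  assumes "AE x in lborel. u x = u' x" "AE x in lborel. v x = v' x" "u \<in> L2" "u' \<in> L2" "v \<in> L2" "v' \<in> L2"
  shows "L2_inner u v = L2_inner u' v'"
  unfolding L2_inner_def
proof (rule integral_cong_AE)
  show "AE x in lborel. u x \<bullet> v x = u' x \<bullet> v' x"
    using assms(1,2) by eventually_elim simp
qed (use assms in \<open>auto simp: L2_def\<close>)

lemma L2_inner_add:
  "\<lbrakk>AE x in lborel. w x = u x + v x; w \<in> L2; u \<in> L2; v \<in> L2; z \<in> L2\<rbrakk>
    \<Longrightarrow> L2_inner w z = L2_inner u z + L2_inner v z"
  by (subst L2_inner_cong[of w "\<lambda>x. u x + v x" z z])
     (auto simp: L2_inner_def inner_add_left L2_integrable_inner L2_add)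

lemma L2_inner_scaleR:
  "\<lbrakk>AE x in lborel. w x = c *\<^sub>R u x; w \<in> L2; u \<in> L2; z \<in> L2\<rbrakk>
    \<Longrightarrow> L2_inner w z = c * L2_inner u z"
  by (subst L2_inner_cong[of w "\<lambda>x. c *\<^sub>R u x" z z])
     (auto simp: L2_inner_def L2_scaleR)

lemma L2_inner_ge_0: "0 \<le> L2_inner u u"
  by (auto simp: L2_inner_def)

lemma L2_norm_sq: "(L2_norm u)\<^sup>2 = L2_inner u u"
  by (simp add: L2_inner_def L2_norm_def power2_norm_eq_inner)

type_synonym plane = "real \<times> real"

definition X_fun :: "(plane \<Rightarrow> complex) set" where
  "X_fun = {u \<in> H2. (\<lambda>x. (norm x)\<^sup>2 *\<^sub>R u x) \<in> L2}"

definition X_rel :: "(plane \<Rightarrow> complex) \<Rightarrow> (plane \<Rightarrow> complex) \<Rightarrow> bool" where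
  "X_rel u v \<longleftrightarrow> u \<in> X_fun \<and> v \<in> X_fun \<and> (AE x in lborel. u x = v x)"

definition X_norm :: "(plane \<Rightarrow> complex) \<Rightarrow> real" where
  "X_norm u = sqrt ((H2_norm u)\<^sup>2 + (L2_norm (\<lambda>x. (norm x)\<^sup>2 *\<^sub>R u x))\<^sup>2)"

definition X_inner :: "(plane \<Rightarrow> complex) \<Rightarrow> (plane \<Rightarrow> complex) \<Rightarrow> real" where
  "X_inner u v = L2_inner u v + (\<Sum>i\<in>Basis. L2_inner (weak_deriv i u) (weak_deriv i v)) +
     (\<Sum>i\<in>Basis. \<Sum>j\<in>Basis. L2_inner (weak_deriv j (weak_deriv i u)) (weak_deriv j (weak_deriv i v))) +
     L2_inner (\<lambda>x. (norm x)\<^sup>2 *\<^sub>R u x) (\<lambda>x. (norm x)\<^sup>2 *\<^sub>R v x)"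

lemma X_fun_D:
  assumes "u \<in> X_fun"
  shows "u \<in> H2" "u \<in> H1" "u \<in> L2" "(\<lambda>x. (norm x)\<^sup>2 *\<^sub>R u x) \<in> L2"
    "i \<in> Basis \<Longrightarrow> weak_deriv i u \<in> H1" "i \<in> Basis \<Longrightarrow> weak_deriv i u \<in> L2"
    "i \<in> Basis \<Longrightarrow> j \<in> Basis \<Longrightarrow> weak_deriv j (weak_deriv i u) \<in> L2"
  using assms by (auto simp: X_fun_def intro: H2_H1 H1_L2 H2_weak_deriv weak_deriv_L2)

lemma X_fun_zero: "(\<lambda>x. 0) \<in> X_fun"
  by (simp add: X_fun_def H2_zero L2_zero)

lemma X_fun_add: "u \<in> X_fun \<Longrightarrow> v \<in> X_fun \<Longrightarrow> (\<lambda>x. u x + v x) \<in> X_fun"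
  by (auto simp: X_fun_def scaleR_add_right intro: H2_add L2_add)

lemma X_fun_scaleR: "u \<in> X_fun \<Longrightarrow> (\<lambda>x. c *\<^sub>R u x) \<in> X_fun"
  using L2_scaleR[of "\<lambda>x. (norm x)\<^sup>2 *\<^sub>R u x" c]
  by (auto simp: X_fun_def mult.commute intro: H2_scaleR)

lemma X_rel_weak_deriv:
  assumes "X_rel u v" "i \<in> Basis" shows "weak_deriv i u = weak_deriv i v"
  using assms by (auto simp: X_rel_def intro: weak_deriv_cong X_fun_D)

lemma X_inner_cong:
  assumes "X_rel u u'" "X_rel v v'" shows "X_inner u v = X_inner u' v'"
proof -
  have "L2_inner u v = L2_inner u' v'"
    using assms by (auto simp: X_rel_def intro!: L2_inner_cong X_fun_D)
  moreover have "L2_inner (\<lambda>x. (norm x)\<^sup>2 *\<^sub>R u x) (\<lambda>x. (norm x)\<^sup>2 *\<^sub>R v x) =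
      L2_inner (\<lambda>x. (norm x)\<^sup>2 *\<^sub>R u' x) (\<lambda>x. (norm x)\<^sup>2 *\<^sub>R v' x)"
    using assms by (intro L2_inner_cong X_fun_D) (auto simp: X_rel_def)
  ultimately show ?thesis
    using assms X_rel_weak_deriv by (simp add: X_inner_def)
qed

lemma X_norm_eq: "X_norm u = sqrt (X_inner u u)"
  by (simp add: X_norm_def H2_norm_def X_inner_def L2_norm_sq L2_inner_ge_0 sum_nonneg)

text \<open>The elements of \<open>X\<close> are almost everywhere classes of complex valued functions; \<open>X\<close> is taken as
  a real vector space, with the real inner product that induces \<open>X_norm\<close>.\<close>

quotient_type X = "plane \<Rightarrow> complex" / partial: X_rel
proof (rule part_equivpI)
  show "\<exists>u. X_rel u u" using X_fun_zero by (auto simp: X_rel_def)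
  show "symp X_rel" by (auto simp: symp_def X_rel_def)
  show "transp X_rel" by (auto simp: transp_def X_rel_def)
qed

instantiation X :: real_inner
begin

lift_definition zero_X :: X is "\<lambda>x. 0"
  by (simp add: X_rel_def X_fun_zero)

lift_definition plus_X :: "X \<Rightarrow> X \<Rightarrow> X" is "\<lambda>u v x. u x + v x"
  by (auto simp: X_rel_def intro: X_fun_add)

lift_definition scaleR_X :: "real \<Rightarrow> X \<Rightarrow> X" is "\<lambda>c u x. c *\<^sub>R u x"
  by (auto simp: X_rel_def intro: X_fun_scaleR)

lift_definition inner_X :: "X \<Rightarrow> X \<Rightarrow> real" is X_inner
  by (rule X_inner_cong)

lift_definition norm_X :: "X \<Rightarrow> real" is X_norm
  by (simp add: X_norm_eq X_inner_cong)

definition uminus_X :: "X \<Rightarrow> X" where "- (u::X) = (-1) *\<^sub>R u"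
definition minus_X :: "X \<Rightarrow> X \<Rightarrow> X" where "u - v = u + (-1) *\<^sub>R (v::X)"
definition sgn_X :: "X \<Rightarrow> X" where "sgn (u::X) = inverse (norm u) *\<^sub>R u"
definition dist_X :: "X \<Rightarrow> X \<Rightarrow> real" where "dist u v = norm (u - (v::X))"
definition uniformity_X :: "(X \<times> X) filter" where
  "uniformity_X = (INF e\<in>{0 <..}. principal {(x, y). dist x y < e})"
definition open_X :: "X set \<Rightarrow> bool" where
  "open_X U = (\<forall>x\<in>U. eventually (\<lambda>(x', y). x' = x \<longrightarrow> y \<in> U) uniformity)"

instance
proof
  fix u v w :: X and a b :: real
  show "u + v + w = u + (v + w)"
    by transfer (simp add: X_rel_def X_fun_add add.assoc)
  show "u + v = v + u"
    by transfer (simp add: X_rel_def X_fun_add add.commute)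
  show "0 + u = u"
    by transfer (simp add: X_rel_def)
  show "- u + u = 0"
    unfolding uminus_X_def
    by transfer (auto simp: X_rel_def X_fun_zero intro: X_fun_add X_fun_scaleR[of _ "-1", simplified])
  show "u - v = u + - v" by (simp add: minus_X_def uminus_X_def)
  show "a *\<^sub>R (u + v) = a *\<^sub>R u + a *\<^sub>R v"
    by transfer (simp add: X_rel_def X_fun_add X_fun_scaleR scaleR_add_right del: scaleR_conv_of_real)
  show "(a + b) *\<^sub>R u = a *\<^sub>R u + b *\<^sub>R u"
    by transfer (simp add: X_rel_def X_fun_add X_fun_scaleR scaleR_add_left)
  show "a *\<^sub>R b *\<^sub>R u = (a * b) *\<^sub>R u"
    by transfer (simp add: X_rel_def X_fun_scaleR)
  show "1 *\<^sub>R u = u"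
    by transfer (simp add: X_rel_def)
  show "dist u v = norm (u - v)" "sgn u = inverse (norm u) *\<^sub>R u" by (simp_all add: dist_X_def sgn_X_def)
  show "uniformity = (INF e\<in>{0 <..}. principal {(x, y::X). dist x y < e})"
    by (rule uniformity_X_def)
  show "open U = (\<forall>x\<in>U. eventually (\<lambda>(x', y). x' = x \<longrightarrow> y \<in> U) uniformity)" for U :: "X set"
    by (rule open_X_def)
  show "inner u v = inner v u"
    by transfer (simp add: X_inner_def L2_inner_def inner_commute)
  show "inner (u + v) w = inner u w + inner v w"
  proof (transfer)
    fix u v w assume "X_rel u u" "X_rel v v" "X_rel w w"
    then have m: "u \<in> X_fun" "v \<in> X_fun" "w \<in> X_fun" by (auto simp: X_rel_def)
    note [simp] = X_fun_D[OF m(1)] X_fun_D[OF m(2)] X_fun_D[OF m(3)] X_fun_D[OF X_fun_add[OF m(1,2)]]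
    have "L2_inner (\<lambda>x. u x + v x) w = L2_inner u w + L2_inner v w"
      by (rule L2_inner_add) auto
    moreover have "L2_inner (\<lambda>x. (norm x)\<^sup>2 *\<^sub>R (u x + v x)) (\<lambda>x. (norm x)\<^sup>2 *\<^sub>R w x) =
        L2_inner (\<lambda>x. (norm x)\<^sup>2 *\<^sub>R u x) (\<lambda>x. (norm x)\<^sup>2 *\<^sub>R w x) +
        L2_inner (\<lambda>x. (norm x)\<^sup>2 *\<^sub>R v x) (\<lambda>x. (norm x)\<^sup>2 *\<^sub>R w x)"
      by (rule L2_inner_add[OF _ X_fun_D(4)[OF X_fun_add[OF m(1,2)]] X_fun_D(4)[OF m(1)] X_fun_D(4)[OF m(2)] X_fun_D(4)[OF m(3)]])
         (simp add: scaleR_add_right)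
    moreover have "L2_inner (weak_deriv i (\<lambda>x. u x + v x)) (weak_deriv i w) =
        L2_inner (weak_deriv i u) (weak_deriv i w) + L2_inner (weak_deriv i v) (weak_deriv i w)"
      if "i \<in> Basis" for i
      using that by (intro L2_inner_add weak_deriv_add) auto
    moreover have "L2_inner (weak_deriv j (weak_deriv i (\<lambda>x. u x + v x))) (weak_deriv j (weak_deriv i w)) =
        L2_inner (weak_deriv j (weak_deriv i u)) (weak_deriv j (weak_deriv i w)) +
        L2_inner (weak_deriv j (weak_deriv i v)) (weak_deriv j (weak_deriv i w))"
      if "i \<in> Basis" "j \<in> Basis" for i j
      using that by (intro L2_inner_add weak_deriv2_add) auto
    ultimately show "X_inner (\<lambda>x. u x + v x) w = X_inner u w + X_inner v w"
      unfolding X_inner_def by (simp add: sum.distrib)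
  qed
  show "inner (a *\<^sub>R u) v = a * inner u v"
  proof (transfer)
    fix a u w assume "X_rel u u" "X_rel w w"
    then have m: "u \<in> X_fun" "w \<in> X_fun" by (auto simp: X_rel_def)
    note s = X_fun_scaleR[OF m(1), of a]
    note [simp] = X_fun_D[OF m(1)] X_fun_D[OF m(2)]
    have "L2_inner (\<lambda>x. a *\<^sub>R u x) w = a * L2_inner u w"
      by (rule L2_inner_scaleR[OF _ X_fun_D(3)[OF s]]) auto
    moreover have "L2_inner (\<lambda>x. (norm x)\<^sup>2 *\<^sub>R (a *\<^sub>R u x)) (\<lambda>x. (norm x)\<^sup>2 *\<^sub>R w x) =
        a * L2_inner (\<lambda>x. (norm x)\<^sup>2 *\<^sub>R u x) (\<lambda>x. (norm x)\<^sup>2 *\<^sub>R w x)"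
      by (rule L2_inner_scaleR[OF _ X_fun_D(4)[OF s] X_fun_D(4)[OF m(1)] X_fun_D(4)[OF m(2)]])
         (simp add: scaleR_left_commute[of _ a])
    moreover have "L2_inner (weak_deriv i (\<lambda>x. a *\<^sub>R u x)) (weak_deriv i w) =
        a * L2_inner (weak_deriv i u) (weak_deriv i w)"
      if "i \<in> Basis" for i
      by (rule L2_inner_scaleR[OF weak_deriv_scaleR X_fun_D(6)[OF s]]) (use that in auto)
    moreover have "L2_inner (weak_deriv j (weak_deriv i (\<lambda>x. a *\<^sub>R u x))) (weak_deriv j (weak_deriv i w)) =
        a * L2_inner (weak_deriv j (weak_deriv i u)) (weak_deriv j (weak_deriv i w))"
      if "i \<in> Basis" "j \<in> Basis" for i j
      by (rule L2_inner_scaleR[OF weak_deriv2_scaleR X_fun_D(7)[OF s]]) (use that in auto)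
    ultimately show "X_inner (\<lambda>x. a *\<^sub>R u x) w = a * X_inner u w"
      unfolding X_inner_def by (simp add: sum_distrib_left distrib_left)
  qed
  show "0 \<le> inner u u"
    by transfer (auto simp: X_inner_def intro!: add_nonneg_nonneg sum_nonneg L2_inner_ge_0)
  show "norm u = sqrt (inner u u)"
    by transfer (rule X_norm_eq)
  show "inner u u = 0 \<longleftrightarrow> u = 0"
  proof transfer
    fix u assume "X_rel u u"
    then have u: "u \<in> X_fun" by (simp add: X_rel_def)
    show "X_inner u u = 0 \<longleftrightarrow> X_rel u (\<lambda>x. 0)"
    proof
      assume "X_inner u u = 0"
      moreover have "0 \<le> (\<Sum>i\<in>Basis. L2_inner (weak_deriv i u) (weak_deriv i u))"
        "0 \<le> (\<Sum>i\<in>Basis. \<Sum>j\<in>Basis. L2_inner (weak_deriv j (weak_deriv i u)) (weak_deriv j (weak_deriv i u)))"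
        by (intro sum_nonneg L2_inner_ge_0)+
      moreover have "0 \<le> L2_inner u u" "0 \<le> L2_inner (\<lambda>x. (norm x)\<^sup>2 *\<^sub>R u x) (\<lambda>x. (norm x)\<^sup>2 *\<^sub>R u x)"
        by (rule L2_inner_ge_0)+
      ultimately have "L2_inner u u = 0" unfolding X_inner_def by linarith
      then have "AE x in lborel. u x \<bullet> u x = 0"
        unfolding L2_inner_def
        using integral_nonneg_eq_0_iff_AE[OF L2_integrable_inner[OF X_fun_D(3)[OF u] X_fun_D(3)[OF u]]] by simp
      then show "X_rel u (\<lambda>x. 0)" using u X_fun_zero by (auto simp: X_rel_def)
    next
      assume "X_rel u (\<lambda>x. 0)"
      then have "X_inner u u = X_inner (\<lambda>x. 0 *\<^sub>R (0::complex)) (\<lambda>x. 0)" using X_inner_cong by simp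
      also have "\<dots> = 0"
      proof -
        have z: "X_rel (\<lambda>x. 0) (\<lambda>x. 0)" using X_fun_zero by (simp add: X_rel_def)
        have "L2_inner (weak_deriv i (\<lambda>x::plane. 0)) (weak_deriv i (\<lambda>x::plane. 0)) = 0" if "i \<in> Basis" for i
          unfolding L2_inner_def
          by (rule integral_eq_zero_AE) (use weak_deriv_zero[OF that] in auto)
        moreover have "L2_inner (weak_deriv j (weak_deriv i (\<lambda>x::plane. 0))) (weak_deriv j (weak_deriv i (\<lambda>x::plane. 0))) = 0"
          if "i \<in> Basis" "j \<in> Basis" for i j
          unfolding L2_inner_def
          by (rule integral_eq_zero_AE) (use weak_deriv2_scaleR[OF H2_zero that, of 0] in auto)
        ultimately show ?thesis
          by (simp add: X_inner_def) (simp add: L2_inner_def)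
      qed
      finally show "X_inner u u = 0" .
    qed
  qed
qed

end

subsection \<open>Standing waves of the Gross-Pitaevskii equation\<close>

definition laplacian :: "(plane \<Rightarrow> complex) \<Rightarrow> plane \<Rightarrow> complex" where
  "laplacian u x = (\<Sum>i\<in>Basis. weak_deriv i (weak_deriv i u) x)"

text \<open>On \<open>X\<close> every term below is square integrable, since \<open>H\<^sup>2(\<real>\<^sup>2)\<close> embeds into the bounded functions, so
  this is an equality in \<open>L\<^sup>2\<close>.\<close>

definition stationary_GP :: "(plane \<Rightarrow> complex) \<Rightarrow> real \<Rightarrow> bool" where
  "stationary_GP u \<omega> \<longleftrightarrow> (AE x in lborel.
     - laplacian u x + complex_of_real ((norm x)\<^sup>2 - \<omega> + (norm (u x))\<^sup>2) * u x = 0)"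

text \<open>At a point other than the origin the inner quantifiers range over one \<open>r\<close> and the angles
  differing by multiples of \<open>2\<pi>\<close>; the origin is a null set. No measurability of \<open>\<rho>\<close> is imposed,
  as it follows (after a change on a null set) from that of \<open>u\<close>.\<close>

definition angular_form :: "nat \<Rightarrow> (plane \<Rightarrow> complex) \<Rightarrow> bool" where
  "angular_form m u \<longleftrightarrow> (\<exists>\<rho>::real \<Rightarrow> real. AE x in lborel. \<forall>r\<ge>0. \<forall>\<theta>.
     x = (r * cos \<theta>, r * sin \<theta>) \<longrightarrow> u x = exp (\<i> * of_nat m * of_real \<theta>) * of_real (\<rho> r))"

lemma stationary_GP_cong:
  assumes "X_rel u v" "stationary_GP u \<omega>" shows "stationary_GP v \<omega>"
proof -
  have l: "laplacian u = laplacian v"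
    by (simp add: laplacian_def fun_eq_iff X_rel_weak_deriv[OF assms(1)])
  have "AE x in lborel. u x = v x" using assms(1) by (simp add: X_rel_def)
  with assms(2) show ?thesis
    unfolding stationary_GP_def l by eventually_elim simp
qed

lemma angular_form_cong:
  assumes "X_rel u v" "angular_form m u" shows "angular_form m v"
proof -
  have e: "AE x in lborel. u x = v x" using assms(1) by (simp add: X_rel_def)
  from assms(2) obtain \<rho> :: "real \<Rightarrow> real" where "AE x in lborel. \<forall>r\<ge>0. \<forall>\<theta>.
     x = (r * cos \<theta>, r * sin \<theta>) \<longrightarrow> u x = exp (\<i> * of_nat m * of_real \<theta>) * of_real (\<rho> r)"
    unfolding angular_form_def by blast
  with e have "AE x in lborel. \<forall>r\<ge>0. \<forall>\<theta>.
     x = (r * cos \<theta>, r * sin \<theta>) \<longrightarrow> v x = exp (\<i> * of_nat m * of_real \<theta>) * of_real (\<rho> r)"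
    by eventually_elim auto
  then show ?thesis unfolding angular_form_def by blast
qed

lemma X_rel_sym: "X_rel u v \<Longrightarrow> X_rel v u"
  by (auto simp: X_rel_def)

lift_definition standing_wave :: "X \<Rightarrow> real \<Rightarrow> bool" is stationary_GP
  using stationary_GP_cong X_rel_sym by blast

lift_definition has_angular_form :: "nat \<Rightarrow> X \<Rightarrow> bool" is angular_form
  using angular_form_cong X_rel_sym by blast

definition F_space :: "nat \<Rightarrow> X set" where
  "F_space m = {u. has_angular_form m u}"

text \<open>The closure is taken in the subspace \<open>F \<times> \<real>\<close> of \<open>X \<times> \<real>\<close>.\<close>

definition solution_closure :: "nat \<Rightarrow> (X \<times> real) set" where
  "solution_closure m = top_of_set (F_space m \<times> UNIV) closure_of
     {(u, \<omega>). u \<in> F_space m \<and> u \<noteq> 0 \<and> standing_wave u \<omega>}"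

end

theory Submission
  imports Defs "HOL-Computational_Algebra.Polynomial"
begin

text \<open>Write \<open>z = x + i y\<close> and \<open>s = \<bar>x\<bar>\<^sup>2\<close>. With \<open>u = a H(s) z\<^sup>m\<close> and \<open>H(0) = 1\<close> the stationary equation
  becomes the regular singular equation \<open>s H'' + (m + 1) H' = V H / 4\<close>, where
  \<open>V = s - \<omega> + a\<^sup>2 s\<^sup>m H\<^sup>2\<close>, which is solved by shooting from \<open>s = 0\<close>; the solution depends continuously
  on \<open>(a, \<omega>)\<close>. Once \<open>s > \<omega>\<close> the quantity \<open>s\<^sup>m\<^sup>+\<^sup>1 H H'\<close> is strictly increasing. Hence a continuous
  determination of the angle of \<open>(H, H')\<close> eventually stays above \<open>- n \<pi>\<close>, or eventually stays below
  \<open>- n \<pi> - \<pi>/2\<close>, or lies between these values for all \<open>s > \<omega>\<close>; in the last case \<open>H\<close> decays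
  exponentially. The first two conditions are open and exclusive, so that the closed set \<open>D\<^sub>n\<close> of the
  decaying parameters separates them in the \<open>(a, \<omega>)\<close> plane. On the line \<open>a = 0\<close> the angle is strictly
  decreasing in \<open>\<omega>\<close> (Sturm) and the Laguerre function of degree \<open>n\<^sub>0\<close> decays, so for some \<open>n\<close> the set \<open>D\<^sub>n\<close>
  meets this line exactly in \<open>(0, \<omega>\<^sub>0)\<close>. By the topology of the plane a single component of \<open>D\<^sub>n\<close> separates the
  two half lines; it contains \<open>(0, \<omega>\<^sub>0)\<close> and is unbounded, and since \<open>a\<close> is bounded in terms of \<open>\<omega>\<close> on it,
  \<open>\<omega>\<close> is unbounded. Its image under \<open>(a, \<omega>) \<mapsto> (u, \<omega>)\<close> is the required continuum.\<close>

subsection \<open>The radial equation\<close>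

text \<open>Shooting leaves only the two numbers \<open>(a, \<omega>)\<close>, so separation in the
  plane can replace the degree theory that usually makes a bifurcation global. For
  \<open>a \<noteq> 0\<close> no monotone dependence of the angle on the parameters is at hand, so
  the decaying parameters are not shown to form a curve; components of closed sets are used instead
  of implicit functions. Factoring out \<open>z^m\<close> removes the centrifugal term:
  \<open>4 (s H'' + (m + 1) H')\<close> is the radial Laplacian in dimension \<open>2 m + 2\<close>,
  regular at the origin with the single datum \<open>H(0) = 1\<close>. The cubic term could still
  make solutions blow up at a finite \<open>s\<close>, and then the angle would not be defined for
  all parameters; this is the obstacle that the cutoff removes. Decay is a condition at infinity,
  whereas continuity in the parameters is available only at finite \<open>s\<close>. Monotonicity of
  \<open>s^(m+1) H H'\<close> bridges the gap: failure to decay is visible at some finite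
  \<open>s\<close> and is irreversible. No count of zeros links the index \<open>n\<close> to
  \<open>n0\<close>: the degree of the Laguerre function enters only through the value of
  \<open>\<omega>\<close>.\<close>

text \<open>The pair \<open>p\<close> is \<open>(a, \<omega>)\<close>. The square \<open>\<bar>u\<bar>\<^sup>2\<close> is cut off at \<open>max \<omega> 0\<close>, which makes the equation
  globally Lipschitz; \<open>decaying_maximum_principle\<close> below shows that the cutoff is not active on decaying
  solutions.\<close>

definition potential :: "nat \<Rightarrow> real \<times> real \<Rightarrow> real \<Rightarrow> real \<Rightarrow> real" where
  "potential m p s h = s - snd p + min ((fst p)\<^sup>2 * \<bar>s\<bar> ^ m * h\<^sup>2) (max (snd p) 0)"

definition rhs :: "nat \<Rightarrow> real \<times> real \<Rightarrow> real \<Rightarrow> real \<Rightarrow> real" where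
  "rhs m p s h = potential m p s h * h / 4"

text \<open>Away from the kinks at \<open>-e\<close> and \<open>e\<close> the slope of
  \<open>x -> min(x^2, e^2) x\<close> is \<open>3 x^2\<close> or \<open>e^2\<close>, whence the
  constant. The kinks are handled by splitting the difference for
  \<open>\<bar>x\<bar> \<le> \<bar>y\<bar>\<close> and clipping \<open>\<bar>y\<bar>\<close> at
  \<open>e\<close>.\<close>

lemma saturated_square_lipschitz:
  fixes x y e :: real
  assumes "e \<ge> 0"
  shows "\<bar>min (x\<^sup>2) (e\<^sup>2) * x - min (y\<^sup>2) (e\<^sup>2) * y\<bar> \<le> 3 * e\<^sup>2 * \<bar>x - y\<bar>"
proof -
  have *: "\<bar>min (x\<^sup>2) (e\<^sup>2) * x - min (y\<^sup>2) (e\<^sup>2) * y\<bar> \<le> 3 * e\<^sup>2 * \<bar>x - y\<bar>" if le: "\<bar>x\<bar> \<le> \<bar>y\<bar>" for x y :: real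
  proof -
    have "\<bar>x\<bar> * \<bar>min (y\<^sup>2) (e\<^sup>2) - min (x\<^sup>2) (e\<^sup>2)\<bar> \<le> 2 * e\<^sup>2 * \<bar>x - y\<bar>"
    proof (cases "\<bar>x\<bar> \<le> e")
      case False
      then have "x\<^sup>2 \<ge> e\<^sup>2" "y\<^sup>2 \<ge> e\<^sup>2"
        using le assms abs_le_square_iff[of e x] abs_le_square_iff[of e y] by auto
      then show ?thesis by simp
    next
      case True
      define t where "t = min \<bar>y\<bar> e"
      have t: "t \<ge> 0" "t \<ge> \<bar>x\<bar>" "t \<le> e" "t - \<bar>x\<bar> \<le> \<bar>x - y\<bar>"
        using True le assms by (auto simp: t_def)
      have "min (y\<^sup>2) (e\<^sup>2) = t\<^sup>2"
      proof (cases "\<bar>y\<bar> \<le> e")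
        case True then have "y\<^sup>2 \<le> e\<^sup>2" using assms abs_le_square_iff[of y e] by simp
        then show ?thesis using True by (simp add: t_def)
      next
        case False then have "e\<^sup>2 \<le> y\<^sup>2" using assms abs_le_square_iff[of e y] by simp
        then show ?thesis using False by (simp add: t_def)
      qed
      moreover have "x\<^sup>2 \<le> e\<^sup>2" using True assms abs_le_square_iff[of x e] by simp
      then have "min (x\<^sup>2) (e\<^sup>2) = \<bar>x\<bar>\<^sup>2" by simp
      moreover have "\<bar>x\<bar>\<^sup>2 \<le> t\<^sup>2" using t by (intro power_mono) auto
      ultimately have "\<bar>min (y\<^sup>2) (e\<^sup>2) - min (x\<^sup>2) (e\<^sup>2)\<bar> = (t + \<bar>x\<bar>) * (t - \<bar>x\<bar>)"
        by (simp add: power2_eq_square algebra_simps)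
      also have "\<dots> \<le> (2 * e) * \<bar>x - y\<bar>" using t by (intro mult_mono) auto
      finally have "\<bar>x\<bar> * \<bar>min (y\<^sup>2) (e\<^sup>2) - min (x\<^sup>2) (e\<^sup>2)\<bar> \<le> e * ((2 * e) * \<bar>x - y\<bar>)"
        using True assms by (intro mult_mono) auto
      then show ?thesis by (simp add: power2_eq_square)
    qed
    moreover have "\<bar>min (y\<^sup>2) (e\<^sup>2) * (x - y)\<bar> \<le> e\<^sup>2 * \<bar>x - y\<bar>"
      unfolding abs_mult by (intro mult_right_mono) auto
    moreover have "min (x\<^sup>2) (e\<^sup>2) * x - min (y\<^sup>2) (e\<^sup>2) * y =
        x * (min (x\<^sup>2) (e\<^sup>2) - min (y\<^sup>2) (e\<^sup>2)) + min (y\<^sup>2) (e\<^sup>2) * (x - y)"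
      by (simp add: algebra_simps)
    ultimately show ?thesis
      using abs_triangle_ineq[of "x * (min (x\<^sup>2) (e\<^sup>2) - min (y\<^sup>2) (e\<^sup>2))" "min (y\<^sup>2) (e\<^sup>2) * (x - y)"]
      by (simp add: abs_mult abs_minus_commute)
  qed
  show ?thesis
    using *[of x y] *[of y x] by (cases "\<bar>x\<bar> \<le> \<bar>y\<bar>") (auto simp: abs_minus_commute)
qed

lemma abs_potential_le: "\<bar>potential m p s h\<bar> \<le> \<bar>s\<bar> + \<bar>snd p\<bar>"
  and potential_ge: "potential m p s h \<ge> s - snd p"
proof -
  have "0 \<le> (fst p)\<^sup>2 * \<bar>s\<bar> ^ m * h\<^sup>2" by simp
  then show "\<bar>potential m p s h\<bar> \<le> \<bar>s\<bar> + \<bar>snd p\<bar>" "potential m p s h \<ge> s - snd p"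
    unfolding potential_def by linarith+
qed

lemma abs_rhs_le: "\<bar>rhs m p s h\<bar> \<le> (\<bar>s\<bar> + \<bar>snd p\<bar>) * \<bar>h\<bar> / 4"
  unfolding rhs_def using abs_potential_le[of m p s h]
  by (simp add: abs_mult mult_right_mono)

text \<open>With \<open>c = \<bar>a\<bar> s^(m/2)\<close> the cubic term is
  \<open>min ((c h)^2) (e^2) (c h) / c\<close>. The scale \<open>c\<close> cancels in the estimate,
  so the constant is independent of \<open>a\<close>; the division by 4 absorbs the factor 3. For
  \<open>c = 0\<close> the equation is linear.\<close>

lemma rhs_lipschitz: "\<bar>rhs m p s h - rhs m p s k\<bar> \<le> (\<bar>s\<bar> + \<bar>snd p\<bar>) * \<bar>h - k\<bar>"
proof (cases "fst p = 0 \<or> \<bar>s\<bar> ^ m = 0")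
  case True
  have "rhs m p s h - rhs m p s k = (s - snd p) * (h - k) / 4"
  proof -
    have "(fst p)\<^sup>2 * \<bar>s\<bar> ^ m = 0" using True by auto
    then have "potential m p s h = s - snd p" for h unfolding potential_def
      by (simp only: mult_zero_left)
    then show ?thesis by (simp add: rhs_def right_diff_distrib diff_divide_distrib)
  qed
  then have "\<bar>rhs m p s h - rhs m p s k\<bar> = \<bar>s - snd p\<bar> * \<bar>h - k\<bar> / 4"
    by (simp only: abs_divide abs_mult abs_numeral)
  also have "\<dots> \<le> (\<bar>s\<bar> + \<bar>snd p\<bar>) * \<bar>h - k\<bar> / 4"
    by (intro divide_right_mono mult_right_mono) auto
  also have "\<dots> \<le> (\<bar>s\<bar> + \<bar>snd p\<bar>) * \<bar>h - k\<bar>" by simp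
  finally show ?thesis .
next
  case False
  define c where "c = \<bar>fst p\<bar> * sqrt (\<bar>s\<bar> ^ m)"
  define e where "e = sqrt (max (snd p) 0)"
  have c: "c > 0" and e: "e \<ge> 0" using False by (auto simp: c_def e_def)
  have e2: "e\<^sup>2 = max (snd p) 0" by (simp add: e_def)
  have c2: "c\<^sup>2 = (fst p)\<^sup>2 * \<bar>s\<bar> ^ m" by (simp add: c_def power_mult_distrib)
  define w where "w h = min ((c*h)\<^sup>2) (e\<^sup>2) * (c*h) / c" for h
  have V: "potential m p s h * h = (s - snd p) * h + w h" for h
    using c unfolding potential_def e2 w_def power_mult_distrib c2 by (simp add: distrib_right)
  have D: "rhs m p s h - rhs m p s k = ((s - snd p) * (h - k) + (w h - w k)) / 4"
    unfolding rhs_def V by (simp add: algebra_simps diff_divide_distrib add_divide_distrib)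
  have "\<bar>w h - w k\<bar> \<le> 3 * e\<^sup>2 * \<bar>h - k\<bar>"
  proof -
    have "w h - w k = (min ((c*h)\<^sup>2) (e\<^sup>2) * (c*h) - min ((c*k)\<^sup>2) (e\<^sup>2) * (c*k)) / c"
      unfolding w_def by (rule diff_divide_distrib[symmetric])
    then have "c * \<bar>w h - w k\<bar> = \<bar>min ((c*h)\<^sup>2) (e\<^sup>2) * (c*h) - min ((c*k)\<^sup>2) (e\<^sup>2) * (c*k)\<bar>"
      using c by (simp add: abs_divide)
    also have "\<dots> \<le> 3 * e\<^sup>2 * \<bar>c * h - c * k\<bar>"
      by (rule saturated_square_lipschitz[OF e])
    also have "\<bar>c * h - c * k\<bar> = c * \<bar>h - k\<bar>"
      using c by (metis abs_mult abs_of_pos right_diff_distrib)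
    finally show ?thesis using c by simp
  qed
  moreover have "\<bar>(s - snd p) * (h - k)\<bar> \<le> (\<bar>s\<bar> + \<bar>snd p\<bar>) * \<bar>h - k\<bar>"
    unfolding abs_mult by (intro mult_right_mono) auto
  moreover have "e\<^sup>2 * \<bar>h - k\<bar> \<le> \<bar>snd p\<bar> * \<bar>h - k\<bar>"
    unfolding e2 by (intro mult_right_mono) auto
  ultimately have "\<bar>rhs m p s h - rhs m p s k\<bar> \<le> ((\<bar>s\<bar> + \<bar>snd p\<bar>) * \<bar>h - k\<bar> + 3 * (\<bar>snd p\<bar> * \<bar>h - k\<bar>)) / 4"
    unfolding D abs_divide using abs_triangle_ineq[of "(s - snd p) * (h - k)" "w h - w k"] by simp
  also have "\<dots> \<le> (\<bar>s\<bar> + \<bar>snd p\<bar>) * \<bar>h - k\<bar>" by (simp add: distrib_right)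
  finally show ?thesis .
qed

lemma continuous_on_potential [continuous_intros]:
  assumes "continuous_on S p" "continuous_on S s" "continuous_on S h"
  shows "continuous_on S (\<lambda>x. potential m (p x) (s x) (h x))"
  unfolding potential_def by (intro continuous_intros assms)

lemma continuous_on_rhs [continuous_intros]:
  assumes "continuous_on S p" "continuous_on S s" "continuous_on S h"
  shows "continuous_on S (\<lambda>x. rhs m (p x) (s x) (h x))"
  unfolding rhs_def by (intro continuous_intros assms) auto

text \<open>Integrating \<open>s H'' + (m + 1) H' = f\<close> twice from \<open>0\<close> and interchanging the integrals gives
  \<open>H(s) = 1 + \<integral>\<^sub>0\<^sup>s (1 - (\<tau>/s)\<^sup>m)/m f(\<tau>) d\<tau>\<close>; the substitution \<open>\<tau> = s t\<close> removes the singularity at \<open>0\<close>.\<close>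

definition kern :: "nat \<Rightarrow> real \<Rightarrow> real" where
  "kern m t = (1 - t ^ m) / m"

lemma kern_bounds: "0 \<le> t \<Longrightarrow> t \<le> 1 \<Longrightarrow> 0 \<le> kern m t" "m \<ge> 1 \<Longrightarrow> 0 \<le> t \<Longrightarrow> t \<le> 1 \<Longrightarrow> kern m t \<le> 1"
proof -
  show "0 \<le> t \<Longrightarrow> t \<le> 1 \<Longrightarrow> 0 \<le> kern m t" by (simp add: kern_def power_le_one)
  show "m \<ge> 1 \<Longrightarrow> 0 \<le> t \<Longrightarrow> t \<le> 1 \<Longrightarrow> kern m t \<le> 1"
    unfolding kern_def by (subst divide_le_eq_1) (auto intro: order_trans[of _ 1])
qed

lemma continuous_on_kern [continuous_intros]:
  "continuous_on S f \<Longrightarrow> continuous_on S (\<lambda>x. kern m (f x))"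
  unfolding kern_def divide_inverse by (intro continuous_intros)

section \<open>Picard iteration for the singular integral equation\<close>

definition picard :: "nat \<Rightarrow> real \<times> real \<Rightarrow> (real \<Rightarrow> real) \<Rightarrow> real \<Rightarrow> real" where
  "picard m p h s = 1 + s * integral {0..1} (\<lambda>t. kern m t * rhs m p (s * t) (h (s * t)))"

primrec iterate :: "nat \<Rightarrow> nat \<Rightarrow> real \<times> real \<Rightarrow> real \<Rightarrow> real" where
  "iterate m 0 p = (\<lambda>s. 1)"
| "iterate m (Suc k) p = picard m p (iterate m k p)"

text \<open>The limit of the iterates as a telescoping series, to which the Weierstrass test
  applies.\<close>

definition profile :: "nat \<Rightarrow> real \<times> real \<Rightarrow> real \<Rightarrow> real" where
  "profile m p s = 1 + (\<Sum>k. iterate m (Suc k) p s - iterate m k p s)"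

lemma continuous_on_scaled:
  assumes "continuous_on UNIV (\<lambda>x. h (fst x) (snd x) :: real)"
  shows "continuous_on (UNIV \<times> cbox 0 1) (\<lambda>(x, t). kern m t * rhs m (fst x) (snd x * t) (h (fst x) (snd x * t)))"
    and "continuous_on (UNIV \<times> cbox 0 1) (\<lambda>(x, t). t ^ n * rhs m (fst x) (snd x * t) (h (fst x) (snd x * t)))"
proof -
  have "continuous_on (UNIV \<times> cbox 0 (1::real)) (\<lambda>y. h (fst (fst y)) (snd (fst y) * snd y))"
    using continuous_on_compose2[OF assms, of "UNIV \<times> cbox 0 1" "\<lambda>y. (fst (fst y), snd (fst y) * snd y)"]
    by (simp add: continuous_intros)
  note [continuous_intros] = this
  show "continuous_on (UNIV \<times> cbox 0 1) (\<lambda>(x, t). kern m t * rhs m (fst x) (snd x * t) (h (fst x) (snd x * t)))"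
    "continuous_on (UNIV \<times> cbox 0 1) (\<lambda>(x, t). t ^ n * rhs m (fst x) (snd x * t) (h (fst x) (snd x * t)))"
    unfolding split_beta by (intro continuous_intros)+
qed

lemma continuous_iterate: "continuous_on UNIV (\<lambda>x. iterate m k (fst x) (snd x))"
proof (induction k)
  case (Suc k)
  note integral_continuous_on_param[OF continuous_on_scaled(1)[OF this]]
  then show ?case unfolding iterate.simps picard_def
    by (intro continuous_intros) (simp add: cbox_interval)
qed simp

lemma continuous_slice:
  assumes "continuous_on UNIV (\<lambda>x. h (fst x) (snd x) :: real)"
  shows "continuous_on S (h p)"
  using continuous_on_compose2[OF assms, of S "\<lambda>s. (p, s)"] by (simp add: continuous_intros)

lemma continuous_on_kern_rhs:
  assumes "continuous_on UNIV h"
  shows "continuous_on S (\<lambda>t. kern m t * rhs m p (s * t) (h (s * t)))"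
proof -
  have "continuous_on S (\<lambda>t. h (s * t))"
    using continuous_on_compose2[OF assms, of S "\<lambda>t. s * t"] by (auto intro!: continuous_intros)
  then show ?thesis by (intro continuous_intros)
qed

text \<open>The factor \<open>t^n\<close> in the integrand contributes \<open>1 / (n + 1)\<close>,
  which builds up the factorial. The estimate serves convergence of the iterates, the passage to the
  limit (\<open>n = 0\<close>) and uniqueness.\<close>

lemma picard_diff_le:
  fixes h k :: "real \<Rightarrow> real"
  assumes m: "m \<ge> 1" and h: "continuous_on UNIV h" "continuous_on UNIV k"
    and L: "\<bar>s\<bar> + \<bar>snd p\<bar> \<le> L" and B: "B \<ge> 0"
    and d: "\<And>t. \<bar>t\<bar> \<le> \<bar>s\<bar> \<Longrightarrow> \<bar>h t - k t\<bar> \<le> B * (L * \<bar>t\<bar>) ^ n / fact n"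
  shows "\<bar>picard m p h s - picard m p k s\<bar> \<le> B * (L * \<bar>s\<bar>) ^ Suc n / fact (Suc n)"
proof -
  have L0: "L \<ge> 0" using L by linarith
  define c where "c = B * L * (L * \<bar>s\<bar>) ^ n / fact n"
  note i = integrable_continuous_real[OF continuous_on_kern_rhs]
  have bound: "\<bar>kern m t * rhs m p (s * t) (h (s * t)) - kern m t * rhs m p (s * t) (k (s * t))\<bar> \<le> c * t ^ n"
    if t: "t \<in> {0..1}" for t
  proof -
    have st: "\<bar>s * t\<bar> \<le> \<bar>s\<bar>" using t by (simp add: abs_mult mult_left_le)
    have "\<bar>rhs m p (s * t) (h (s * t)) - rhs m p (s * t) (k (s * t))\<bar> \<le> (\<bar>s*t\<bar> + \<bar>snd p\<bar>) * \<bar>h (s*t) - k (s*t)\<bar>"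
      by (rule rhs_lipschitz)
    also have "\<dots> \<le> L * (B * (L * \<bar>s*t\<bar>) ^ n / fact n)"
      using L st L0 by (intro mult_mono d) auto
    also have "\<dots> = c * t ^ n" using t by (simp add: c_def abs_mult power_mult_distrib)
    finally have "\<bar>rhs m p (s * t) (h (s * t)) - rhs m p (s * t) (k (s * t))\<bar> \<le> c * t ^ n" .
    moreover have "\<bar>kern m t\<bar> \<le> 1" using kern_bounds(1)[of t m] kern_bounds(2)[of m t] m t by auto
    ultimately have "\<bar>kern m t\<bar> * \<bar>rhs m p (s * t) (h (s * t)) - rhs m p (s * t) (k (s * t))\<bar> \<le> 1 * (c * t ^ n)"
      by (intro mult_mono) auto
    then show ?thesis by (simp flip: abs_mult right_diff_distrib)
  qed
  have dpw: "((\<lambda>t. t ^ Suc n / Suc n) has_real_derivative t ^ n) (at t within {0..1})" for t :: real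
    using DERIV_cdivide[OF DERIV_pow[of "Suc n" t "{0..1}"], of "Suc n"] by (simp del: of_nat_Suc)
  have "((\<lambda>t::real. t ^ n) has_integral (1 ^ Suc n / Suc n - 0 ^ Suc n / Suc n)) {0..1}"
    by (rule fundamental_theorem_of_calculus)
       (use dpw in \<open>auto simp: has_real_derivative_iff_has_vector_derivative[symmetric]\<close>)
  then have pw: "((\<lambda>t. c * t ^ n) has_integral c * (1 / Suc n)) {0..1}"
    by (intro has_integral_mult_right) simp
  have "\<bar>picard m p h s - picard m p k s\<bar> =
     \<bar>s\<bar> * \<bar>integral {0..1} (\<lambda>t. kern m t * rhs m p (s * t) (h (s * t)) - kern m t * rhs m p (s * t) (k (s * t)))\<bar>"
    unfolding picard_def by (simp add: integral_diff[OF i[OF h(1)] i[OF h(2)]] abs_mult[symmetric] right_diff_distrib)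
  also have "\<dots> \<le> \<bar>s\<bar> * (c * (1 / Suc n))"
  proof (rule mult_left_mono)
    show "\<bar>integral {0..1} (\<lambda>t. kern m t * rhs m p (s * t) (h (s * t)) - kern m t * rhs m p (s * t) (k (s * t)))\<bar> \<le> c * (1 / Suc n)"
      using integral_norm_bound_integral[OF integrable_diff[OF i[OF h(1)] i[OF h(2)]] has_integral_integrable[OF pw]]
        bound integral_unique[OF pw] by auto
  qed simp
  also have "\<dots> = B * (L * \<bar>s\<bar>) ^ Suc n / fact (Suc n)"
    by (simp add: c_def field_simps)
  finally show ?thesis .
qed

lemma iterate_diff_le:
  assumes m: "m \<ge> 1" and L: "\<bar>s\<bar> + \<bar>snd p\<bar> \<le> L"
  shows "\<bar>iterate m (Suc k) p s - iterate m k p s\<bar> \<le> (L * \<bar>s\<bar>) ^ Suc k / fact (Suc k)"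
  using L
proof (induction k arbitrary: s)
  case 0
  \<comment> \<open>The initial iterate 1 is the Picard image of the zero function, so the first
    difference is covered by \<open>picard_diff_le\<close> with \<open>B = 1\<close> and
    \<open>n = 0\<close>.\<close>
  have "rhs m p t 0 = 0" for t by (simp add: rhs_def)
  then have "picard m p (\<lambda>_. 0) s = 1" by (simp add: picard_def)
  then show ?case
    using picard_diff_le[OF m, of "\<lambda>_. 1" "\<lambda>_. 0" s p L 1 0] 0 by simp
next
  case (Suc k)
  show ?case
    unfolding iterate.simps
    using picard_diff_le[OF m continuous_slice[OF continuous_iterate] continuous_slice[OF continuous_iterate], of s p L 1 m "Suc k" p m k p "Suc k"]
    Suc by simp
qed

text \<open>Only \<open>s\<close> and \<open>\<omega>\<close> are restricted: since the Lipschitz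
  constant is independent of \<open>a\<close>, the convergence is uniform in
  \<open>a\<close>.\<close>

lemma profile_uniform_limit:
  assumes m: "m \<ge> 1"
  shows "uniform_limit {x. \<bar>snd x\<bar> + \<bar>snd (fst x)\<bar> \<le> L} (\<lambda>k x. iterate m k (fst x) (snd x)) (\<lambda>x. profile m (fst x) (snd x)) sequentially"
proof -
  define d where "d k x = iterate m (Suc k) (fst x) (snd x) - iterate m k (fst x) (snd x)"
    for k and x :: "(real \<times> real) \<times> real"
  have "uniform_limit {x. \<bar>snd x\<bar> + \<bar>snd (fst x)\<bar> \<le> L} (\<lambda>n x. \<Sum>i<n. d i x) (\<lambda>x. suminf (\<lambda>i. d i x)) sequentially"
  proof (rule Weierstrass_m_test[where M="\<lambda>k. (L * L) ^ Suc k / fact (Suc k)"])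
    fix k and x :: "(real \<times> real) \<times> real" assume x: "x \<in> {x. \<bar>snd x\<bar> + \<bar>snd (fst x)\<bar> \<le> L}"
    then have "norm (d k x) \<le> (L * \<bar>snd x\<bar>) ^ Suc k / fact (Suc k)"
      unfolding d_def real_norm_def by (intro iterate_diff_le[OF m]) auto
    also have "\<dots> \<le> (L * L) ^ Suc k / fact (Suc k)"
      using x by (intro divide_right_mono power_mono mult_left_mono) auto
    finally show "norm (d k x) \<le> (L * L) ^ Suc k / fact (Suc k)" .
  next
    have "summable (\<lambda>k. (L * L) ^ k / fact k)"
      using summable_exp[of "L * L"] by (simp add: field_simps)
    then show "summable (\<lambda>k. (L * L) ^ Suc k / fact (Suc k))"
      by (subst summable_Suc_iff[of "\<lambda>k. (L * L) ^ k / fact k"])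
  qed
  moreover have "(\<Sum>i<n. d i x) = iterate m n (fst x) (snd x) - 1" for n x
    unfolding d_def sum_lessThan_telescope[where f="\<lambda>k. iterate m k (fst x) (snd x)"] by simp
  ultimately have "uniform_limit {x. \<bar>snd x\<bar> + \<bar>snd (fst x)\<bar> \<le> L} (\<lambda>n x. 1 + (iterate m n (fst x) (snd x) - 1)) (\<lambda>x. 1 + suminf (\<lambda>i. d i x)) sequentially"
    by (intro uniform_limit_intros) simp
  then show ?thesis by (simp add: profile_def d_def)
qed

lemma continuous_profile:
  assumes m: "m \<ge> 1"
  shows "continuous_on UNIV (\<lambda>x. profile m (fst x) (snd x))"
proof -
  have "isCont (\<lambda>x. profile m (fst x) (snd x)) x" for x
  proof -
    define L where "L = \<bar>snd x\<bar> + \<bar>snd (fst x)\<bar> + 1"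
    let ?S = "{x. \<bar>snd x\<bar> + \<bar>snd (fst x)\<bar> < L} :: ((real \<times> real) \<times> real) set"
    have "continuous_on {x. \<bar>snd x\<bar> + \<bar>snd (fst x)\<bar> \<le> L} (\<lambda>x. profile m (fst x) (snd x))"
      by (rule uniform_limit_theorem[OF _ profile_uniform_limit[OF m]])
         (auto intro!: always_eventually continuous_on_subset[OF continuous_iterate])
    then have "continuous_on ?S (\<lambda>x. profile m (fst x) (snd x))"
      by (rule continuous_on_subset) auto
    moreover have "open ?S" by (intro open_Collect_less continuous_intros)
    moreover have "x \<in> ?S" by (simp add: L_def)
    ultimately show ?thesis using continuous_on_eq_continuous_at by blast
  qed
  then show ?thesis by (simp add: continuous_on_eq_continuous_at)
qed

lemma profile_fixed_point:
  assumes m: "m \<ge> 1"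
  shows "profile m p s = picard m p (profile m p) s"
proof -
  define L where "L = \<bar>s\<bar> + \<bar>snd p\<bar>"
  have ul: "uniform_limit {x. \<bar>snd x\<bar> + \<bar>snd (fst x)\<bar> \<le> L} (\<lambda>k x. iterate m k (fst x) (snd x)) (\<lambda>x. profile m (fst x) (snd x)) sequentially"
    by (rule profile_uniform_limit[OF m])
  have conv: "(\<lambda>k. iterate m k p s) \<longlonglongrightarrow> profile m p s"
    using tendsto_uniform_limitI[OF ul, of "(p, s)"] by (simp add: L_def)
  have "(\<lambda>k. iterate m (Suc k) p s) \<longlonglongrightarrow> picard m p (profile m p) s"
  proof (rule metric_LIMSEQ_I)
    fix e :: real assume e: "e > 0"
    \<comment> \<open>Chosen so that \<open>B L \<bar>s\<bar> < e\<close>; the summand 1 keeps the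
      denominator positive when \<open>s = 0\<close>.\<close>
    define B where "B = e / (2 * (L * \<bar>s\<bar> + 1))"
    have L0: "L * \<bar>s\<bar> \<ge> 0" by (simp add: L_def)
    then have B: "B > 0" using e by (simp add: B_def add_nonneg_pos)
    from uniform_limitD[OF ul B] obtain N where N: "\<forall>k\<ge>N. \<forall>x\<in>{x. \<bar>snd x\<bar> + \<bar>snd (fst x)\<bar> \<le> L}. dist (iterate m k (fst x) (snd x)) (profile m (fst x) (snd x)) < B"
      unfolding eventually_sequentially by blast
    have "dist (iterate m (Suc k) p s) (picard m p (profile m p) s) < e" if "k \<ge> N" for k
    proof -
      have "\<bar>picard m p (iterate m k p) s - picard m p (profile m p) s\<bar> \<le> B * (L * \<bar>s\<bar>) ^ Suc 0 / fact (Suc 0)"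
      proof (rule picard_diff_le[OF m])
        fix t :: real assume "\<bar>t\<bar> \<le> \<bar>s\<bar>"
        then show "\<bar>iterate m k p t - profile m p t\<bar> \<le> B * (L * \<bar>t\<bar>) ^ 0 / fact 0"
          using N[rule_format, OF that, of "(p, t)"] by (simp add: L_def dist_real_def)
      qed (use B in \<open>auto simp: L_def intro: continuous_slice continuous_iterate continuous_profile m\<close>)
      also have "\<dots> < e"
      proof -
        have "e * (L * \<bar>s\<bar>) < e * (2 * (L * \<bar>s\<bar> + 1))" using e L0 by (intro mult_strict_left_mono) auto
        then show ?thesis using L0 by (simp add: B_def pos_divide_less_eq add_nonneg_pos)
      qed
      finally show ?thesis by (simp add: dist_real_def)
    qed
    then show "\<exists>no. \<forall>n\<ge>no. dist (iterate m (Suc n) p s) (picard m p (profile m p) s) < e" by blast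
  qed
  then show ?thesis using conv LIMSEQ_Suc LIMSEQ_unique by blast
qed

text \<open>Feeding the fixed point equation into \<open>picard_diff_le\<close> repeatedly bounds
  the difference by \<open>B (L \<bar>s\<bar>)^n / n!\<close> for every \<open>n\<close>. This is
  how an explicit solution is recognised as the profile.\<close>

lemma profile_unique:
  assumes m: "m \<ge> 1" and h: "continuous_on UNIV h" and eq: "\<And>s. h s = picard m p h s"
  shows "h s = profile m p s"
proof -
  define L where "L = \<bar>s\<bar> + \<bar>snd p\<bar>"
  note c = continuous_slice[OF continuous_profile[OF m]]
  have "continuous_on (cball 0 \<bar>s\<bar>) (\<lambda>t. \<bar>h t - profile m p t\<bar>)"
    by (intro continuous_intros continuous_on_subset[OF h] c) auto
  then have "bounded ((\<lambda>t. \<bar>h t - profile m p t\<bar>) ` cball 0 \<bar>s\<bar>)"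
    by (intro compact_imp_bounded compact_continuous_image) auto
  then obtain B where B: "B > 0" "\<And>t. \<bar>t\<bar> \<le> \<bar>s\<bar> \<Longrightarrow> \<bar>h t - profile m p t\<bar> \<le> B"
    unfolding bounded_pos by auto
  have "\<bar>h t - profile m p t\<bar> \<le> B * (L * \<bar>t\<bar>) ^ n / fact n" if "\<bar>t\<bar> \<le> \<bar>s\<bar>" for n t
    using that
  proof (induction n arbitrary: t)
    case (Suc n)
    have "\<bar>picard m p h t - picard m p (profile m p) t\<bar> \<le> B * (L * \<bar>t\<bar>) ^ Suc n / fact (Suc n)"
      by (rule picard_diff_le[OF m h c]) (use B Suc in \<open>auto simp: L_def\<close>)
    then show ?case using eq[of t] profile_fixed_point[OF m, of p t] by simp
  qed (use B in auto)
  then have "\<bar>h s - profile m p s\<bar> \<le> B * ((L * \<bar>s\<bar>) ^ n / fact n)" for n by (simp add: mult.assoc)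
  moreover have "(\<lambda>n. B * ((L * \<bar>s\<bar>) ^ n / fact n)) \<longlonglongrightarrow> B * 0"
    using summable_LIMSEQ_zero[OF summable_exp[of "L * \<bar>s\<bar>"]]
    by (intro tendsto_intros) (simp add: field_simps)
  ultimately have "\<bar>h s - profile m p s\<bar> \<le> B * 0" by (intro LIMSEQ_le_const) auto
  then show ?thesis by simp
qed

lemma profile_0: "m \<ge> 1 \<Longrightarrow> profile m p 0 = 1"
  using profile_fixed_point[of m p 0] by (simp add: picard_def)

text \<open>The derivative of the profile: one integration of the equation expresses
  \<open>s^(m+1) H'(s)\<close> as the integral of \<open>\<tau>^m f(\<tau>)\<close> over
  \<open>[0, s]\<close>, and \<open>\<tau> = s t\<close> extends the quotient continuously to
  \<open>s = 0\<close>.\<close>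

definition slope :: "nat \<Rightarrow> real \<times> real \<Rightarrow> real \<Rightarrow> real" where
  "slope m p s = integral {0..1} (\<lambda>t. t ^ m * rhs m p (s * t) (profile m p (s * t)))"

lemma continuous_slope:
  assumes m: "m \<ge> 1"
  shows "continuous_on UNIV (\<lambda>x. slope m (fst x) (snd x))"
  unfolding slope_def
  using integral_continuous_on_param[OF continuous_on_scaled(2)[OF continuous_profile[OF m]], of m m]
  by (simp add: cbox_interval)

definition force :: "nat \<Rightarrow> real \<times> real \<Rightarrow> real \<Rightarrow> real" where
  "force m p s = rhs m p s (profile m p s)"

lemma continuous_force:
  assumes m: "m \<ge> 1"
  shows "continuous_on UNIV (\<lambda>x. force m (fst x) (snd x))"
  unfolding force_def by (intro continuous_intros continuous_profile m)

lemma integral_rescale: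
  fixes g :: "real \<Rightarrow> real"
  assumes "s > 0" "continuous_on {0..s} g"
  shows "integral {0..1} (\<lambda>t. g (s * t)) = integral {0..s} g / s"
proof -
  have "((\<lambda>t. g (s * t)) has_integral (1 / \<bar>s\<bar>) *\<^sub>R integral {0..s} g) ((\<lambda>x. x / s) ` {0..s})"
    using has_integral_stretch_real[OF integrable_integral[OF integrable_continuous_real[OF assms(2)]], of s] assms(1) by simp
  moreover have "(\<lambda>x. x / s) ` {0..s} = {0..1}"
    using image_divide_atLeastAtMost[OF assms(1), of 0 s] assms(1) by simp
  ultimately show ?thesis using assms(1) by (simp add: integral_unique)
qed

text \<open>Undoing the substitution moves \<open>s\<close> into the limits of integration, where
  the fundamental theorem of calculus can differentiate.\<close>

lemma slope_eq:
  assumes m: "m \<ge> 1" and s: "s > 0"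
  shows "slope m p s = integral {0..s} (\<lambda>t. t ^ m * force m p t) / s ^ (m + 1)"
    and "profile m p s = 1 + (integral {0..s} (force m p) - integral {0..s} (\<lambda>t. t ^ m * force m p t) / s ^ m) / m"
proof -
  note c = continuous_slice[OF continuous_force[OF m]]
  have "slope m p s = integral {0..1} (\<lambda>t. (\<lambda>t. (t / s) ^ m * force m p t) (s * t))"
    using s by (simp add: slope_def force_def)
  also have "\<dots> = integral {0..s} (\<lambda>t. (t / s) ^ m * force m p t) / s"
    using s by (intro integral_rescale continuous_intros c) auto
  also have "(\<lambda>t. (t / s) ^ m * force m p t) = (\<lambda>t. (1 / s ^ m) * (t ^ m * force m p t))"
    by (simp add: power_divide fun_eq_iff)
  finally show "slope m p s = integral {0..s} (\<lambda>t. t ^ m * force m p t) / s ^ (m + 1)"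
    by simp
  have "profile m p s = 1 + s * integral {0..1} (\<lambda>t. (\<lambda>t. kern m (t / s) * force m p t) (s * t))"
    using s by (subst profile_fixed_point[OF m]) (simp add: picard_def force_def)
  also have "integral {0..1} (\<lambda>t. (\<lambda>t. kern m (t / s) * force m p t) (s * t)) = integral {0..s} (\<lambda>t. kern m (t / s) * force m p t) / s"
    using s by (intro integral_rescale continuous_intros c) auto
  also have "(\<lambda>t. kern m (t / s) * force m p t) = (\<lambda>t. (1 / m) * force m p t - (1 / m) * (1 / s ^ m) * (t ^ m * force m p t))"
    using s m by (simp add: kern_def power_divide fun_eq_iff diff_divide_distrib left_diff_distrib)
  also have "integral {0..s} \<dots> = (1 / m) * integral {0..s} (force m p) - (1 / m) * (1 / s ^ m) * integral {0..s} (\<lambda>t. t ^ m * force m p t)"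
    by (subst integral_diff) (use s m in \<open>auto intro!: integrable_continuous_real continuous_intros c\<close>)
  finally show "profile m p s = 1 + (integral {0..s} (force m p) - integral {0..s} (\<lambda>t. t ^ m * force m p t) / s ^ m) / m"
    using s by (simp add: diff_divide_distrib right_diff_distrib mult.commute)
qed

lemma integral_has_real_derivative_at:
  fixes g :: "real \<Rightarrow> real"
  assumes "continuous_on UNIV g" "s > 0"
  shows "((\<lambda>s. integral {0..s} g) has_real_derivative g s) (at s)"
proof -
  have "((\<lambda>s. integral {0..s} g) has_real_derivative g s) (at s within {0..s+1})"
    using assms by (intro integral_has_real_derivative continuous_on_subset[OF assms(1)]) auto
  moreover have "at s within {0..s+1} = at s"
    using assms(2) by (intro at_within_interior) auto
  ultimately show ?thesis by simp
qed

lemma profile_deriv: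
  assumes m: "m \<ge> 1" and s: "s > 0"
  shows "(profile m p has_real_derivative slope m p s) (at s)"
    and "(slope m p has_real_derivative (force m p s - (real m + 1) * slope m p s) / s) (at s)"
proof -
  define A where "A s = integral {0..s} (force m p)" for s
  define B where "B s = integral {0..s} (\<lambda>t. t ^ m * force m p t)" for s
  have dA: "(A has_real_derivative force m p s) (at s)"
    unfolding A_def by (rule integral_has_real_derivative_at[OF continuous_slice[OF continuous_force[OF m]] s])
  have dB: "(B has_real_derivative s ^ m * force m p s) (at s)"
    unfolding B_def
    by (rule integral_has_real_derivative_at[OF _ s]) (intro continuous_intros continuous_slice[OF continuous_force[OF m]])
  have ev: "\<forall>\<^sub>F t in nhds s. t > 0" using s eventually_nhds_in_open[of "{0<..}" s] by auto
  have Beq: "B s = s ^ (m + 1) * slope m p s" using slope_eq(1)[OF m s] s by (simp add: B_def)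
  have "((\<lambda>t. 1 + (A t - B t / t ^ m) / m) has_real_derivative slope m p s) (at s)"
  proof -
    have "((\<lambda>t. t ^ m) has_real_derivative m * s ^ (m - 1)) (at s)"
      by (auto intro!: derivative_eq_intros)
    from DERIV_add[OF DERIV_const DERIV_cdivide[OF DERIV_diff[OF dA DERIV_divide[OF dB this]], of m], of 1]
    have "((\<lambda>t. 1 + (A t - B t / t ^ m) / m) has_real_derivative
       (force m p s - (s ^ m * force m p s * s ^ m - B s * (m * s ^ (m - 1))) / (s ^ m * s ^ m)) / m) (at s)"
      using s by simp
    moreover have "B s * (m * s ^ (m - 1)) = m * slope m p s * (s ^ m * s ^ m)"
      using m by (cases m) (simp_all add: Beq)
    ultimately show ?thesis using s m by (simp add: diff_divide_distrib)
  qed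
  note D = this
  have "\<forall>\<^sub>F t in nhds s. profile m p t = 1 + (A t - B t / t ^ m) / m"
    using ev by eventually_elim (simp add: slope_eq(2)[OF m] A_def B_def)
  from iffD2[OF DERIV_cong_ev[OF refl this refl] D]
  show "(profile m p has_real_derivative slope m p s) (at s)" .
  have "((\<lambda>t. B t / t ^ (m + 1)) has_real_derivative (force m p s - (real m + 1) * slope m p s) / s) (at s)"
  proof -
    have "((\<lambda>t. t ^ (m + 1)) has_real_derivative (m + 1) * s ^ m) (at s)"
      using DERIV_pow[of "m + 1" s] by simp
    from DERIV_divide[OF dB this]
    have "((\<lambda>t. B t / t ^ (m + 1)) has_real_derivative
       (s ^ m * force m p s * s ^ (m + 1) - B s * ((m + 1) * s ^ m)) / (s ^ (m + 1) * s ^ (m + 1))) (at s)"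
      using s by simp
    moreover have "(s ^ m * force m p s * s ^ (m + 1) - B s * ((m + 1) * s ^ m)) = (s ^ m * s ^ (m + 1)) * (force m p s - (real m + 1) * slope m p s)"
      by (simp add: Beq algebra_simps)
    ultimately show ?thesis using s by simp
  qed
  note D = this
  have "\<forall>\<^sub>F t in nhds s. slope m p t = B t / t ^ (m + 1)"
    using ev by eventually_elim (simp add: slope_eq(1)[OF m] B_def)
  from iffD2[OF DERIV_cong_ev[OF refl this refl] D]
  show "(slope m p has_real_derivative (force m p s - (real m + 1) * slope m p s) / s) (at s)" .
qed

subsection \<open>Phase of a radial solution\<close>

locale positive_degree =
  fixes m :: nat
  assumes m: "m \<ge> 1"
begin

lemmas continuous_profile_slice = continuous_slice[OF continuous_profile[OF m]]
  and continuous_slope_slice = continuous_slice[OF continuous_slope[OF m]]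
  and continuous_force_slice = continuous_slice[OF continuous_force[OF m]]

lemma abs_force_le: "\<bar>force m p s\<bar> \<le> (\<bar>s\<bar> + \<bar>snd p\<bar>) * \<bar>profile m p s\<bar>"
proof -
  have "\<bar>force m p s\<bar> \<le> (\<bar>s\<bar> + \<bar>snd p\<bar>) * \<bar>profile m p s\<bar> / 4"
    unfolding force_def by (rule abs_rhs_le)
  moreover have "0 \<le> (\<bar>s\<bar> + \<bar>snd p\<bar>) * \<bar>profile m p s\<bar>" by simp
  ultimately show ?thesis by linarith
qed

text \<open>The equation is regular on \<open>[e, s]\<close> for every \<open>e > 0\<close>, so by a
  backward Gronwall estimate a double zero at \<open>s\<close> would spread to all of
  \<open>(0, s)\<close>, and by continuity to \<open>0\<close>, where the profile is 1.\<close>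

lemma profile_slope_nonzero:
  assumes "s \<ge> 0"
  shows "profile m p s \<noteq> 0 \<or> slope m p s \<noteq> 0"
proof (cases "s = 0")
  case True then show ?thesis using profile_0[OF m, of p] by simp
next
  case False
  then have s: "s > 0" using assms by simp
  show ?thesis
  proof (rule ccontr)
    assume "\<not> ?thesis"
    then have z: "profile m p s = 0" "slope m p s = 0" by auto
    have "profile m p e = 0" if e: "0 < e" "e < s" for e
    proof -
      define y where "y t = (profile m p t)\<^sup>2 + (slope m p t)\<^sup>2" for t
      define C where "C = 1 + (s + \<bar>snd p\<bar>) / e"
      define dy where "dy t = 2 * profile m p t * slope m p t + 2 * slope m p t * ((force m p t - (real m + 1) * slope m p t) / t)" for t
      \<comment> \<open>\<open>K\<close> bounds \<open>- y' / y\<close> on \<open>[e, s]\<close>;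
        its three summands come from \<open>2 H H'\<close>, from the force and from the damping
        \<open>(m + 1) H' / s\<close>.\<close>
      define K where "K = C + 2 * (real m + 1) / e"
      have "y e * exp (K * e) \<le> y s * exp (K * s)"
      proof (rule DERIV_nonneg_imp_nondecreasing[of e s])
        fix t assume t: "e \<le> t" "t \<le> s"
        then have t0: "t > 0" using e by linarith
        have "(y has_real_derivative dy t) (at t)"
          unfolding y_def dy_def
          by (rule derivative_eq_intros profile_deriv[OF m t0] refl)+ (simp add: algebra_simps)
        then have "((\<lambda>t. y t * exp (K * t)) has_real_derivative (dy t + K * y t) * exp (K * t)) (at t)"
          by (auto intro!: derivative_eq_intros simp: algebra_simps)
        moreover have "dy t + K * y t \<ge> 0"
        proof -
          define h q where "h = \<bar>profile m p t\<bar>" and "q = \<bar>slope m p t\<bar>"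
          have h0: "h \<ge> 0" "q \<ge> 0" by (auto simp: h_def q_def)
          have yhq: "y t = h\<^sup>2 + q\<^sup>2" by (simp add: y_def h_def q_def)
          have f: "\<bar>force m p t\<bar> / t \<le> (s + \<bar>snd p\<bar>) / e * h"
          proof -
            have "\<bar>force m p t\<bar> / t \<le> (s + \<bar>snd p\<bar>) * h / e"
              using abs_force_le[of p t] t t0 e
              by (intro frac_le) (auto simp: h_def intro!: order_trans[OF abs_force_le] mult_right_mono)
            then show ?thesis by simp
          qed
          have d: "dy t = 2 * profile m p t * slope m p t + 2 * slope m p t * (force m p t / t) - 2 * (real m + 1) / t * (slope m p t)\<^sup>2"
            using t0 by (simp add: dy_def field_simps power2_eq_square)
          have x1: "\<bar>2 * profile m p t * slope m p t\<bar> \<le> h\<^sup>2 + q\<^sup>2"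
            using sum_squares_bound[of h q] by (simp add: abs_mult h_def q_def)
          have x2: "\<bar>2 * slope m p t * (force m p t / t)\<bar> \<le> (s + \<bar>snd p\<bar>) / e * (h\<^sup>2 + q\<^sup>2)"
          proof -
            have "\<bar>2 * slope m p t * (force m p t / t)\<bar> = 2 * q * (\<bar>force m p t\<bar> / t)" using t0 by (simp add: abs_mult q_def)
            also have "\<dots> \<le> 2 * q * ((s + \<bar>snd p\<bar>) / e * h)" using h0 by (intro mult_left_mono f) auto
            also have "\<dots> = (s + \<bar>snd p\<bar>) / e * (2 * h * q)" by simp
            also have "\<dots> \<le> (s + \<bar>snd p\<bar>) / e * (h\<^sup>2 + q\<^sup>2)"
              using e s sum_squares_bound[of h q] by (intro mult_left_mono) auto
            finally show ?thesis .
          qed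
          have x3: "2 * (real m + 1) / t * (slope m p t)\<^sup>2 \<le> 2 * (real m + 1) / e * (h\<^sup>2 + q\<^sup>2)"
            using t e by (intro mult_mono frac_le) (auto simp: q_def h_def)
          have "K * (h\<^sup>2 + q\<^sup>2) = (h\<^sup>2 + q\<^sup>2) + (s + \<bar>snd p\<bar>) / e * (h\<^sup>2 + q\<^sup>2) + 2 * (real m + 1) / e * (h\<^sup>2 + q\<^sup>2)"
            unfolding K_def C_def by (simp only: distrib_right mult_1_left)
          then show ?thesis unfolding yhq d using abs_le_D2[OF x1] abs_le_D2[OF x2] x3 by linarith
        qed
        ultimately show "\<exists>y'. ((\<lambda>t. y t * exp (K * t)) has_real_derivative y') (at t) \<and> 0 \<le> y'" by auto
      qed (use e in auto)
      then have "y e * exp (K * e) \<le> 0" using z by (simp add: y_def)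
      then have "y e \<le> 0" by (simp add: mult_le_0_iff)
      then show ?thesis unfolding y_def by (metis add.commute sum_power2_le_zero_iff)
    qed
    moreover have "(profile m p \<longlongrightarrow> profile m p 0) (at_right 0)"
      using continuous_profile_slice[of UNIV p] by (auto simp: continuous_on_def intro: tendsto_within_subset)
    moreover have "\<forall>\<^sub>F e in at_right 0. 0 < e \<and> e < s"
      using s by (simp add: eventually_at_right_field) blast
    ultimately have "(profile m p \<longlongrightarrow> profile m p 0) (at_right 0)" "\<forall>\<^sub>F e in at_right 0. profile m p e = 0"
      by (auto elim: eventually_mono)
    then have "((\<lambda>_. 0) \<longlongrightarrow> profile m p 0) (at_right (0 :: real))"
      by (rule Lim_transform_eventually)
    then have "profile m p 0 = 0" using tendsto_unique[OF _ _ tendsto_const] by (metis trivial_limit_at_right_real)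
    then show False using profile_0[OF m, of p] by simp
  qed
qed

text \<open>The quantity of the self-adjoint form \<open>(s^(m+1) H')' = s^m f\<close> of the
  equation.\<close>

definition flux :: "real \<times> real \<Rightarrow> real \<Rightarrow> real" where
  "flux p s = s ^ (m + 1) * slope m p s"

lemma flux_deriv:
  assumes "s > 0"
  shows "(flux p has_real_derivative s ^ m * force m p s) (at s)"
proof -
  have "((\<lambda>t. t ^ (m + 1)) has_real_derivative (m + 1) * s ^ m) (at s)"
    using DERIV_pow[of "m + 1" s] by simp
  from DERIV_mult[OF this profile_deriv(2)[OF m assms, of p]]
  show ?thesis unfolding flux_def using assms by (simp add: field_simps)
qed

lemma force_times_profile: "force m p s * profile m p s = potential m p s (profile m p s) * (profile m p s)\<^sup>2 / 4"
  by (simp add: force_def rhs_def power2_eq_square)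

text \<open>The derivative is \<open>s^m V H^2 / 4 + s^(m+1) H'^2\<close>, where
  \<open>V \<ge> s - \<omega> > 0\<close>, and \<open>H\<close>, \<open>H'\<close> have no common
  zero. The left endpoint may be \<open>max \<omega> 0\<close> itself; \<open>sector_pos\<close>
  uses this at \<open>s = 0\<close>.\<close>

lemma flux_profile_increasing:
  assumes "max (snd p) 0 \<le> s" "s < t"
  shows "flux p s * profile m p s < flux p t * profile m p t"
proof (rule DERIV_pos_imp_increasing_open[OF assms(2)])
  fix x assume x: "s < x" "x < t"
  then have x0: "x > 0" "x > snd p" using assms by auto
  have d: "((\<lambda>s. flux p s * profile m p s) has_real_derivative x ^ m * force m p x * profile m p x + slope m p x * flux p x) (at x)"
    using DERIV_mult[OF flux_deriv[OF x0(1)] profile_deriv(1)[OF m x0(1)]] by simp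
  have V: "potential m p x h > 0" for h using potential_ge[of x p m h] x0 by simp
  have e: "x ^ m * force m p x * profile m p x + slope m p x * flux p x =
     x ^ m * (potential m p x (profile m p x) * (profile m p x)\<^sup>2 / 4) + x ^ (m + 1) * (slope m p x)\<^sup>2"
    unfolding force_times_profile[symmetric] by (simp add: flux_def power2_eq_square)
  have "0 < x ^ m * (potential m p x (profile m p x) * (profile m p x)\<^sup>2 / 4) + x ^ (m + 1) * (slope m p x)\<^sup>2"
  proof (cases "profile m p x = 0")
    case True
    then have "slope m p x \<noteq> 0" using profile_slope_nonzero[of x p] x0 by auto
    then show ?thesis using True x0 by simp
  next
    case False
    then show ?thesis using V x0 by (intro add_pos_nonneg mult_pos_pos divide_pos_pos) auto
  qed
  then show "\<exists>y. ((\<lambda>s. flux p s * profile m p s) has_real_derivative y) (at x) \<and> 0 < y"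
    using d e by auto
qed (unfold flux_def, intro continuous_intros continuous_profile_slice continuous_slope_slice)

lemma sgn_flux_profile:
  assumes "s > 0"
  shows "flux p s * profile m p s > 0 \<longleftrightarrow> profile m p s * slope m p s > 0"
    and "flux p s * profile m p s < 0 \<longleftrightarrow> profile m p s * slope m p s < 0"
  using assms zero_less_mult_iff[of "s ^ (m+1)" "slope m p s * profile m p s"]
     mult_less_0_iff[of "s ^ (m+1)" "slope m p s * profile m p s"]
  by (auto simp: flux_def mult.assoc mult.commute[of "slope m p s"])

text \<open>\<open>H + i H'\<close> has no zero on the convex set \<open>s \<ge> 0\<close> of
  triples \<open>(a, \<omega>, s)\<close>, so it has a continuous logarithm there. At
  \<open>((0, 0), 0)\<close> the value is 1, so its angle is a multiple of \<open>2 pi\<close> and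
  can be subtracted.\<close>

lemma phase_exists:
  "\<exists>\<theta>. continuous_on {x. snd x \<ge> 0} \<theta> \<and> (\<forall>x. snd x \<ge> 0 \<longrightarrow> (\<exists>r>0. profile m (fst x) (snd x) = r * cos (\<theta> x) \<and>
     slope m (fst x) (snd x) = r * sin (\<theta> x))) \<and> \<theta> ((0, 0), 0) = (0 :: real)"
proof -
  let ?T = "{x. snd x \<ge> 0} :: ((real \<times> real) \<times> real) set"
  let ?f = "\<lambda>x :: (real \<times> real) \<times> real. Complex (profile m (fst x) (snd x)) (slope m (fst x) (snd x))"
  have "continuous_on UNIV ?f"
    unfolding Complex_eq by (intro continuous_intros continuous_profile continuous_slope m)
  then have c: "continuous_on ?T ?f" by (rule continuous_on_subset) auto
  have "convex ?T" unfolding convex_def by auto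
  then have ct: "contractible ?T" by (rule convex_imp_contractible)
  have nz: "?f x \<noteq> 0" if "x \<in> ?T" for x
    using profile_slope_nonzero[of "snd x" "fst x"] that by (auto simp: complex_eq_iff)
  from continuous_logarithm_on_contractible[OF c ct nz]
  obtain g where g: "continuous_on ?T g" "\<And>x. x \<in> ?T \<Longrightarrow> ?f x = exp (g x)" by blast
  have polar: "profile m (fst x) (snd x) = exp (Re (g x)) * cos (Im (g x))" "slope m (fst x) (snd x) = exp (Re (g x)) * sin (Im (g x))"
    if "x \<in> ?T" for x
    using g(2)[OF that] by (auto simp: complex_eq_iff Re_exp Im_exp)
  define c0 where "c0 = Im (g ((0, 0), 0))"
  have "profile m (0, 0) 0 = 1" by (rule profile_0[OF m])
  moreover have "slope m (0, 0) 0 = 0" using m by (simp add: slope_def rhs_def potential_def)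
  ultimately have "cos c0 > 0" "sin c0 = 0"
    using polar[of "((0,0),0)"] by (auto simp: c0_def zero_less_mult_iff) (metis exp_gt_zero mult_eq_0_iff zero_less_mult_pos zero_less_one)
  then have "cos c0 = 1" using sin_cos_squared_add[of c0] by (simp add: power2_eq_1_iff)
  note c0 = this \<open>sin c0 = 0\<close>
  show ?thesis
  proof (intro exI[of _ "\<lambda>x. Im (g x) - c0"] conjI allI impI)
    show "continuous_on ?T (\<lambda>x. Im (g x) - c0)" by (intro continuous_intros g)
    fix x :: "(real \<times> real) \<times> real" assume "0 \<le> snd x"
    then show "\<exists>r>0. profile m (fst x) (snd x) = r * cos (Im (g x) - c0) \<and> slope m (fst x) (snd x) = r * sin (Im (g x) - c0)"
      using polar[of x] by (intro exI[of _ "exp (Re (g x))"]) (simp add: cos_diff sin_diff c0)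
  qed (simp add: c0_def)
qed

definition phase :: "real \<times> real \<Rightarrow> real \<Rightarrow> real" where
  "phase p s = (SOME \<theta>. continuous_on {x. snd x \<ge> 0} \<theta> \<and> (\<forall>x. snd x \<ge> 0 \<longrightarrow> (\<exists>r>0. profile m (fst x) (snd x) = r * cos (\<theta> x) \<and>
     slope m (fst x) (snd x) = r * sin (\<theta> x))) \<and> \<theta> ((0, 0), 0) = (0 :: real)) (p, s)"

lemma continuous_phase: "continuous_on {x. snd x \<ge> 0} (\<lambda>x. phase (fst x) (snd x))"
  and phase_polar: "s \<ge> 0 \<Longrightarrow> \<exists>r>0. profile m p s = r * cos (phase p s) \<and> slope m p s = r * sin (phase p s)"
  and phase_00: "phase (0, 0) 0 = 0"
proof -
  note * = someI_ex[OF phase_exists]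
  show "continuous_on {x. snd x \<ge> 0} (\<lambda>x. phase (fst x) (snd x))" unfolding phase_def using * by simp
  show "s \<ge> 0 \<Longrightarrow> \<exists>r>0. profile m p s = r * cos (phase p s) \<and> slope m p s = r * sin (phase p s)"
    unfolding phase_def using *[THEN conjunct2, THEN conjunct1, rule_format, of "(p, s)"] by simp
  show "phase (0, 0) 0 = 0" unfolding phase_def using * by simp
qed

lemma continuous_phase_slice: "S \<subseteq> {0..} \<Longrightarrow> continuous_on S (phase p)"
  by (rule continuous_on_compose2[OF continuous_phase, of S "\<lambda>s. (p, s)", simplified])
     (auto intro!: continuous_intros)

lemma continuous_phase_param: "s \<ge> 0 \<Longrightarrow> continuous_on S (\<lambda>p. phase p s)"
  using continuous_on_compose2[OF continuous_phase, of S "\<lambda>p. (p, s)"]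
  by (simp add: continuous_intros image_subset_iff)

text \<open>\<open>H(0) = 1\<close> keeps the cosine positive at \<open>s = 0\<close> for all
  parameters. The parameter plane is connected and the angle is 0 at one point, so it never reaches
  \<open>pi / 2\<close> in absolute value.\<close>

lemma phase_initial: "\<bar>phase p 0\<bar> < pi / 2"
proof (rule ccontr)
  assume "\<not> ?thesis"
  then have ge: "pi / 2 \<le> \<bar>phase p 0\<bar>" by simp
  have "connected ((\<lambda>p. \<bar>phase p 0\<bar>) ` UNIV)"
    by (intro connected_continuous_image continuous_intros continuous_phase_param) auto
  moreover have "\<bar>phase (0, 0) 0\<bar> \<le> pi / 2" by (simp add: phase_00)
  ultimately have "pi / 2 \<in> (\<lambda>p. \<bar>phase p 0\<bar>) ` UNIV"
    using ge connected_contains_Icc[of "(\<lambda>p. \<bar>phase p 0\<bar>) ` UNIV"] by (meson UNIV_I atLeastAtMost_iff image_eqI subsetD)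
  then obtain q where q: "\<bar>phase q 0\<bar> = pi / 2" by force
  then have "cos (phase q 0) = 0" by (metis cos_abs_real cos_pi_half)
  then show False using phase_polar[of 0 q] profile_0[OF m, of q] by simp
qed

section \<open>Trapping of the angle beyond the turning point\<close>

lemma sin_double_shift: "sin (2 * (of_int j * pi + a)) = sin (2 * a)"
proof -
  have "2 * (of_int j * pi + a) = 2 * a + (2 * pi) * of_int j" by (simp add: algebra_simps)
  then show ?thesis by (simp only: sin_add sin_int_2pin cos_int_2pin mult_zero_right mult_1_right add_0_right)
qed

lemma phase_sgn:
  assumes "s \<ge> 0"
  obtains r where "r > 0" "profile m p s * slope m p s = r * sin (2 * phase p s)"
proof -
  obtain r where "r > 0" "profile m p s = r * cos (phase p s)" "slope m p s = r * sin (phase p s)"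
    using phase_polar[OF assms] by blast
  then show ?thesis using that[of "r\<^sup>2 / 2"] by (simp add: sin_double power2_eq_square)
qed

text \<open>\<open>sin (2 \<theta>)\<close> has the sign of \<open>H H'\<close>. Once positive
  beyond \<open>max \<omega> 0\<close> it stays positive, so the angle cannot leave the open first
  or third quadrant.\<close>

lemma phase_crossing_impossible:
  assumes "max (snd p) 0 < s" "s < t"
    and "sin (2 * phase p s) > 0" "sin (2 * phase p t) = 0"
  shows False
proof -
  have st: "s > 0" "t > 0" using assms by auto
  obtain r where r: "r > 0" "profile m p s * slope m p s = r * sin (2 * phase p s)" using phase_sgn[of s p] st by auto
  obtain r' where r': "r' > 0" "profile m p t * slope m p t = r' * sin (2 * phase p t)" using phase_sgn[of t p] st by auto
  have "flux p s * profile m p s > 0" using sgn_flux_profile[OF st(1)] r assms by simp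
  moreover have "flux p s * profile m p s < flux p t * profile m p t"
    using flux_profile_increasing assms by auto
  ultimately have "profile m p t * slope m p t > 0" using sgn_flux_profile(1)[OF st(2), of p] by linarith
  then show False using r' assms by simp
qed

lemma phase_stays_above:
  fixes n :: int
  assumes "max (snd p) 0 < s" "s \<le> t" "phase p s > - of_int n * pi"
  shows "phase p t > - of_int n * pi"
proof (rule ccontr)
  assume "\<not> ?thesis"
  then have le: "phase p t \<le> - of_int n * pi" by simp
  have s0: "s > 0" using assms by simp
  \<comment> \<open>A descent to \<open>- n pi\<close> would pass through \<open>- n pi + e\<close>.
    The bound \<open>pi / 4\<close> puts \<open>2 e\<close> into \<open>(0, pi)\<close>, so the sine
    is positive there and zero at the end, against \<open>phase_crossing_impossible\<close>.\<close>
  define e where "e = min (pi / 4) (phase p s + of_int n * pi)"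
  have e: "0 < e" "e \<le> phase p s + of_int n * pi" using assms by (auto simp: e_def)
  have e4: "e \<le> pi / 4" unfolding e_def by (rule min.cobounded1)
  have "\<exists>u\<ge>s. u \<le> t \<and> phase p u = - of_int n * pi + e"
    using e le assms by (intro IVT2' continuous_phase_slice) (use s0 in auto)
  then obtain u where u: "s \<le> u" "u \<le> t" "phase p u = - of_int n * pi + e" by blast
  have "\<exists>v\<ge>u. v \<le> t \<and> phase p v = - of_int n * pi"
    using e le assms u by (intro IVT2' continuous_phase_slice) (use s0 in auto)
  then obtain v where v: "u \<le> v" "v \<le> t" "phase p v = - of_int n * pi" by blast
  have "u \<noteq> v" using u v e by auto
  then have "u < v" using v by simp
  moreover have "sin (2 * phase p u) > 0"
  proof -
    have "sin (2 * phase p u) = sin (2 * e)" using sin_double_shift[of "-n" e] u by simp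
    then show ?thesis using e e4 sin_gt_zero[of "2 * e"] pi_gt_zero by simp
  qed
  moreover have "sin (2 * phase p v) = 0" using sin_double_shift[of "-n" 0] v by simp
  ultimately show False using phase_crossing_impossible[of p u v] assms u by auto
qed

lemma phase_stays_below:
  fixes n :: int
  assumes "max (snd p) 0 < s" "s \<le> t" "phase p s < - of_int n * pi - pi / 2"
  shows "phase p t < - of_int n * pi - pi / 2"
proof (rule ccontr)
  assume "\<not> ?thesis"
  then have le: "phase p t \<ge> - of_int n * pi - pi / 2" by simp
  have s0: "s > 0" using assms by simp
  define e where "e = min (pi / 4) (- of_int n * pi - pi / 2 - phase p s)"
  have e: "0 < e" "e \<le> - of_int n * pi - pi / 2 - phase p s" using assms by (auto simp: e_def)
  have e4: "e \<le> pi / 4" unfolding e_def by (rule min.cobounded1)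
  have "\<exists>u\<ge>s. u \<le> t \<and> phase p u = - of_int n * pi - pi / 2 - e"
    using e le assms by (intro IVT' continuous_phase_slice) (use s0 in auto)
  then obtain u where u: "s \<le> u" "u \<le> t" "phase p u = - of_int n * pi - pi / 2 - e" by blast
  have "\<exists>v\<ge>u. v \<le> t \<and> phase p v = - of_int n * pi - pi / 2"
    using e le assms u by (intro IVT' continuous_phase_slice) (use s0 in auto)
  then obtain v where v: "u \<le> v" "v \<le> t" "phase p v = - of_int n * pi - pi / 2" by blast
  have "u \<noteq> v" using u v e by auto
  then have "u < v" using v by simp
  moreover have "sin (2 * phase p u) > 0"
  proof -
    have "phase p u = of_int (- n) * pi + (- pi / 2 - e)" using u by simp
    then have "sin (2 * phase p u) = sin (2 * (- pi / 2 - e))" by (simp only: sin_double_shift)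
    also have "\<dots> = sin (2 * e)" by (simp add: sin_diff right_diff_distrib)
    finally show ?thesis using e e4 sin_gt_zero[of "2 * e"] pi_gt_zero by simp
  qed
  moreover have "sin (2 * phase p v) = 0" 
  proof -
    have "phase p v = of_int (- n) * pi + (- pi / 2)" using v by simp
    then have "sin (2 * phase p v) = sin (2 * (- pi / 2))" by (simp only: sin_double_shift)
    then show ?thesis by simp
  qed
  ultimately show False using phase_crossing_impossible[of p u v] assms u by auto
qed

section \<open>Partition of the parameter plane by the final angle\<close>

definition sector :: "int \<Rightarrow> (real \<times> real) set" where
  "sector n = {p. \<forall>s > max (snd p) 0. - of_int n * pi - pi / 2 \<le> phase p s \<and> phase p s \<le> - of_int n * pi}"

text \<open>One witness \<open>s\<close> suffices here and in \<open>below\<close>, since by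
  \<open>phase_stays_above\<close> and \<open>phase_stays_below\<close> the angle then keeps its
  side forever. For a fixed \<open>s\<close> the condition is open in \<open>p\<close>, hence both
  sets are open.\<close>

definition above :: "int \<Rightarrow> (real \<times> real) set" where
  "above n = {p. \<exists>s > max (snd p) 0. phase p s > - of_int n * pi}"

definition below :: "int \<Rightarrow> (real \<times> real) set" where
  "below n = {p. \<exists>s > max (snd p) 0. phase p s < - of_int n * pi - pi / 2}"

lemma Compl_sector: "- sector n = above n \<union> below n"
  unfolding sector_def above_def below_def by (auto simp: not_le)

lemma open_above: "open (above n)"
proof -
  have "above n = (\<Union>s\<in>{0<..}. {p. snd p < s} \<inter> {p. phase p s > - of_int n * pi})"
    by (auto simp: above_def)
  also have "open \<dots>"
    by (intro open_UN ballI open_Int open_Collect_less continuous_intros continuous_phase_param) auto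
  finally show ?thesis .
qed

lemma open_below: "open (below n)"
proof -
  have "below n = (\<Union>s\<in>{0<..}. {p. snd p < s} \<inter> {p. phase p s < - of_int n * pi - pi / 2})"
    by (auto simp: below_def)
  also have "open \<dots>"
    by (intro open_UN ballI open_Int open_Collect_less continuous_intros continuous_phase_param) auto
  finally show ?thesis .
qed

lemma closed_sector: "closed (sector n)"
  using open_above open_below by (simp add: closed_def Compl_sector open_Un)

lemma above_below_disjoint: "above n \<inter> below n = {}"
proof -
  have False if mem: "p \<in> above n" "p \<in> below n" for p
  proof -
    obtain s t where st: "s > max (snd p) 0" "phase p s > - of_int n * pi" "t > max (snd p) 0" "phase p t < - of_int n * pi - pi / 2"
      using mem unfolding above_def below_def mem_Collect_eq by blast
    have "phase p (max s t) > - of_int n * pi" using phase_stays_above[of p s "max s t" n] st by auto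
    moreover have "phase p (max s t) < - of_int n * pi - pi / 2" using phase_stays_below[of p t "max s t" n] st by auto
    ultimately show False using pi_gt_zero by linarith
  qed
  then show ?thesis by blast
qed

text \<open>The range of the angle only gives \<open>H H' \<le> 0\<close>. If equality held at
  \<open>s\<close>, strict growth of \<open>flux * profile\<close> would make it positive at
  \<open>s + 1\<close>.\<close>

lemma sector_decreasing:
  assumes "p \<in> sector n" "s > max (snd p) 0"
  shows "profile m p s * slope m p s < 0"
proof -
  have nonpos: "profile m p s * slope m p s \<le> 0" if s: "s > max (snd p) 0" for s
  proof -
    define a where "a = - phase p s - of_int n * pi"
    have "0 \<le> a" "a \<le> pi / 2" using assms s by (auto simp: sector_def a_def)
    then have "sin (2 * a) \<ge> 0" by (intro sin_ge_zero) auto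
    moreover have "phase p s = of_int (- n) * pi + (- a)" by (simp add: a_def)
    then have "sin (2 * phase p s) = sin (2 * (- a))" by (simp only: sin_double_shift)
    then have "sin (2 * phase p s) = - sin (2 * a)" by simp
    moreover obtain r where "r > 0" "profile m p s * slope m p s = r * sin (2 * phase p s)" using phase_sgn[of s p] s by auto
    ultimately show ?thesis by (simp add: mult_nonneg_nonpos)
  qed
  have "flux p s * profile m p s < flux p (s + 1) * profile m p (s + 1)"
    using flux_profile_increasing assms by auto
  also have "\<dots> \<le> 0"
    using sgn_flux_profile(1)[of "s + 1" p] nonpos[of "s + 1"] assms by (auto simp: not_less[symmetric])
  finally show ?thesis using sgn_flux_profile(2)[of s p] assms by auto
qed

text \<open>For \<open>\<omega> \<le> 0\<close> the monotone quantity grows from its value 0 at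
  \<open>s = 0\<close>, so \<open>H H'\<close> is positive at once.\<close>

lemma sector_pos: "p \<in> sector n \<Longrightarrow> snd p > 0"
proof (rule ccontr)
  assume p: "p \<in> sector n" "\<not> snd p > 0"
  have "flux p 0 * profile m p 0 < flux p 1 * profile m p 1"
    using flux_profile_increasing[of p 0 1] p by auto
  moreover have "profile m p 1 * slope m p 1 < 0" using sector_decreasing[OF p(1), of 1] p by auto
  ultimately show False using sgn_flux_profile(2)[of 1 p] by (simp add: flux_def)
qed

text \<open>Strict negativity of \<open>sin (2 \<theta>)\<close> keeps the angle off the axes. Its
  image over a ray is connected, so the quadrant found at one point, here \<open>M + 1\<close>,
  contains it all.\<close>

lemma sectorI:
  assumes "\<And>s. s > max (snd p) 0 \<Longrightarrow> profile m p s * slope m p s < 0"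
  obtains n where "p \<in> sector n"
proof -
  define M where "M = max (snd p) 0"
  have neg: "sin (2 * phase p s) < 0" if "s > M" for s
  proof -
    obtain r where "r > 0" "profile m p s * slope m p s = r * sin (2 * phase p s)"
      using phase_sgn[of s p] \<open>s > M\<close> by (auto simp: M_def)
    then show ?thesis using assms[of s] that by (auto simp: M_def mult_less_0_iff)
  qed
  define j where "j = \<lfloor>phase p (M + 1) / pi\<rfloor>"
  define a where "a = phase p (M + 1) - of_int j * pi"
  have a: "0 \<le> a" "a < pi"
  proof -
    have "of_int j \<le> phase p (M + 1) / pi" "phase p (M + 1) / pi < of_int j + 1"
      using floor_correct[of "phase p (M + 1) / pi"] by (auto simp: j_def)
    then show "0 \<le> a" "a < pi"
      by (auto simp: a_def pos_le_divide_eq pos_divide_less_eq distrib_right)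
  qed
  have "a > pi / 2"
  proof (rule ccontr)
    assume "\<not> a > pi / 2"
    then have "sin (2 * a) \<ge> 0" using a by (intro sin_ge_zero) auto
    then show False using neg[of "M + 1"] sin_double_shift[of j a] by (simp add: a_def)
  qed
  define n where "n = - (j + 1)"
  have ph: "phase p (M + 1) > - of_int n * pi - pi / 2" "phase p (M + 1) < - of_int n * pi"
    using a \<open>a > pi / 2\<close> by (auto simp: a_def n_def algebra_simps)
  have conn: "connected (phase p ` {M<..})"
    by (intro connected_continuous_image continuous_phase_slice) (auto simp: M_def)
  have nz: "- of_int n * pi \<notin> phase p ` {M<..}" "- of_int n * pi - pi / 2 \<notin> phase p ` {M<..}"
  proof -
    have "phase p s \<noteq> - of_int n * pi" if "s > M" for s
      using neg[OF that] sin_double_shift[of "-n" 0] by auto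
    moreover have "phase p s \<noteq> - of_int n * pi - pi / 2" if "s > M" for s
      using neg[OF that] sin_double_shift[of "-n" "- pi / 2"] by auto
    ultimately show "- of_int n * pi \<notin> phase p ` {M<..}" "- of_int n * pi - pi / 2 \<notin> phase p ` {M<..}"
      by (metis greaterThan_iff imageE)+
  qed
  have in0: "phase p (M + 1) \<in> phase p ` {M<..}" by auto
  have "p \<in> sector n"
    unfolding sector_def mem_Collect_eq
  proof (intro allI impI)
    fix s assume "s > max (snd p) 0"
    then have s: "phase p s \<in> phase p ` {M<..}" by (auto simp: M_def)
    show "- of_int n * pi - pi / 2 \<le> phase p s \<and> phase p s \<le> - of_int n * pi"
    proof (intro conjI; rule ccontr)
      assume "\<not> - of_int n * pi - pi / 2 \<le> phase p s"
      then show False using subsetD[OF connected_contains_Icc[OF conn s in0], of "- of_int n * pi - pi / 2"] ph nz by auto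
    next
      assume "\<not> phase p s \<le> - of_int n * pi"
      then show False using subsetD[OF connected_contains_Icc[OF conn in0 s], of "- of_int n * pi"] ph nz by auto
    qed
  qed
  then show ?thesis by (rule that)
qed

end

subsection \<open>Decaying solutions\<close>

context positive_degree
begin

section \<open>Exponential decay beyond the turning point\<close>

definition decaying :: "(real \<times> real) set" where
  "decaying = {p. \<forall>s > max (snd p) 0. profile m p s * slope m p s < 0}"

lemma decayingD: "p \<in> decaying \<Longrightarrow> s > max (snd p) 0 \<Longrightarrow> profile m p s * slope m p s < 0"
  by (simp add: decaying_def)

lemma sector_subset_decaying: "sector n \<subseteq> decaying"
  using sector_decreasing unfolding decaying_def by blast

lemma decaying_sector: "p \<in> decaying \<Longrightarrow> \<exists>n. p \<in> sector n"
  using sectorI[of p] decayingD by metis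

lemma decaying_pos: "p \<in> decaying \<Longrightarrow> snd p > 0"
  using decaying_sector sector_pos by blast

text \<open>For \<open>y = H^2\<close> the claim is \<open>y' \<le> - y / 2\<close>, that is,
  \<open>z = y' + y / 2\<close> is nonpositive. Where \<open>s \<ge> 2 \<omega>\<close> the
  potential is at least \<open>s / 2\<close>, which gives \<open>z' \<ge> z / 2\<close>; a positive
  value of \<open>z\<close> would grow exponentially, whereas \<open>z \<le> y / 2\<close> stays
  bounded because \<open>y\<close> decreases.\<close>

lemma profile_square_decay:
  assumes p: "p \<in> decaying" and s0: "2 * snd p \<le> s0" "0 < s0" and s: "s0 \<le> s"
  shows "(profile m p s)\<^sup>2 \<le> (profile m p s0)\<^sup>2 * exp ((s0 - s) / 2)"
proof -
  define y where "y s = (profile m p s)\<^sup>2" for s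
  define z where "z s = 2 * profile m p s * slope m p s + y s / 2" for s
  define dz where "dz s = 2 * (slope m p s)\<^sup>2 + 2 * profile m p s * ((force m p s - (real m + 1) * slope m p s) / s)
      + profile m p s * slope m p s" for s
  have sp: "snd p > 0" using decaying_pos[OF p] .
  have big: "s > max (snd p) 0" if "s \<ge> s0" for s using that sp s0 by auto
  have dy: "(y has_real_derivative 2 * profile m p s * slope m p s) (at s)" if "s \<ge> s0" for s
    unfolding y_def by (rule derivative_eq_intros profile_deriv[OF m] refl | use that s0 in simp)+
  have dz: "(z has_real_derivative dz s) (at s)" if "s \<ge> s0" for s
  proof -
    have s: "s > 0" using that s0 by simp
    show ?thesis unfolding z_def dz_def
      by (rule DERIV_cong[OF DERIV_add[OF DERIV_mult[OF DERIV_cmult[OF profile_deriv(1)[OF m s]] profile_deriv(2)[OF m s]] DERIV_cdivide[OF dy[OF that]]]])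
         (simp add: power2_eq_square)
  qed
  have dz_ge: "dz s - z s / 2 \<ge> 0" if s: "s \<ge> s0" for s
  proof -
    have s': "s > 0" using s s0 by simp
    define V where "V = potential m p s (profile m p s)"
    have "V \<ge> s / 2" using potential_ge[of s p m] s s0 unfolding V_def by (smt (verit) field_sum_of_halves)
    then have "V / (2 * s) \<ge> 1 / 4" using s' by (simp add: field_simps)
    then have V: "V / (2 * s) * y s \<ge> 1 / 4 * y s" unfolding y_def by (intro mult_right_mono) auto
    have "2 * profile m p s * ((force m p s - (real m + 1) * slope m p s) / s) =
      2 * (force m p s * profile m p s) / s - 2 * (real m + 1) * (profile m p s * slope m p s) / s"
      by (simp add: diff_divide_distrib algebra_simps)
    also have "2 * (force m p s * profile m p s) / s = V / (2 * s) * y s"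
      unfolding force_times_profile V_def y_def by simp
    finally have "dz s - z s / 2 = 2 * (slope m p s)\<^sup>2 + V / (2 * s) * y s - 1 / 4 * y s
        - 2 * (real m + 1) * (profile m p s * slope m p s) / s"
      unfolding dz_def z_def by (simp add: add_divide_distrib)
    moreover have "2 * (real m + 1) * (profile m p s * slope m p s) / s \<le> 0"
    proof (rule divide_nonpos_pos[OF mult_nonneg_nonpos s'])
      show "profile m p s * slope m p s \<le> 0" using decayingD[OF p big[OF s]] by (rule less_imp_le)
    qed simp
    ultimately show ?thesis using V by (smt (verit) zero_le_power2)
  qed
  have mono: "exp (- a / 2) * z a \<le> exp (- b / 2) * z b" if "s0 \<le> a" "a \<le> b" for a b
  proof (rule DERIV_nonneg_imp_nondecreasing[OF that(2)])
    fix x assume "a \<le> x" "x \<le> b"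
    then have x: "x \<ge> s0" using that by simp
    have "((\<lambda>s. exp (- s / 2) * z s) has_real_derivative exp (- x / 2) * (dz x - z x / 2)) (at x)"
      by (auto intro!: derivative_eq_intros dz[OF x] simp: algebra_simps)
    then show "\<exists>y. ((\<lambda>s. exp (- s / 2) * z s) has_real_derivative y) (at x) \<and> 0 \<le> y"
      using dz_ge[OF x] by auto
  qed
  have y_anti: "y b \<le> y a" if "s0 \<le> a" "a \<le> b" for a b
  proof (rule DERIV_nonpos_imp_nonincreasing[OF that(2)])
    fix x assume "a \<le> x" "x \<le> b"
    then have x: "x \<ge> s0" using that by simp
    then show "\<exists>d. (y has_real_derivative d) (at x) \<and> d \<le> 0"
      using dy[OF x] decayingD[OF p big[OF x]] by (intro exI[of _ "2 * profile m p x * slope m p x"]) (simp add: mult.assoc)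
  qed
  have z_nonpos: "z a \<le> 0" if a: "s0 \<le> a" for a
  proof (rule ccontr)
    assume "\<not> z a \<le> 0"
    define k where "k = exp (- a / 2) * z a"
    have k: "k > 0" using \<open>\<not> z a \<le> 0\<close> by (simp add: k_def)
    \<comment> \<open>At this \<open>b\<close> the inequality
      \<open>k exp (b / 2) \<le> y a / 2\<close> fails already with \<open>1 + b / 2\<close> in
      place of the exponential.\<close>
    define b where "b = a + y a / k"
    have y0: "y t \<ge> 0" for t by (simp add: y_def)
    have b: "b \<ge> a" using k y0 by (simp add: b_def)
    have "k \<le> exp (- b / 2) * z b" unfolding k_def by (rule mono[OF a b])
    then have "k * exp (b / 2) \<le> z b"
      by (simp add: exp_minus field_simps)
    moreover have "z b \<le> y b / 2"
      using decayingD[OF p big[of b]] a b unfolding z_def by simp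
    moreover have "1 + b / 2 \<le> exp (b / 2)" by (rule exp_ge_add_one_self)
    then have "k * (1 + b / 2) \<le> k * exp (b / 2)" using k by simp
    moreover have "y b \<le> y a" using y_anti[OF a b] .
    ultimately have "k * (1 + b / 2) \<le> y a / 2" by linarith
    moreover have "k * b = k * a + y a" using k by (simp add: b_def distrib_left)
    moreover have "k * a > 0" using k a s0 by simp
    ultimately show False using k by (simp add: distrib_left add_divide_distrib)
  qed
  have "y s * exp (s / 2) \<le> y s0 * exp (s0 / 2)"
  proof (rule DERIV_nonpos_imp_nonincreasing[OF s])
    fix x assume x: "s0 \<le> x" "x \<le> s"
    have "((\<lambda>s. y s * exp (s / 2)) has_real_derivative exp (x / 2) * z x) (at x)"
      by (auto intro!: derivative_eq_intros dy[OF x(1)] simp: z_def algebra_simps)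
    moreover have "exp (x / 2) * z x \<le> 0" using z_nonpos[OF x(1)] by (simp add: mult_nonneg_nonpos)
    ultimately show "\<exists>d. ((\<lambda>s. y s * exp (s / 2)) has_real_derivative d) (at x) \<and> d \<le> 0" by blast
  qed
  moreover have "exp ((s0 - s) / 2) = exp (s0 / 2) / exp (s / 2)"
    by (simp add: exp_diff diff_divide_distrib)
  ultimately show ?thesis by (simp add: y_def pos_le_divide_eq)
qed

text \<open>By the mean value theorem the difference of the profile over the last unit is a slope at
  some \<open>z < s\<close>, and \<open>\<bar>flux\<bar>\<close> decreases beyond the turning point
  because \<open>H\<close> and \<open>H'\<close> have opposite signs.\<close>

lemma slope_le_profile:
  assumes p: "p \<in> decaying" and s: "max (snd p) 0 + 1 < s"
  shows "\<bar>slope m p s\<bar> \<le> \<bar>profile m p (s - 1)\<bar> + \<bar>profile m p s\<bar>"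
proof -
  have "\<exists>z>s - 1. z < s \<and> profile m p s - profile m p (s - 1) = (s - (s - 1)) * slope m p z"
    by (rule MVT2) (use s profile_deriv(1)[OF m] in auto)
  then obtain z where z: "s - 1 < z" "z < s" "slope m p z = profile m p s - profile m p (s - 1)" by auto
  have "(flux p s)\<^sup>2 \<le> (flux p z)\<^sup>2"
  proof (rule DERIV_nonpos_imp_nonincreasing[of z s])
    fix x assume "z \<le> x" "x \<le> s"
    then have x: "x > max (snd p) 0" "x > 0" using z s by auto
    have "((\<lambda>s. (flux p s)\<^sup>2) has_real_derivative 2 * flux p x * (x ^ m * force m p x)) (at x)"
      by (rule derivative_eq_intros flux_deriv[OF x(2)] refl)+ simp
    moreover have "2 * flux p x * (x ^ m * force m p x) =
        (x ^ (m + 1) * x ^ m * potential m p x (profile m p x) / 2) * (profile m p x * slope m p x)"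
      by (simp add: flux_def force_def rhs_def)
    moreover have "(x ^ (m + 1) * x ^ m * potential m p x (profile m p x) / 2) * (profile m p x * slope m p x) \<le> 0"
    proof (rule mult_nonneg_nonpos)
      have "potential m p x (profile m p x) \<ge> 0" using potential_ge[of x p m "profile m p x"] x by simp
      then show "0 \<le> x ^ (m + 1) * x ^ m * potential m p x (profile m p x) / 2" using x by simp
      show "profile m p x * slope m p x \<le> 0" using decayingD[OF p x(1)] by simp
    qed
    ultimately show "\<exists>d. ((\<lambda>s. (flux p s)\<^sup>2) has_real_derivative d) (at x) \<and> d \<le> 0" by auto
  qed (use z in auto)
  then have "\<bar>flux p s\<bar> \<le> \<bar>flux p z\<bar>" by (simp add: abs_le_square_iff)
  also have "\<bar>flux p z\<bar> \<le> s ^ (m + 1) * \<bar>slope m p z\<bar>"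
    unfolding flux_def abs_mult using z s power_mono[of z s "m + 1"] by (intro mult_right_mono) (auto simp: power_abs)
  finally have "\<bar>slope m p s\<bar> \<le> \<bar>slope m p z\<bar>" 
    using s mult_le_cancel_left_pos[of "s ^ (m + 1)" "\<bar>slope m p s\<bar>" "\<bar>slope m p z\<bar>"]
    by (simp only: flux_def abs_mult power_abs) simp
  then show ?thesis using z by simp
qed

text \<open>Uniformity over compact parameter sets provides the majorant for dominated convergence
  in \<open>branch_continuous\<close>.\<close>

lemma decaying_uniform_bound:
  assumes K: "compact K" "K \<subseteq> decaying"
  obtains C where "C > 0"
    "\<And>p s. p \<in> K \<Longrightarrow> s \<ge> 0 \<Longrightarrow> \<bar>profile m p s\<bar> \<le> C * exp (- s / 8)"
    "\<And>p s. p \<in> K \<Longrightarrow> s \<ge> 0 \<Longrightarrow> \<bar>slope m p s\<bar> \<le> C * exp (- s / 8)"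
    "\<And>p s. p \<in> K \<Longrightarrow> s \<ge> 0 \<Longrightarrow> \<bar>force m p s\<bar> \<le> C * exp (- s / 8)"
proof -
  have "bounded (snd ` K)" using K(1) by (intro compact_imp_bounded compact_continuous_image continuous_intros)
  then obtain W0 where W0: "\<And>p. p \<in> K \<Longrightarrow> \<bar>snd p\<bar> \<le> W0" unfolding bounded_iff by auto
  define W where "W = max W0 1"
  have W: "W \<ge> 1" "\<And>p. p \<in> K \<Longrightarrow> \<bar>snd p\<bar> \<le> W" using W0 by (auto simp: W_def le_max_iff_disj)
  define s0 where "s0 = 2 * W"
  have comp: "compact (K \<times> {0..s0 + 1})" using K(1) by (intro compact_Times) auto
  have "bounded ((\<lambda>x. profile m (fst x) (snd x)) ` (K \<times> {0..s0 + 1}))"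
    using comp by (intro compact_imp_bounded compact_continuous_image continuous_on_subset[OF continuous_profile[OF m]]) auto
  then obtain B1 where B1: "\<And>p s. p \<in> K \<Longrightarrow> 0 \<le> s \<Longrightarrow> s \<le> s0 + 1 \<Longrightarrow> \<bar>profile m p s\<bar> \<le> B1" unfolding bounded_iff by force
  have "bounded ((\<lambda>x. slope m (fst x) (snd x)) ` (K \<times> {0..s0 + 1}))"
    using comp by (intro compact_imp_bounded compact_continuous_image continuous_on_subset[OF continuous_slope[OF m]]) auto
  then obtain B2 where B2: "\<And>p s. p \<in> K \<Longrightarrow> 0 \<le> s \<Longrightarrow> s \<le> s0 + 1 \<Longrightarrow> \<bar>slope m p s\<bar> \<le> B2" unfolding bounded_iff by force
  define B where "B = max 1 (max B1 B2)"
  have B: "B \<ge> 1" "\<And>p s. p \<in> K \<Longrightarrow> 0 \<le> s \<Longrightarrow> s \<le> s0 + 1 \<Longrightarrow> \<bar>profile m p s\<bar> \<le> B \<and> \<bar>slope m p s\<bar> \<le> B"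
    using B1 B2 by (auto simp: B_def le_max_iff_disj)
  \<comment> \<open>The factor 2 and the shift by 1 come from \<open>slope_le_profile\<close>, which
    adds two values of the profile and looks back by one unit.\<close>
  define M where "M = 2 * B * exp ((s0 + 1) / 4)"
  have Me: "M * exp (- s / 4) = 2 * B * exp ((s0 + 1 - s) / 4)" for s
    by (simp add: M_def diff_divide_distrib flip: exp_add)
  have far: "\<bar>profile m p s\<bar> \<le> B * exp ((s0 - s) / 4)" if p: "p \<in> K" and s: "s \<ge> s0" for p s
  proof -
    have "(profile m p s)\<^sup>2 \<le> (profile m p s0)\<^sup>2 * exp ((s0 - s) / 2)"
      by (rule profile_square_decay) (use K p s W in \<open>auto simp: s0_def abs_le_iff\<close>)
    also have "\<dots> \<le> B\<^sup>2 * exp ((s0 - s) / 2)"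
      using B(2)[OF p, of s0] W B(1) by (intro mult_right_mono) (auto simp: s0_def abs_le_square_iff[symmetric])
    also have "exp ((s0 - s) / 2) = (exp ((s0 - s) / 4))\<^sup>2" by (simp flip: exp_double)
    also have "B\<^sup>2 * (exp ((s0 - s) / 4))\<^sup>2 = (B * exp ((s0 - s) / 4))\<^sup>2" by (simp add: power_mult_distrib)
    finally show ?thesis using B(1) abs_le_square_iff[of "profile m p s" "B * exp ((s0 - s) / 4)"] by simp
  qed
  have HQ: "\<bar>profile m p s\<bar> \<le> M * exp (- s / 4) \<and> \<bar>slope m p s\<bar> \<le> M * exp (- s / 4)" if p: "p \<in> K" and s: "s \<ge> 0" for p s
  proof (cases "s \<le> s0 + 1")
    case True
    have "B * 1 \<le> 2 * B * exp ((s0 + 1 - s) / 4)" using True B(1) by (intro mult_mono) auto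
    then show ?thesis using B(2)[OF p s True] unfolding Me by linarith
  next
    case False
    have "exp ((s0 - s) / 4) \<le> exp ((s0 + 1 - s) / 4)" by simp
    then have e: "B * exp ((s0 - s) / 4) \<le> B * exp ((s0 + 1 - s) / 4)" using B(1) by (intro mult_left_mono) auto
    have 1: "\<bar>profile m p s\<bar> \<le> B * exp ((s0 + 1 - s) / 4)" using far[OF p, of s] False e by simp
    have 2: "\<bar>profile m p (s - 1)\<bar> \<le> B * exp ((s0 + 1 - s) / 4)" using far[OF p, of "s - 1"] False by (simp add: algebra_simps)
    have "\<bar>slope m p s\<bar> \<le> \<bar>profile m p (s - 1)\<bar> + \<bar>profile m p s\<bar>"
      by (rule slope_le_profile) (use K p False W(1) W(2)[OF p] in \<open>auto simp: s0_def\<close>)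
    then show ?thesis using 1 2 unfolding Me by auto
  qed
  have e48: "exp (- s / 4) \<le> exp (- s / 8)" if "s \<ge> 0" for s :: real using that by simp
  have M0: "M > 0" using B(1) by (simp add: M_def)
  \<comment> \<open>The force carries a factor of at most \<open>s + W\<close>. Half of the rate
    \<open>1/4\<close> absorbs it through \<open>s exp (- s / 8) \<le> 8\<close>, which leaves the
    common rate \<open>1/8\<close>.\<close>
  define C where "C = (8 + W) * M"
  have CM: "M \<le> C" using M0 W(1) by (simp add: C_def)
  show ?thesis
  proof (rule that[of C])
    show "C > 0" using M0 W(1) by (simp add: C_def)
    fix p s assume ps: "p \<in> K" "(s::real) \<ge> 0"
    have "M * exp (- s / 4) \<le> C * exp (- s / 8)" using CM e48[OF ps(2)] M0 by (intro mult_mono) auto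
    then show "\<bar>profile m p s\<bar> \<le> C * exp (- s / 8)" "\<bar>slope m p s\<bar> \<le> C * exp (- s / 8)"
      using HQ[OF ps] by auto
    have "\<bar>force m p s\<bar> \<le> (\<bar>s\<bar> + \<bar>snd p\<bar>) * \<bar>profile m p s\<bar>" by (rule abs_force_le)
    also have "\<dots> \<le> (s + W) * (M * exp (- s / 4))"
      using W(2)[OF ps(1)] HQ[OF ps] ps by (intro mult_mono) auto
    also have "\<dots> = (s * exp (- s / 8) + W * exp (- s / 8)) * (M * exp (- s / 8))"
    proof -
      have "exp (- s / 4) = exp (- s / 8) * exp (- s / 8)" by (simp flip: exp_add)
      then show ?thesis by (simp add: algebra_simps)
    qed
    also have "\<dots> \<le> (8 + W) * (M * exp (- s / 8))"
    proof (intro mult_right_mono add_mono)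
      have "s / 8 \<le> exp (s / 8)" using exp_ge_add_one_self[of "s / 8"] by linarith
      then show "s * exp (- s / 8) \<le> 8" by (simp add: exp_minus field_simps)
      show "W * exp (- s / 8) \<le> W" using W(1) ps by (simp add: mult_left_le)
    qed (use M0 in auto)
    finally show "\<bar>force m p s\<bar> \<le> C * exp (- s / 8)" by (simp add: C_def)
  qed
qed

section \<open>A priori bounds from the maximum principle\<close>

lemma power_exp_tendsto_0: "((\<lambda>s::real. s ^ k * exp (- s / 4)) \<longlongrightarrow> 0) at_top"
proof -
  have "filterlim (\<lambda>s::real. s / 4) at_top at_top"
    by (rule filterlim_at_top_mult_tendsto_pos[of "\<lambda>_. 1 / 4" "1 / 4" at_top "\<lambda>s. s", simplified]) (auto intro: filterlim_ident)
  from filterlim_compose[OF tendsto_power_div_exp_0[of k] this]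
  have "((\<lambda>s::real. 4 ^ k * ((s / 4) ^ k / exp (s / 4))) \<longlongrightarrow> 4 ^ k * 0) at_top"
    by (intro tendsto_intros)
  then show ?thesis by (simp add: power_divide exp_minus field_simps)
qed

text \<open>\<open>y\<close> is \<open>\<bar>u\<bar>^2\<close> as a function of \<open>s\<close>. It
  vanishes at \<open>0\<close>, as \<open>m \<ge> 1\<close>, and at infinity, so exceeding
  \<open>\<omega>\<close> would produce an interior maximum; there the saturated potential is
  positive and makes the point a strict minimum on its right.\<close>

lemma decaying_maximum_principle:
  assumes p: "p \<in> decaying" and s: "s \<ge> 0"
  shows "(fst p)\<^sup>2 * s ^ m * (profile m p s)\<^sup>2 \<le> snd p"
proof (rule ccontr)
  assume gt: "\<not> ?thesis"
  have sp: "snd p > 0" using decaying_pos[OF p] .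
  define y where "y s = (fst p)\<^sup>2 * s ^ m * (profile m p s)\<^sup>2" for s
  have ys: "y s > snd p" using gt by (simp add: y_def)
  have yc: "continuous_on S y" for S
    unfolding y_def by (intro continuous_intros continuous_profile_slice)
  obtain C where C: "C > 0" "\<And>s. s \<ge> 0 \<Longrightarrow> \<bar>profile m p s\<bar> \<le> C * exp (- s / 8)"
    by (rule decaying_uniform_bound[of "{p}"]) (use p in auto)
  have lim: "((\<lambda>s. (fst p)\<^sup>2 * C\<^sup>2 * (s ^ m * exp (- s / 4))) \<longlongrightarrow> 0) at_top"
    using tendsto_mult_left[OF power_exp_tendsto_0, of "(fst p)\<^sup>2 * C\<^sup>2" m] by simp
  have "\<forall>\<^sub>F s in at_top. (fst p)\<^sup>2 * C\<^sup>2 * (s ^ m * exp (- s / 4)) < snd p"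
    using order_tendstoD(2)[OF lim sp] .
  then obtain N where N: "\<And>s. s \<ge> N \<Longrightarrow> (fst p)\<^sup>2 * C\<^sup>2 * (s ^ m * exp (- s / 4)) < snd p"
    by (auto simp: eventually_at_top_linorder)
  have small: "y t < snd p" if "t \<ge> N" "t \<ge> 0" for t
  proof -
    have "(profile m p t)\<^sup>2 = \<bar>profile m p t\<bar>\<^sup>2" by simp
    also have "\<dots> \<le> (C * exp (- t / 8))\<^sup>2" using C(2)[OF that(2)] by (intro power_mono) auto
    also have "\<dots> = C\<^sup>2 * exp (- t / 4)" by (simp add: power_mult_distrib flip: exp_double)
    finally have "(fst p)\<^sup>2 * t ^ m * (profile m p t)\<^sup>2 \<le> (fst p)\<^sup>2 * t ^ m * (C\<^sup>2 * exp (- t / 4))"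
      using that by (intro mult_left_mono) auto
    then show ?thesis using N[OF that(1)] unfolding y_def by (simp add: algebra_simps)
  qed
  define T where "T = max N s"
  have "\<exists>x\<in>{0..T}. \<forall>t\<in>{0..T}. y t \<le> y x"
    using s by (intro continuous_attains_sup yc) (auto simp: T_def)
  then obtain x where x: "x \<in> {0..T}" "\<And>t. t \<in> {0..T} \<Longrightarrow> y t \<le> y x" by blast
  have yx: "y x > snd p" using x(2)[of s] ys s by (simp add: T_def)
  have xT: "x < T"
    using small[of T] s yx x(1) by (cases "x = T") (auto simp: T_def)
  have "y 0 = 0" using m by (simp add: y_def)
  then have x0: "x > 0" using yx sp x(1) by (cases "x = 0") auto
  define H Q where "H = profile m p" and "Q = slope m p"
  have dH: "(H has_real_derivative Q x) (at x)" if "x > 0" for x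
    unfolding H_def Q_def by (rule profile_deriv(1)[OF m that])
  have dQ: "(Q has_real_derivative (force m p x - (real m + 1) * Q x) / x) (at x)" if "x > 0" for x
    unfolding H_def Q_def by (rule profile_deriv(2)[OF m that])
  \<comment> \<open>\<open>w\<close> is \<open>y'\<close> without the positive factor
    \<open>a^2 t^(m-1)\<close>, so the second derivative test needs only the sign of
    \<open>w'\<close> at the maximum.\<close>
  define w where "w t = H t * (m * H t + 2 * t * Q t)" for t
  have dy: "(y has_real_derivative (fst p)\<^sup>2 * t ^ (m - 1) * w t) (at t)" if t: "t > 0" for t
  proof -
    have "t ^ m = t ^ (m - 1) * t" using m by (metis One_nat_def Suc_diff_1 Suc_le_lessD power_Suc2)
    then show ?thesis
      unfolding y_def H_def[symmetric]
      by (auto intro!: derivative_eq_intros dH[OF t] simp: w_def algebra_simps power2_eq_square)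
  qed
  have a0: "(fst p)\<^sup>2 > 0" and Hx: "H x \<noteq> 0" using yx sp by (auto simp: y_def H_def)
  have "(fst p)\<^sup>2 * x ^ (m - 1) * w x = 0"
  proof (rule DERIV_local_max[OF dy[OF x0]])
    show "min x (T - x) > 0" using x0 xT by simp
    show "\<forall>t. \<bar>x - t\<bar> < min x (T - x) \<longrightarrow> y t \<le> y x" using x(2) by (auto simp: abs_less_iff)
  qed
  then have wx: "w x = 0" using a0 x0 by simp
  then have Qx: "2 * x * Q x = - m * H x" using Hx by (simp add: w_def)
  define V where "V = potential m p x (H x)"
  \<comment> \<open>With \<open>y x > \<omega>\<close> the cutoff is active and contributes exactly
    \<open>\<omega>\<close>, which cancels the \<open>- \<omega>\<close> of the potential.\<close>
  have Vx: "V = x"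
    using yx sp x0 by (simp add: V_def potential_def y_def H_def)
  have f: "force m p x = x * H x / 4" using Vx by (simp add: force_def rhs_def V_def H_def)
  have dw: "(w has_real_derivative Q x * (m * H x + 2 * x * Q x) + H x * (m * Q x + 2 * Q x + 2 * (force m p x - (real m + 1) * Q x))) (at x)"
    unfolding w_def using x0
    by (auto intro!: derivative_eq_intros dH[OF x0] dQ[OF x0] simp: add_divide_distrib diff_divide_distrib algebra_simps)
  have "Q x * (m * H x + 2 * x * Q x) + H x * (m * Q x + 2 * Q x + 2 * (force m p x - (real m + 1) * Q x))
     = H x * (x * H x / 2 - m * Q x)"
    using Qx by (simp add: f algebra_simps)
  also have "\<dots> = (H x)\<^sup>2 * (x / 2 + (real m)\<^sup>2 / (2 * x))"
  proof -
    have "Q x = - m * H x / (2 * x)" using Qx x0 by (simp add: field_simps)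
    then show ?thesis by (simp add: power2_eq_square algebra_simps)
  qed
  also have "\<dots> > 0" using Hx x0 by (intro mult_pos_pos add_pos_nonneg) auto
  finally obtain d where d: "d > 0" "\<And>h. 0 < h \<Longrightarrow> h < d \<Longrightarrow> w x < w (x + h)"
    using DERIV_pos_inc_right[OF dw] by blast
  define t where "t = x + min (d / 2) (T - x)"
  have t: "x < t" "t \<le> T" "t < x + d" using d xT by (auto simp: t_def min_def)
  have "y x < y t"
  proof (rule DERIV_pos_imp_increasing_open[OF t(1) _ yc])
    fix u assume u: "x < u" "u < t"
    have "w u > 0" using d(2)[of "u - x"] u t wx by auto
    then have "(fst p)\<^sup>2 * u ^ (m - 1) * w u > 0" using a0 x0 u by simp
    then show "\<exists>d. (y has_real_derivative d) (at u) \<and> 0 < d" using dy[of u] u x0 by auto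
  qed
  then show False using x(2)[of t] t x0 by auto
qed

text \<open>The cutoff bounds the potential independently of \<open>a\<close>, so near
  \<open>0\<close> the profile stays close to 1 however large \<open>a\<close> is. The maximum
  principle at a fixed point \<open>s1\<close> then bounds \<open>a^2 s1^m\<close>.\<close>

lemma decaying_amplitude_bound:
  assumes p: "p \<in> decaying" and W: "snd p \<le> W" "W \<ge> 1"
  shows "(fst p)\<^sup>2 \<le> 4 * W * (2 * W) ^ m"
proof -
  have sp: "snd p > 0" using decaying_pos[OF p] .
  \<comment> \<open>On \<open>[0, s1]\<close> the integral term is at most
    \<open>s1 W M / 2 = M / 4\<close>, where \<open>M\<close> is the maximum of
    \<open>\<bar>H\<bar>\<close>. Then \<open>M \<le> 4/3\<close>, and \<open>H \<ge> 1/2\<close> at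
    \<open>s1\<close>.\<close>
  define s1 where "s1 = 1 / (2 * W)"
  have s1: "s1 > 0" "s1 \<le> 1" using W by (auto simp: s1_def field_simps)
  have "\<exists>x\<in>{0..s1}. \<forall>t\<in>{0..s1}. \<bar>profile m p t\<bar> \<le> \<bar>profile m p x\<bar>"
    using s1 by (intro continuous_attains_sup continuous_intros continuous_profile_slice) auto
  then obtain x where x: "x \<in> {0..s1}" "\<And>t. t \<in> {0..s1} \<Longrightarrow> \<bar>profile m p t\<bar> \<le> \<bar>profile m p x\<bar>" by blast
  define M where "M = \<bar>profile m p x\<bar>"
  have near1: "\<bar>profile m p s - 1\<bar> \<le> M / 4" if s: "s \<in> {0..s1}" for s
  proof -
    have "norm (integral {0..1} (\<lambda>t. kern m t * rhs m p (s * t) (profile m p (s * t)))) \<le> (W * M / 2) * (1 - 0)"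
    proof (rule integral_bound)
      show "continuous_on {0..1} (\<lambda>t. kern m t * rhs m p (s * t) (profile m p (s * t)))"
        by (rule continuous_on_kern_rhs[OF continuous_profile_slice])
      fix t :: real assume t: "t \<in> {0..1}"
      have st: "s * t \<in> {0..s1}" using s t by (auto intro: order_trans[OF mult_left_le])
      have "\<bar>kern m t\<bar> \<le> 1" using kern_bounds(1)[of t m] kern_bounds(2)[OF m, of t] t by auto
      moreover have "\<bar>rhs m p (s * t) (profile m p (s * t))\<bar> \<le> (\<bar>s * t\<bar> + \<bar>snd p\<bar>) * \<bar>profile m p (s * t)\<bar> / 4"
        by (rule abs_rhs_le)
      moreover have "(\<bar>s * t\<bar> + \<bar>snd p\<bar>) * \<bar>profile m p (s * t)\<bar> \<le> (2 * W) * M"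
        using st x(2)[OF st] s1 W sp unfolding M_def by (intro mult_mono) auto
      ultimately have "\<bar>kern m t\<bar> * \<bar>rhs m p (s * t) (profile m p (s * t))\<bar> \<le> 1 * (W * M / 2)"
        by (intro mult_mono) auto
      then show "norm (kern m t * rhs m p (s * t) (profile m p (s * t))) \<le> W * M / 2" by (simp add: abs_mult)
    qed simp
    then have "\<bar>s\<bar> * \<bar>integral {0..1} (\<lambda>t. kern m t * rhs m p (s * t) (profile m p (s * t)))\<bar> \<le> s1 * (W * M / 2)"
      using s s1 by (intro mult_mono) auto
    also have "s1 * (W * M / 2) = M / 4" using W by (simp add: s1_def)
    finally have "\<bar>s\<bar> * \<bar>integral {0..1} (\<lambda>t. kern m t * rhs m p (s * t) (profile m p (s * t)))\<bar> \<le> M / 4" .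
    moreover have "profile m p s - 1 = s * integral {0..1} (\<lambda>t. kern m t * rhs m p (s * t) (profile m p (s * t)))"
      by (subst profile_fixed_point[OF m]) (simp add: picard_def)
    ultimately show ?thesis by (simp only: abs_mult)
  qed
  have "M \<le> 1 + M / 4" using near1[OF x(1)] unfolding M_def by linarith
  moreover have "\<bar>profile m p s1 - 1\<bar> \<le> M / 4" using near1[of s1] s1 by simp
  ultimately have "profile m p s1 \<ge> 1 / 2" by linarith
  then have "(1/2)\<^sup>2 \<le> (profile m p s1)\<^sup>2" by (intro power_mono) auto
  then have "(fst p)\<^sup>2 * s1 ^ m * (1 / 4) \<le> (fst p)\<^sup>2 * s1 ^ m * (profile m p s1)\<^sup>2"
    using s1 by (intro mult_left_mono) (auto simp: power2_eq_square)
  also have "\<dots> \<le> W" using decaying_maximum_principle[OF p, of s1] s1 W by simp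
  finally have "(fst p)\<^sup>2 * s1 ^ m \<le> 4 * W" by simp
  then show ?thesis using W by (simp add: s1_def power_divide field_simps)
qed

end

subsection \<open>The linear equation and the bifurcating continuum\<close>

context positive_degree
begin

section \<open>Sturm comparison on the line \<open>a = 0\<close>\<close>

definition wronskian :: "real \<times> real \<Rightarrow> real \<times> real \<Rightarrow> real \<Rightarrow> real" where
  "wronskian p q s = flux p s * profile m q s - profile m p s * flux q s"

lemma continuous_wronskian: "continuous_on S (wronskian p q)"
  unfolding wronskian_def flux_def
  by (intro continuous_intros continuous_profile_slice continuous_slope_slice)

lemma wronskian_deriv:
  assumes s: "s > 0"
  shows "(wronskian (0, v) (0, w) has_real_derivative
    s ^ m * ((w - v) / 4) * (profile m (0, v) s * profile m (0, w) s)) (at s)"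
proof -
  have f: "force m (0, u) s = (s - u) * profile m (0, u) s / 4" for u
    by (simp add: force_def rhs_def potential_def)
  from DERIV_diff[OF DERIV_mult[OF flux_deriv[OF s, of "(0, v)"] profile_deriv(1)[OF m s, of "(0, w)"]]
    DERIV_mult[OF profile_deriv(1)[OF m s, of "(0, v)"] flux_deriv[OF s, of "(0, w)"]]]
  show ?thesis unfolding wronskian_def
    by (rule DERIV_cong) (simp add: f flux_def algebra_simps diff_divide_distrib add_divide_distrib)
qed

lemma wronskian_polar:
  assumes "s \<ge> 0"
  obtains r where "r > 0" "wronskian p q s = s ^ (m + 1) * (r * sin (phase p s - phase q s))"
    "profile m p s * profile m q s = r * (cos (phase p s) * cos (phase q s))"
    "slope m p s * slope m q s = r * (sin (phase p s) * sin (phase q s))"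
proof -
  obtain a where a: "a > 0" "profile m p s = a * cos (phase p s)" "slope m p s = a * sin (phase p s)"
    using phase_polar[OF assms] by blast
  obtain b where b: "b > 0" "profile m q s = b * cos (phase q s)" "slope m q s = b * sin (phase q s)"
    using phase_polar[OF assms] by blast
  show ?thesis
  proof (rule that[of "a * b"])
    show "wronskian p q s = s ^ (m + 1) * (a * b * sin (phase p s - phase q s))"
      unfolding wronskian_def flux_def a(2,3) b(2,3) by (simp add: sin_diff algebra_simps)
  qed (use a b in simp_all)
qed

lemma slope_0: "slope m p 0 = - snd p / (4 * (real m + 1))"
proof -
  have "((\<lambda>t. t ^ Suc m / (real m + 1)) has_real_derivative t ^ m) (at t within {0..1})" for t :: real
    using DERIV_cdivide[OF DERIV_pow[of "Suc m" t "{0..1}"], of "real m + 1"] by (simp add: add.commute)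
  then have "((\<lambda>t::real. t ^ m) has_integral (1 ^ Suc m / (real m + 1) - 0 ^ Suc m / (real m + 1))) {0..1}"
    by (intro fundamental_theorem_of_calculus) (auto simp: has_real_derivative_iff_has_vector_derivative[symmetric])
  then have "integral {0..1} (\<lambda>t::real. t ^ m) = 1 / (real m + 1)" by (simp add: integral_unique)
  moreover have "slope m p 0 = integral {0..1} (\<lambda>t. (- snd p / 4) * t ^ m)"
  proof -
    have "rhs m p 0 1 = - snd p / 4" using m by (simp add: rhs_def potential_def power_0_left)
    then show ?thesis by (simp add: slope_def profile_0[OF m] mult.commute)
  qed
  ultimately show ?thesis by simp
qed

text \<open>At \<open>s = 0\<close> the profile is 1 and the slope is a negative multiple of
  \<open>\<omega>\<close>. Both angles lie in \<open>(- pi/2, pi/2)\<close>, so the sine of their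
  difference decides their order.\<close>

lemma phase_strict_antimono_initial:
  assumes "v < w"
  shows "phase (0, w) 0 < phase (0, v) 0"
proof (rule ccontr)
  assume "\<not> ?thesis"
  then have le: "phase (0, v) 0 - phase (0, w) 0 \<le> 0" by simp
  have gt: "phase (0, v) 0 - phase (0, w) 0 > - pi"
    using phase_initial[of "(0, v)"] phase_initial[of "(0, w)"] by (auto simp: abs_less_iff)
  have "sin (phase (0, w) 0 - phase (0, v) 0) \<ge> 0" using le gt by (intro sin_ge_zero) auto
  moreover obtain a where a: "a > 0" "profile m (0, v) 0 = a * cos (phase (0, v) 0)" "slope m (0, v) 0 = a * sin (phase (0, v) 0)"
    using phase_polar[of 0] by blast
  moreover obtain b where b: "b > 0" "profile m (0, w) 0 = b * cos (phase (0, w) 0)" "slope m (0, w) 0 = b * sin (phase (0, w) 0)"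
    using phase_polar[of 0] by blast
  have "slope m (0, w) 0 * profile m (0, v) 0 - profile m (0, w) 0 * slope m (0, v) 0 = a * b * sin (phase (0, w) 0 - phase (0, v) 0)"
    unfolding a(2,3) b(2,3) by (simp add: sin_diff algebra_simps)
  ultimately have "slope m (0, w) 0 * profile m (0, v) 0 - profile m (0, w) 0 * slope m (0, v) 0 \<ge> 0" using a b by simp
  then have "- w / (4 * (real m + 1)) \<ge> - v / (4 * (real m + 1))" by (simp add: slope_0 profile_0[OF m])
  then have "w \<le> v" by (simp add: divide_le_cancel)
  then show False using assms by simp
qed

text \<open>Supplies the strict growth of the Wronskian just before a meeting point of two angles.
  If both profiles vanish there, the equal signs are read off the difference quotients.\<close>

lemma profile_product_pos_left:
  assumes s: "s > 0" and eq: "phase p s = phase q s"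
  shows "\<forall>\<^sub>F t in at_left s. profile m p t * profile m q t > 0"
proof -
  obtain r where r: "r > 0" "profile m p s * profile m q s = r * (cos (phase p s) * cos (phase q s))"
    "slope m p s * slope m q s = r * (sin (phase p s) * sin (phase q s))"
    using wronskian_polar[of s p q] s by auto
  show ?thesis
  proof (cases "cos (phase p s) = 0")
    case False
    then have "profile m p s * profile m q s > 0" using r(1) eq False unfolding r(2) by (auto simp: zero_less_mult_iff neq_iff)
    moreover have "(profile m p \<longlongrightarrow> profile m p s) (at_left s)" for p
      using DERIV_isCont[OF profile_deriv(1)[OF m s, of p]] unfolding isCont_def
      by (rule tendsto_within_subset) simp
    then have "((\<lambda>t. profile m p t * profile m q t) \<longlongrightarrow> profile m p s * profile m q s) (at_left s)"
      by (intro tendsto_mult)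
    ultimately show ?thesis by (intro order_tendstoD(1))
  next
    case True
    obtain a where a: "a > 0" "profile m p s = a * cos (phase p s)" using phase_polar[of s p] s by auto
    obtain b where b: "b > 0" "profile m q s = b * cos (phase q s)" using phase_polar[of s q] s by auto
    have z: "profile m p s = 0" "profile m q s = 0" using a b True eq by auto
    have "sin (phase p s) \<noteq> 0" using True sin_cos_squared_add[of "phase p s"] by auto
    then have pos: "slope m p s * slope m q s > 0" using r(1) eq unfolding r(3) by (auto simp: zero_less_mult_iff neq_iff)
    have "((\<lambda>t. (profile m p t / (t - s)) * (profile m q t / (t - s))) \<longlongrightarrow> slope m p s * slope m q s) (at_left s)"
      using has_field_derivative_at_within[OF profile_deriv(1)[OF m s, of p], of "{..<s}"] has_field_derivative_at_within[OF profile_deriv(1)[OF m s, of q], of "{..<s}"]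
      unfolding has_field_derivative_iff z by (intro tendsto_mult) simp_all
    from order_tendstoD(1)[OF this pos]
    have "\<forall>\<^sub>F t in at_left s. 0 < (profile m p t / (t - s)) * (profile m q t / (t - s))" .
    moreover have "\<forall>\<^sub>F t in at_left s. t < s" by (auto simp: eventually_at_filter)
    ultimately show ?thesis
      by eventually_elim (auto simp: zero_less_mult_iff zero_less_divide_iff divide_less_0_iff)
  qed
qed

text \<open>At a first meeting point of the two angles the Wronskian is 0. Shortly before, the
  difference of the angles lies in \<open>(0, pi)\<close>, so the Wronskian is positive; yet it
  increases there because the profiles have equal signs.\<close>

lemma phase_strict_antimono:
  assumes vw: "v < w" and s: "s \<ge> 0"
  shows "phase (0, w) s < phase (0, v) s"
proof (rule ccontr)
  assume contra: "\<not> ?thesis"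
  define d where "d s = phase (0, v) s - phase (0, w) s" for s
  have dc: "continuous_on S d" if "S \<subseteq> {0..}" for S
    unfolding d_def by (intro continuous_intros continuous_phase_slice that)
  have d0: "d 0 > 0" using phase_strict_antimono_initial[OF vw] by (simp add: d_def)
  define Z where "Z = {t\<in>{0..s}. d t = 0}"
  have Zeq: "Z = {0..s} \<inter> d -` {0}" by (auto simp: Z_def)
  have "closed Z" unfolding Zeq by (rule continuous_closed_preimage) (auto intro: dc)
  moreover have "bounded Z" by (rule bounded_subset[of "{0..s}"]) (auto simp: Z_def)
  ultimately have "compact Z" by (simp add: compact_eq_bounded_closed)
  have "\<exists>t\<ge>0. t \<le> s \<and> d t = 0"
    using contra s d0 by (intro IVT2' dc) (auto simp: d_def)
  then have "Z \<noteq> {}" by (auto simp: Z_def)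
  from compact_attains_inf[OF \<open>compact Z\<close> this]
  obtain t where t: "t \<in> Z" "\<And>u. u \<in> Z \<Longrightarrow> t \<le> u" by auto
  have t0: "t > 0" and dt: "d t = 0" using t(1) d0 by (auto simp: Z_def order_le_less)
  have dpos: "d u > 0" if u: "0 \<le> u" "u < t" for u
  proof (rule ccontr)
    assume "\<not> d u > 0"
    then have "\<exists>x\<ge>0. x \<le> u \<and> d x = 0"
      using d0 u by (intro IVT2' dc) auto
    then obtain x where "0 \<le> x" "x \<le> u" "d x = 0" by blast
    then have "x \<in> Z" using t(1) u by (simp add: Z_def)
    from t(2)[OF this] show False using \<open>x \<le> u\<close> u by simp
  qed
  have e1: "\<forall>\<^sub>F u in at_left t. profile m (0, v) u * profile m (0, w) u > 0"
    using dt by (intro profile_product_pos_left t0) (simp add: d_def)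
  have "(d \<longlongrightarrow> d t) (at t within {0..})" using dc[of "{0..}"] t0 by (auto simp: continuous_on_def)
  then have "(d \<longlongrightarrow> d t) (at t)" using t0 by (simp add: at_within_interior[of t "{0..}"])
  then have "(d \<longlongrightarrow> d t) (at_left t)" by (rule tendsto_within_subset) simp
  then have e2: "\<forall>\<^sub>F u in at_left t. d u < pi" using dt by (intro order_tendstoD(2)) auto
  have e3: "\<forall>\<^sub>F u in at_left t. u > 0" using t0 by (simp add: eventually_at_left_field) blast
  have "\<forall>\<^sub>F u in at_left t. profile m (0, v) u * profile m (0, w) u > 0 \<and> d u < pi \<and> u > 0"
    using e1 e2 e3 by eventually_elim simp
  then obtain b where b: "b < t" "\<And>u. b < u \<Longrightarrow> u < t \<Longrightarrow> profile m (0, v) u * profile m (0, w) u > 0 \<and> d u < pi \<and> u > 0"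
    unfolding eventually_at_left_field by blast
  define u where "u = (b + t) / 2"
  have u: "b < u" "u < t" using b(1) by (auto simp: u_def)
  have "wronskian (0, v) (0, w) u < wronskian (0, v) (0, w) t"
  proof (rule DERIV_pos_imp_increasing_open[OF u(2) _ continuous_wronskian])
    fix x assume x: "u < x" "x < t"
    then have x': "x > 0" "profile m (0, v) x * profile m (0, w) x > 0" using b(2)[of x] u by auto
    show "\<exists>y. (wronskian (0, v) (0, w) has_real_derivative y) (at x) \<and> 0 < y"
      by (rule exI conjI wronskian_deriv x' mult_pos_pos)+ (use x' vw in auto)
  qed
  moreover have "wronskian (0, v) (0, w) t = 0"
    using wronskian_polar[of t "(0, v)" "(0, w)"] t0 dt by (auto simp: d_def)
  moreover have "wronskian (0, v) (0, w) u > 0"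
  proof -
    have "sin (d u) > 0" using dpos[of u] b(2)[OF u] u by (intro sin_gt_zero) auto
    moreover obtain r where "r > 0" "wronskian (0, v) (0, w) u = u ^ (m + 1) * (r * sin (phase (0, v) u - phase (0, w) u))"
      using wronskian_polar[of u "(0, v)" "(0, w)"] b(2)[OF u] by auto
    ultimately show ?thesis using b(2)[OF u] by (simp add: d_def)
  qed
  ultimately show False by simp
qed

text \<open>Angles in the same closed quadrant give profiles with nonnegative product, so beyond
  \<open>w\<close> the Wronskian is positive and nondecreasing. Both solutions decay exponentially,
  which forces it to 0.\<close>

lemma sector_linear_unique_aux:
  assumes v: "(0, v) \<in> sector n" and w: "(0, w) \<in> sector n" and vw: "v < w"
  shows False
proof -
  have pos: "v > 0" "w > 0" using sector_pos v w by force+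
  have quad: "wronskian (0, v) (0, w) s > 0 \<and> profile m (0, v) s * profile m (0, w) s \<ge> 0" if s: "s > w" for s
  proof -
    define a b where "a = - of_int n * pi - phase (0, v) s" and "b = - of_int n * pi - phase (0, w) s"
    have "- of_int n * pi - pi / 2 \<le> phase (0, v) s \<and> phase (0, v) s \<le> - of_int n * pi"
      "- of_int n * pi - pi / 2 \<le> phase (0, w) s \<and> phase (0, w) s \<le> - of_int n * pi"
      using v w s pos vw unfolding sector_def mem_Collect_eq by simp_all
    then have ab: "0 \<le> a" "a \<le> pi / 2" "0 \<le> b" "b \<le> pi / 2" by (auto simp: a_def b_def)
    have lt: "a < b" using phase_strict_antimono[OF vw, of s] s pos by (simp add: a_def b_def)
    have "sin (phase (0, v) s - phase (0, w) s) > 0"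
      using lt ab pi_gt_zero by (intro sin_gt_zero) (auto simp: a_def b_def)
    moreover have "cos (phase (0, v) s) * cos (phase (0, w) s) = cos a * cos b"
    proof -
      have "phase (0, v) s = - (pi * of_int n + a)" "phase (0, w) s = - (pi * of_int n + b)" by (auto simp: a_def b_def)
      then have "cos (phase (0, v) s) = cos (pi * of_int n) * cos a" "cos (phase (0, w) s) = cos (pi * of_int n) * cos b"
        by (simp_all only: cos_minus cos_add sin_npi_int mult_zero_left diff_0_right)
      then show ?thesis by (auto split: if_splits)
    qed
    moreover have "cos a \<ge> 0" "cos b \<ge> 0" using ab by (auto intro!: cos_ge_zero)
    moreover obtain r where "r > 0" "wronskian (0, v) (0, w) s = s ^ (m + 1) * (r * sin (phase (0, v) s - phase (0, w) s))"
       "profile m (0, v) s * profile m (0, w) s = r * (cos (phase (0, v) s) * cos (phase (0, w) s))"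
      using wronskian_polar[of s "(0, v)" "(0, w)"] s pos by auto
    ultimately show ?thesis using s pos by simp
  qed
  have mono: "wronskian (0, v) (0, w) (w + 1) \<le> wronskian (0, v) (0, w) s" if "s \<ge> w + 1" for s
  proof (rule DERIV_nonneg_imp_nondecreasing[OF that])
    fix x assume "w + 1 \<le> x" "x \<le> s"
    then have x: "x > 0" "profile m (0, v) x * profile m (0, w) x \<ge> 0" using quad[of x] pos by auto
    show "\<exists>y. (wronskian (0, v) (0, w) has_real_derivative y) (at x) \<and> 0 \<le> y"
      by (rule exI conjI wronskian_deriv x mult_nonneg_nonneg)+ (use x vw in auto)
  qed
  obtain C where C: "C > 0"
    "\<And>p s. p \<in> {(0, v), (0, w)} \<Longrightarrow> s \<ge> 0 \<Longrightarrow> \<bar>profile m p s\<bar> \<le> C * exp (- s / 8)"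
    "\<And>p s. p \<in> {(0, v), (0, w)} \<Longrightarrow> s \<ge> 0 \<Longrightarrow> \<bar>slope m p s\<bar> \<le> C * exp (- s / 8)"
    by (rule decaying_uniform_bound[of "{(0, v), (0, w)}"]) (use sector_subset_decaying[of n] v w in auto)
  have W: "wronskian (0, v) (0, w) s \<le> 2 * C\<^sup>2 * (s ^ (m + 1) * exp (- s / 4))" if s: "s \<ge> 0" for s
  proof -
    have ee: "C * exp (- s / 8) * (C * exp (- s / 8)) = C\<^sup>2 * exp (- s / 4)"
    proof -
      have "exp (- s / 4) = exp (- s / 8) * exp (- s / 8)" by (simp flip: exp_add)
      then show ?thesis by (simp add: power2_eq_square)
    qed
    have "\<bar>slope m (0, v) s\<bar> * \<bar>profile m (0, w) s\<bar> \<le> C\<^sup>2 * exp (- s / 4)" "\<bar>profile m (0, v) s\<bar> * \<bar>slope m (0, w) s\<bar> \<le> C\<^sup>2 * exp (- s / 4)"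
      unfolding ee[symmetric] by (rule mult_mono; use C s in simp)+
    then have "slope m (0, v) s * profile m (0, w) s - profile m (0, v) s * slope m (0, w) s \<le> 2 * C\<^sup>2 * exp (- s / 4)"
      unfolding abs_mult[symmetric] by linarith
    from mult_left_mono[OF this, of "s ^ (m + 1)"] s show ?thesis
      unfolding wronskian_def flux_def by (simp add: algebra_simps)
  qed
  have "((\<lambda>s. 2 * C\<^sup>2 * (s ^ (m + 1) * exp (- s / 4))) \<longlongrightarrow> 2 * C\<^sup>2 * 0) at_top"
    by (intro tendsto_intros power_exp_tendsto_0)
  moreover have "\<forall>\<^sub>F s in at_top. wronskian (0, v) (0, w) (w + 1) \<le> 2 * C\<^sup>2 * (s ^ (m + 1) * exp (- s / 4))"
    using eventually_ge_at_top[of "w + 1"]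
  proof eventually_elim
    case (elim s)
    then show ?case using mono[OF elim] W[of s] pos by simp
  qed
  ultimately have "wronskian (0, v) (0, w) (w + 1) \<le> 2 * C\<^sup>2 * 0"
    by (rule tendsto_lowerbound) simp
  then show False using quad[of "w + 1"] by simp
qed

lemma sector_linear_unique: "(0, v) \<in> sector n \<Longrightarrow> (0, w) \<in> sector n \<Longrightarrow> v = w"
  using sector_linear_unique_aux by (metis linorder_neqE_linordered_idom)

lemma sector_linear_sides:
  assumes v: "(0, v) \<in> sector n"
  shows "v < w \<Longrightarrow> (0, w) \<in> below n" "w < v \<Longrightarrow> (0, w) \<in> above n"
proof -
  have pos: "v > 0" using sector_pos[OF v] by simp
  have notin: "(0, w) \<in> above n \<union> below n" if "w \<noteq> v"
    using sector_linear_unique[OF v, of w] that Compl_sector[of n] by auto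
  show "(0, w) \<in> below n" if vw: "v < w"
  proof -
    have "(0, w) \<notin> above n"
    proof
      assume "(0, w) \<in> above n"
      then obtain s where s: "s > max (snd (0::real, w)) 0" "phase (0, w) s > - of_int n * pi"
        unfolding above_def by blast
      moreover have "phase (0, w) s < phase (0, v) s" using phase_strict_antimono[OF vw, of s] s by simp
      moreover have "phase (0, v) s \<le> - of_int n * pi"
        using v s vw pos unfolding sector_def by auto
      ultimately show False by simp
    qed
    then show ?thesis using notin vw by auto
  qed
  show "(0, w) \<in> above n" if vw: "w < v"
  proof -
    have "(0, w) \<notin> below n"
    proof
      assume "(0, w) \<in> below n"
      then obtain s where s: "s > max (snd (0::real, w)) 0" "phase (0, w) s < - of_int n * pi - pi / 2"
        unfolding below_def by blast
      \<comment> \<open>The sector of \<open>v\<close> controls the angle only beyond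
        \<open>v\<close>, while the witness \<open>s\<close> may lie before \<open>v\<close>;
        \<open>phase_stays_below\<close> carries it over.\<close>
      define t where "t = max s (v + 1)"
      have "phase (0, w) t < - of_int n * pi - pi / 2"
        using phase_stays_below[OF s(1) _ s(2), of t] by (simp add: t_def)
      moreover have "phase (0, w) t > phase (0, v) t"
        using phase_strict_antimono[OF vw, of t] pos by (simp add: t_def)
      moreover have "phase (0, v) t \<ge> - of_int n * pi - pi / 2"
      proof -
        have "t > max (snd (0::real, v)) 0" using pos by (simp add: t_def less_max_iff_disj)
        then show ?thesis using v unfolding sector_def by blast
      qed
      ultimately show False by simp
    qed
    then show ?thesis using notin vw by auto
  qed
qed

section \<open>Laguerre functions as explicit decaying solutions\<close>

lemma ode_imp_profile:
  assumes h0: "h 0 = 1"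
    and dh: "\<And>s. (h has_real_derivative h' s) (at s)" "\<And>s. (h' has_real_derivative h'' s) (at s)"
    and eq: "\<And>s. s * h'' s + (real m + 1) * h' s = rhs m p s (h s)"
  shows "h s = profile m p s"
proof (rule profile_unique[OF m])
  show "continuous_on UNIV h" using dh(1) DERIV_isCont by (auto simp: continuous_on_eq_continuous_at)
  fix s
  \<comment> \<open>Antiderivative, found by parts, of the integrand of \<open>picard\<close> times
    \<open>s\<close>: the factor \<open>1 - t^m\<close> kills the derivative term at
    \<open>t = 1\<close> and the factor \<open>t\<close> kills it at \<open>t = 0\<close>, which
    leaves \<open>h s - h 0\<close>.\<close>
  define A where "A t = ((1 - t ^ m) * (t * s * h' (s * t)) + m * h (s * t)) / m" for t
  have "((\<lambda>t. s * (kern m t * rhs m p (s * t) (h (s * t)))) has_integral A 1 - A 0) {0..1}"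
  proof (rule fundamental_theorem_of_calculus)
    fix t :: real
    have e: "t ^ (m - 1) * t = t ^ m" using m by (cases m) auto
    have st: "((\<lambda>t. s * t) has_real_derivative s) (at t within {0..1})"
      by (auto intro!: derivative_eq_intros)
    note ch = DERIV_chain2[OF dh(1) st] DERIV_chain2[OF dh(2) st]
    have "(A has_real_derivative ((0 - m * t ^ (m - 1)) * (t * s * h' (s * t)) + (1 - t ^ m) * (s * h' (s * t) + t * s * (h'' (s * t) * s)) + m * (h' (s * t) * s)) / m) (at t within {0..1})"
      unfolding A_def
    proof (rule DERIV_cdivide)
      have pw: "((\<lambda>t. t ^ m) has_real_derivative m * t ^ (m - 1)) (at t within {0..1})"
        using DERIV_pow[of m t "{0..1}"] by simp
      have ts: "((\<lambda>t. t * s) has_real_derivative s) (at t within {0..1})"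
        by (auto intro!: derivative_eq_intros)
      show "((\<lambda>t. (1 - t ^ m) * (t * s * h' (s * t)) + m * h (s * t)) has_real_derivative
         (0 - m * t ^ (m - 1)) * (t * s * h' (s * t)) + (1 - t ^ m) * (s * h' (s * t) + t * s * (h'' (s * t) * s)) + m * (h' (s * t) * s)) (at t within {0..1})"
        by (rule DERIV_cong[OF DERIV_add[OF DERIV_mult[OF DERIV_diff[OF DERIV_const pw] DERIV_mult[OF ts ch(2)]] DERIV_cmult[OF ch(1)]]])
           (simp add: algebra_simps)
    qed
    moreover have "((0 - m * t ^ (m - 1)) * (t * s * h' (s * t)) + (1 - t ^ m) * (s * h' (s * t) + t * s * (h'' (s * t) * s)) + m * (h' (s * t) * s)) / m
        = s * (kern m t * (s * t * h'' (s * t) + (real m + 1) * h' (s * t)))"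
    proof -
      have "m * t ^ (m - 1) * (t * s * h' (s * t)) = m * t ^ m * s * h' (s * t)"
        unfolding e[symmetric] by (simp only: mult_ac)
      then show ?thesis using m by (simp add: kern_def field_simps) metis
    qed
    ultimately show "(A has_vector_derivative s * (kern m t * rhs m p (s * t) (h (s * t)))) (at t within {0..1})"
      by (simp add: eq has_real_derivative_iff_has_vector_derivative[symmetric])
  qed simp
  moreover have "A 1 - A 0 = h s - 1" using m h0 by (simp add: A_def zero_power)
  ultimately show "h s = picard m p h s" by (simp add: picard_def integral_unique flip: integral_mult_right)
qed

text \<open>Coefficients of the hypergeometric series \<open>1F1(- n; m + 1; s)\<close>, a multiple
  of the associated Laguerre polynomial of degree \<open>n\<close> and order \<open>m\<close>,
  normalised to 1 at 0. The factor \<open>k - n\<close> ends the series.\<close>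

primrec laguerre_coeff :: "nat \<Rightarrow> nat \<Rightarrow> real" where
  "laguerre_coeff n 0 = 1"
| "laguerre_coeff n (Suc k) = laguerre_coeff n k * (real k - real n) / ((real k + 1) * (real k + real m + 1))"

definition laguerre :: "nat \<Rightarrow> real poly" where
  "laguerre n = Poly (map (laguerre_coeff n) [0..<Suc n])"

lemma coeff_laguerre: "coeff (laguerre n) k = laguerre_coeff n k"
proof -
  have "laguerre_coeff n (Suc n + j) = 0" for j by (induction j) auto
  then have "laguerre_coeff n k = 0" if "k \<ge> Suc n" using that by (metis le_add_diff_inverse)
  then show ?thesis by (auto simp: laguerre_def nth_default_def simp del: upt_Suc)
qed

lemma laguerre_ode:
  "s * poly (pderiv (pderiv (laguerre n))) s + (real m + 1 - s) * poly (pderiv (laguerre n)) s + real n * poly (laguerre n) s = 0"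
proof -
  have "pCons 0 (pderiv (pderiv (laguerre n))) + smult (real m + 1) (pderiv (laguerre n)) - pCons 0 (pderiv (laguerre n)) + smult (real n) (laguerre n) = 0"
  proof (rule poly_eqI)
    fix i
    have step: "(real i + 1) * (real i + real m + 1) * laguerre_coeff n (Suc i) = laguerre_coeff n i * (real i - real n)" for i
    proof -
      have "(real i + 1) * (real i + real m + 1) \<noteq> 0" by (simp add: add_nonneg_eq_0_iff)
      then show ?thesis by simp
    qed
    show "coeff (pCons 0 (pderiv (pderiv (laguerre n))) + smult (real m + 1) (pderiv (laguerre n)) - pCons 0 (pderiv (laguerre n)) + smult (real n) (laguerre n)) i = coeff 0 i"
      using step[of i]
      by (cases i) (simp_all add: coeff_pderiv coeff_laguerre algebra_simps del: laguerre_coeff.simps(2))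
  qed
  then have "poly (pCons 0 (pderiv (pderiv (laguerre n))) + smult (real m + 1) (pderiv (laguerre n)) - pCons 0 (pderiv (laguerre n)) + smult (real n) (laguerre n)) s = 0"
    by simp
  then show ?thesis by (simp add: algebra_simps)
qed

text \<open>Substituting \<open>H = P exp (- s / 2)\<close> into the linear equation leaves the
  Laguerre equation with constant \<open>\<omega> / 4 - (m + 1) / 2\<close>; this equals
  \<open>n\<close> exactly for the given \<open>w\<close>.\<close>

lemma profile_laguerre:
  assumes w: "w = 2 * (real m + 2 * real n + 1)"
  shows "profile m (0, w) s = poly (laguerre n) s * exp (- s / 2)"
    and "s > 0 \<Longrightarrow> slope m (0, w) s = (poly (pderiv (laguerre n)) s - poly (laguerre n) s / 2) * exp (- s / 2)"
proof -
  define h where "h s = poly (laguerre n) s * exp (- s / 2)" for s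
  define h' where "h' s = (poly (pderiv (laguerre n)) s - poly (laguerre n) s / 2) * exp (- s / 2)" for s
  define h'' where "h'' s = (poly (pderiv (pderiv (laguerre n))) s - poly (pderiv (laguerre n)) s + poly (laguerre n) s / 4) * exp (- s / 2)" for s
  have d1: "(h has_real_derivative h' s) (at s)" for s
    unfolding h_def h'_def by (auto intro!: derivative_eq_intros poly_DERIV simp: algebra_simps)
  have d2: "(h' has_real_derivative h'' s) (at s)" for s
    unfolding h'_def h''_def
    by (auto intro!: derivative_eq_intros poly_DERIV simp: algebra_simps add_divide_distrib diff_divide_distrib)
  have eq: "s * h'' s + (real m + 1) * h' s = rhs m (0, w) s (h s)" for s
  proof -
    have e: "s * (P2 - P1 + P / 4) + (real m + 1) * (P1 - P / 2) = (s - w) * P / 4"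
      if "s * P2 + (real m + 1 - s) * P1 + real n * P = 0" for P P1 P2
    proof -
      have "s * (P2 - P1 + P / 4) + (real m + 1) * (P1 - P / 2) - (s - w) * P / 4 = s * P2 + (real m + 1 - s) * P1 + real n * P"
        unfolding w by (simp add: field_simps)
      then show ?thesis using that by simp
    qed
    have "s * h'' s + (real m + 1) * h' s = (s * (poly (pderiv (pderiv (laguerre n))) s - poly (pderiv (laguerre n)) s + poly (laguerre n) s / 4) + (real m + 1) * (poly (pderiv (laguerre n)) s - poly (laguerre n) s / 2)) * exp (- s / 2)"
      unfolding h'_def h''_def by (simp add: distrib_right)
    also have "\<dots> = (s - w) * poly (laguerre n) s / 4 * exp (- s / 2)"
      unfolding e[OF laguerre_ode] ..
    finally show ?thesis by (simp add: rhs_def potential_def h_def)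
  qed
  have "h 0 = 1" using coeff_laguerre[of n 0] by (simp add: h_def poly_0_coeff_0)
  then have hp: "h s = profile m (0, w) s" for s by (rule ode_imp_profile[OF _ d1 d2 eq])
  then show "profile m (0, w) s = poly (laguerre n) s * exp (- s / 2)" by (simp add: h_def)
  assume "s > 0"
  then have "(h has_real_derivative slope m (0, w) s) (at s)"
    using profile_deriv(1)[OF m, of s "(0, w)"] hp by (metis ext)
  then show "slope m (0, w) s = (poly (pderiv (laguerre n)) s - poly (laguerre n) s / 2) * exp (- s / 2)"
    using DERIV_unique[OF d1] by (metis h'_def)
qed

lemma poly_exp_tendsto_0: "((\<lambda>s. poly P s * exp (- s) :: real) \<longlongrightarrow> 0) at_top"
proof -
  have "((\<lambda>s. \<Sum>i\<le>degree P. coeff P i * (s ^ i / exp s)) \<longlongrightarrow> (\<Sum>i\<le>degree P. coeff P i * 0)) at_top"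
    by (intro tendsto_intros tendsto_power_div_exp_0)
  then show ?thesis by (simp add: poly_altdef exp_minus sum_distrib_right sum_divide_distrib field_simps)
qed

text \<open>The zeros of the polynomial need not be located: if \<open>H H' \<ge> 0\<close>
  somewhere beyond \<open>w\<close>, then \<open>flux * profile\<close> would stay above a positive
  constant, but it is a polynomial times \<open>exp (- s)\<close>.\<close>

lemma laguerre_decaying:
  assumes w: "w = 2 * (real m + 2 * real n + 1)"
  shows "(0, w) \<in> decaying"
  unfolding decaying_def mem_Collect_eq
proof (intro allI impI, rule ccontr)
  fix s assume s: "s > max (snd (0::real, w)) 0" and "\<not> profile m (0, w) s * slope m (0, w) s < 0"
  define E where "E s = flux (0, w) s * profile m (0, w) s" for s
  have "E s \<ge> 0" using s \<open>\<not> profile m (0, w) s * slope m (0, w) s < 0\<close>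
    unfolding E_def using sgn_flux_profile(2)[of s "(0, w)"] by auto
  also have "E s < E (s + 1)" unfolding E_def using s by (intro flux_profile_increasing) auto
  finally have E1: "E (s + 1) > 0" .
  have ge: "E (s + 1) \<le> E t" if "t > s + 1" for t
    unfolding E_def using s that by (intro less_imp_le flux_profile_increasing) auto
  define R where "R = monom 1 (m + 1) * laguerre n * (pderiv (laguerre n) - smult (1/2) (laguerre n))"
  have Eq: "E t = poly R t * exp (- t)" if "t > 0" for t
  proof -
    have "exp (- t) = exp (- t / 2) * exp (- t / 2)" by (simp flip: exp_add)
    then show ?thesis using that
      by (simp add: E_def flux_def profile_laguerre[OF w] R_def poly_monom algebra_simps)
  qed
  have "\<forall>\<^sub>F t in at_top. E (s + 1) \<le> poly R t * exp (- t)"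
    using eventually_gt_at_top[of "s + 1"]
  proof eventually_elim
    case (elim t)
    then show ?case using ge[OF elim] Eq[of t] s by simp
  qed
  then have "E (s + 1) \<le> 0" using poly_exp_tendsto_0[of R] by (intro tendsto_lowerbound[of _ _ at_top]) auto
  then show False using E1 by simp
qed

section \<open>Separation of the parameter plane\<close>

lemma bifurcation_curve:
  assumes w: "w = 2 * (real m + 2 * real n + 1)"
  obtains C where "C \<subseteq> decaying" "connected C" "(0, w) \<in> C" "\<And>v. (0, v) \<in> C \<Longrightarrow> v = w"
    "\<not> bounded (snd ` C)"
proof -
  \<comment> \<open>The index is whichever sector contains the Laguerre point; its value is
    immaterial.\<close>
  obtain k where k: "(0, w) \<in> sector k" using decaying_sector[OF laguerre_decaying[OF w]] by blast
  define a b where "a = (0 :: real, w + 1)" and "b = (0 :: real, w - 1)"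
  have ab: "a \<in> below k" "b \<in> above k" using sector_linear_sides[OF k] by (auto simp: a_def b_def)
  have "\<not> connected_component (- sector k) a b"
  proof
    assume "connected_component (- sector k) a b"
    then obtain T where T: "connected T" "T \<subseteq> above k \<union> below k" "a \<in> T" "b \<in> T"
      unfolding connected_component_def Compl_sector by blast
    show False
      using connectedD[OF T(1) open_above[of k] open_below[of k]] T ab above_below_disjoint[of k] by blast
  qed
  \<comment> \<open>The whole sector separates \<open>a\<close> from \<open>b\<close>, since a
    connected set in its complement cannot meet both disjoint open sets. The separation theorem
    finds one component that already does.\<close>
  from separation_by_component_closed_pointwise[OF closed_sector this]
  obtain C where C: "C \<in> components (sector k)" "\<not> connected_component (- C) a b" .
  have Csub: "C \<subseteq> sector k" by (rule in_components_subset[OF C(1)])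
  have line: "v = w" if "(0, v) \<in> C" for v using sector_linear_unique[OF k, of v] that Csub by auto
  \<comment> \<open>Otherwise the line \<open>a = 0\<close> would avoid \<open>C\<close> altogether
    and join the two points.\<close>
  have wC: "(0, w) \<in> C"
  proof (rule ccontr)
    assume "(0, w) \<notin> C"
    then have "range (\<lambda>v. (0, v)) \<subseteq> - C" using line by auto
    moreover have "connected (range (\<lambda>v::real. (0::real, v)))"
      by (intro connected_continuous_image continuous_intros connected_UNIV)
    ultimately have "connected_component (- C) a b"
      unfolding connected_component_def by (intro exI[of _ "range (\<lambda>v. (0, v))"]) (auto simp: a_def b_def)
    then show False using C(2) by simp
  qed
  \<comment> \<open>The complement of a bounded \<open>C\<close> has only one unbounded component.
    The two half lines on either side of \<open>(0, w)\<close> are unbounded and avoid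
    \<open>C\<close>, so both would lie in it and the two points would be joined.\<close>
  have unb: "\<not> bounded C"
  proof
    assume bC: "bounded C"
    have nb: "\<not> bounded {w<..}" "\<not> bounded {..<w}"
    proof -
      have "max (w + 1) (B + 1) \<in> {w<..}" "\<not> norm (max (w + 1) (B + 1)) \<le> B" for B by auto
      then show "\<not> bounded {w<..}" unfolding bounded_iff by blast
      have "min (w - 1) (- B - 1) \<in> {..<w}" "\<not> norm (min (w - 1) (- B - 1)) \<le> B" for B by auto
      then show "\<not> bounded {..<w}" unfolding bounded_iff by blast
    qed
    have half: "\<not> bounded (connected_component_set (- C) x)" if "x \<in> (\<lambda>v. (0, v)) ` I" "connected I" "w \<notin> I" "\<not> bounded I" for x I
    proof
      assume bd: "bounded (connected_component_set (- C) x)"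
      have "(\<lambda>v. (0, v)) ` I \<subseteq> - C" using line that by auto
      moreover have "connected ((\<lambda>v::real. (0::real, v)) ` I)"
        by (intro connected_continuous_image continuous_intros that)
      ultimately have "(\<lambda>v. (0, v)) ` I \<subseteq> connected_component_set (- C) x"
        using that(1) by (intro connected_component_maximal) auto
      then have "bounded (snd ` ((\<lambda>v. (0::real, v)) ` I))"
        using bd by (intro bounded_snd) (rule bounded_subset)
      then show False using that(4) by (simp add: image_image)
    qed
    have "\<not> bounded (connected_component_set (- C) a)"
      by (rule half[of a "{w<..}"]) (auto simp: a_def nb)
    moreover have "\<not> bounded (connected_component_set (- C) b)"
      by (rule half[of b "{..<w}"]) (auto simp: b_def nb)
    ultimately have "connected_component_set (- C) a = connected_component_set (- C) b"
      using bC by (intro cobounded_unique_unbounded_component) auto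
    moreover have "a \<notin> C" "b \<notin> C" using line[of "w + 1"] line[of "w - 1"] by (auto simp: a_def b_def)
    ultimately have "connected_component (- C) a b"
      by (metis ComplI connected_component_refl mem_Collect_eq)
    then show False using C(2) by simp
  qed
  have dec: "C \<subseteq> decaying" using Csub sector_subset_decaying by blast
  have "\<not> bounded (snd ` C)"
  proof
    assume "bounded (snd ` C)"
    then obtain B where B: "\<And>p. p \<in> C \<Longrightarrow> \<bar>snd p\<bar> \<le> B" unfolding bounded_iff by auto
    define W where "W = max 1 B"
    have fstb: "\<bar>fst p\<bar> \<le> sqrt (4 * W * (2 * W) ^ m)" if p: "p \<in> C" for p
    proof -
      have "(fst p)\<^sup>2 \<le> 4 * W * (2 * W) ^ m"
        by (rule decaying_amplitude_bound) (use dec p B[OF p] in \<open>auto simp: W_def\<close>)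
      then show ?thesis using real_le_rsqrt by (metis power2_abs)
    qed
    have "norm p \<le> sqrt (4 * W * (2 * W) ^ m) + B" if p: "p \<in> C" for p
      using norm_Pair_le[of "fst p" "snd p"] fstb[OF p] B[OF p] by simp
    then have "bounded C" unfolding bounded_iff by blast
    then show False using unb by simp
  qed
  then show ?thesis using that[of C] dec in_components_connected[OF C(1)] wC line by blast
qed

end

subsection \<open>Weak derivatives and Gaussian bounds on the plane\<close>

text \<open>\<open>F'\<close> is not assumed continuous, so the fundamental theorem is that of the
  gauge integral. If \<open>F'\<close> is not Lebesgue integrable, the default value 0 of the
  integral is the one claimed.\<close>

lemma integral_derivative_compact_support:
  fixes F F' :: "real \<Rightarrow> 'a::euclidean_space"
  assumes F: "\<And>t. (F has_vector_derivative F' t) (at t)" and supp: "\<And>t. \<bar>t\<bar> > R \<Longrightarrow> F t = 0"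
  shows "(\<integral>t. F' t \<partial>lborel) = 0"
proof (cases "integrable lborel F'")
  case False then show ?thesis by (rule not_integrable_integral_eq)
next
  case True
  define S where "S = \<bar>R\<bar> + 1"
  have S: "S > 0" "S > R" by (auto simp: S_def)
  have F'0: "F' t = 0" if t: "\<bar>t\<bar> > R" for t
  proof -
    have op: "open {t. \<bar>t\<bar> > R}" by (intro open_Collect_less continuous_intros)
    have "(F has_vector_derivative 0) (at t)"
      by (rule has_vector_derivative_transform_within_open[OF has_vector_derivative_const op]) (use t supp in auto)
    then show ?thesis using F vector_derivative_unique_at by blast
  qed
  have "(F' has_integral F S - F (- S)) {- S..S}"
    by (rule fundamental_theorem_of_calculus) (use S in \<open>auto intro: has_vector_derivative_at_within[OF F]\<close>)
  then have "(F' has_integral 0) {- S..S}" using S supp[of S] supp[of "- S"] by simp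
  moreover have "F' t = 0" if "t \<notin> {- S..S}" for t
  proof (rule F'0)
    have "\<bar>t\<bar> > S" using that S by auto
    then show "\<bar>t\<bar> > R" using S by simp
  qed
  ultimately have "(F' has_integral 0) UNIV" by (rule has_integral_on_superset) auto
  then show ?thesis using has_integral_integral_lborel[OF True] has_integral_unique by blast
qed

lemma has_vector_derivative_at_shift:
  assumes "((\<lambda>\<tau>. f (t + \<tau>)) has_vector_derivative D) (at 0)"
  shows "(f has_vector_derivative D) (at t)"
proof -
  have "((\<lambda>s. s - t) has_vector_derivative 1) (at t)"
    by (auto intro!: derivative_eq_intros)
  from vector_diff_chain_at[OF this, of "\<lambda>\<tau>. f (t + \<tau>)" D] assms
  show ?thesis by (simp add: o_def)
qed

lemma partial_deriv_line:
  fixes \<phi> :: "'a::euclidean_space \<Rightarrow> real"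
  assumes "\<phi> differentiable (at x)"
  shows "((\<lambda>t. \<phi> (x + t *\<^sub>R b)) has_real_derivative partial_deriv b \<phi> x) (at 0)"
proof -
  have line: "((\<lambda>t::real. x + t *\<^sub>R b) has_derivative (\<lambda>t. t *\<^sub>R b)) (at 0)"
    by (auto intro!: derivative_eq_intros)
  have D: "(\<phi> has_derivative (\<lambda>h. partial_deriv h \<phi> x)) (at x)" using assms by (rule has_derivative_partial)
  then have lin: "linear (\<lambda>h. partial_deriv h \<phi> x)" by (rule has_derivative_linear)
  have "((\<lambda>t. \<phi> (x + t *\<^sub>R b)) has_derivative (\<lambda>t. partial_deriv (t *\<^sub>R b) \<phi> x)) (at 0)"
    using has_derivative_compose[OF line, of \<phi>] D by simp
  moreover have "partial_deriv (t *\<^sub>R b) \<phi> x = partial_deriv b \<phi> x * t" for t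
    using linear_scale[OF lin, of t b] by simp
  ultimately show ?thesis by (simp add: has_field_derivative_def)
qed

lemma plane_Basis: "(Basis :: plane set) = {(1, 0), (0, 1)}"
  by (auto simp: Basis_prod_def)

text \<open>Lines through the origin are excluded since the second derivatives of a function
  \<open>f(\<bar>x\<bar>\<^sup>2) z\<^sup>m\<close> need not exist there.\<close>

lemma has_weak_deriv_if_off_origin:
  fixes u g :: "plane \<Rightarrow> complex"
  assumes b: "b \<in> Basis" and u: "u \<in> L2" and g: "g \<in> L2"
    and D: "\<And>x. x \<noteq> 0 \<Longrightarrow> ((\<lambda>t. u (x + t *\<^sub>R b)) has_vector_derivative g x) (at 0)"
  shows "has_weak_deriv b u g"
  unfolding has_weak_deriv_def
proof (intro conjI u g allI impI)
  fix \<phi> :: "plane \<Rightarrow> real" assume t: "test_function \<phi>"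
  \<comment> \<open>Off the origin \<open>W\<close> is the derivative of \<open>\<phi> u\<close> in
    direction \<open>b\<close>, so its integral along every line that misses the origin is
    0.\<close>
  define W where "W x = partial_deriv b \<phi> x *\<^sub>R u x + \<phi> x *\<^sub>R g x" for x
  note i = L2_scaleR_integrable[OF test_function_partial_L2[OF t b] u] L2_scaleR_integrable[OF test_function_L2[OF t] g]
  have W: "integrable lborel W" unfolding W_def by (intro Bochner_Integration.integrable_add i)
  then have W2: "integrable (lborel \<Otimes>\<^sub>M lborel) W" by (simp add: lborel_prod)
  have diff: "\<phi> differentiable (at x)" for x
    using t unfolding test_function_def by (metis Ck.simps(2))
  have "bounded {x. \<phi> x \<noteq> 0}"
    using t unfolding test_function_def by (meson bounded_subset closure_subset compact_imp_bounded)
  then obtain B where B: "\<And>x. \<phi> x \<noteq> 0 \<Longrightarrow> norm x \<le> B" unfolding bounded_iff by auto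
  have line: "(\<integral>s. W (x + s *\<^sub>R b) \<partial>lborel) = 0" if off: "\<And>s. x + s *\<^sub>R b \<noteq> 0" for x
  proof (rule integral_derivative_compact_support)
    fix s :: real
    let ?y = "x + s *\<^sub>R b"
    have "((\<lambda>\<tau>. \<phi> (?y + \<tau> *\<^sub>R b) *\<^sub>R u (?y + \<tau> *\<^sub>R b)) has_vector_derivative
        \<phi> (?y + 0 *\<^sub>R b) *\<^sub>R g ?y + partial_deriv b \<phi> ?y *\<^sub>R u (?y + 0 *\<^sub>R b)) (at 0)"
      by (rule has_vector_derivative_scaleR[OF partial_deriv_line[OF diff] D[OF off]])
    then have "((\<lambda>\<tau>. \<phi> (x + (s + \<tau>) *\<^sub>R b) *\<^sub>R u (x + (s + \<tau>) *\<^sub>R b)) has_vector_derivative W ?y) (at 0)"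
      by (simp add: W_def scaleR_add_left ac_simps)
    then show "((\<lambda>s. \<phi> (x + s *\<^sub>R b) *\<^sub>R u (x + s *\<^sub>R b)) has_vector_derivative W (x + s *\<^sub>R b)) (at s)"
      by (rule has_vector_derivative_at_shift[where f = "\<lambda>s. \<phi> (x + s *\<^sub>R b) *\<^sub>R u (x + s *\<^sub>R b)"])
  next
    fix s :: real assume s: "\<bar>s\<bar> > B + norm x"
    have "norm (x + s *\<^sub>R b) \<ge> norm (s *\<^sub>R b) - norm x"
      using norm_diff_ineq[of "s *\<^sub>R b" x] by (simp add: add.commute)
    then have "norm (x + s *\<^sub>R b) > B" using s b by simp
    then show "\<phi> (x + s *\<^sub>R b) *\<^sub>R u (x + s *\<^sub>R b) = 0" using B[of "x + s *\<^sub>R b"] by auto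
  qed
  have "(\<integral>x. W x \<partial>lborel) = 0"
  proof -
    \<comment> \<open>Among the lines parallel to \<open>b\<close> only one meets the origin, and
      Fubini does not see it.\<close>
    have ae: "AE c::real in lborel. c \<noteq> 0" by (rule AE_lborel_singleton)
    from b consider "b = (1, 0)" | "b = (0, 1)" by (auto simp: plane_Basis)
    then show ?thesis
    proof cases
      case 1
      have "(\<integral>x. W (x, c) \<partial>lborel) = 0" if "c \<noteq> 0" for c
        using line[of "(0, c)"] that by (simp add: 1 zero_prod_def)
      then have "(\<integral>c. (\<integral>x. W (x, c) \<partial>lborel) \<partial>lborel) = 0"
        using ae by (intro integral_eq_zero_AE) auto
      moreover have "(\<integral>c. (\<integral>x. W (x, c) \<partial>lborel) \<partial>lborel) = integral\<^sup>L (lborel \<Otimes>\<^sub>M lborel) (\<lambda>(x, y). W (x, y))"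
        by (rule lborel_pair.integral_snd) (use W2 in simp)
      ultimately show ?thesis by (simp add: lborel_prod)
    next
      case 2
      have "(\<integral>y. W (c, y) \<partial>lborel) = 0" if "c \<noteq> 0" for c
        using line[of "(c, 0)"] that by (simp add: 2 zero_prod_def)
      then have "(\<integral>c. (\<integral>y. W (c, y) \<partial>lborel) \<partial>lborel) = 0"
        using ae by (intro integral_eq_zero_AE) auto
      moreover have "(\<integral>c. (\<integral>y. W (c, y) \<partial>lborel) \<partial>lborel) = integral\<^sup>L (lborel \<Otimes>\<^sub>M lborel) W"
        by (rule lborel_pair.integral_fst'[OF W2])
      ultimately show ?thesis by (simp add: lborel_prod)
    qed
  qed
  then show "(\<integral>x. partial_deriv b \<phi> x *\<^sub>R u x \<partial>lborel) = - (\<integral>x. \<phi> x *\<^sub>R g x \<partial>lborel)"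
    unfolding W_def using Bochner_Integration.integral_add[OF i] by (simp add: eq_neg_iff_add_eq_0)
qed

section \<open>Gaussian domination in \<open>L2\<close>\<close>

lemma integrable_gaussian_line: "integrable lborel (\<lambda>t::real. exp (- (t\<^sup>2 / 8)))"
proof -
  define f where "f t = indicator {0..} t *\<^sub>R exp (- 1 * t)" for t :: real
  have "(\<lambda>t::real. exp (- 1 * t)) absolutely_integrable_on {0..}"
    by (intro nonnegative_absolutely_integrable_1 integrable_on_exp_minus_to_infinity) auto
  then have "integrable (completion lborel) f" unfolding f_def set_integrable_def .
  moreover have "f \<in> borel_measurable lborel" unfolding f_def by measurable
  ultimately have f: "integrable lborel f" by (simp add: integrable_completion)
  then have f': "integrable lborel (\<lambda>t. f (- t))" using lborel_integrable_real_affine[of f "-1" 0] by simp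
  show ?thesis
  proof (rule Bochner_Integration.integrable_bound)
    show "integrable lborel (\<lambda>t. exp 2 * (f t + f (- t)))" using f f' by simp
    have "exp (- (t\<^sup>2 / 8)) \<le> exp 2 * (f t + f (- t))" for t :: real
    proof -
      \<comment> \<open>This square is chosen to give
        \<open>t^2 / 8 \<ge> \<bar>t\<bar> - 2\<close>, whence the majorant
        \<open>exp 2 * exp (- \<bar>t\<bar>)\<close>.\<close>
      have "0 \<le> (\<bar>t\<bar> - 4)\<^sup>2" by simp
      then have "\<bar>t\<bar> - 2 \<le> t\<^sup>2 / 8" by (simp add: power2_eq_square algebra_simps)
      then have "exp (- (t\<^sup>2 / 8)) \<le> exp (2 + - \<bar>t\<bar>)" by simp
      also have "\<dots> = exp 2 * exp (- \<bar>t\<bar>)" by (rule exp_add)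
      also have "\<dots> \<le> exp 2 * (f t + f (- t))"
        by (intro mult_left_mono) (auto simp: f_def indicator_def)
      finally show ?thesis .
    qed
    then show "AE t in lborel. norm (exp (- (t\<^sup>2 / 8))) \<le> norm (exp 2 * (f t + f (- t)))"
      by (intro AE_I2) (simp add: order_trans[OF _ abs_ge_self])
  qed simp
qed

lemma integrable_gaussian_plane: "integrable lborel (\<lambda>x::plane. (exp (- (x \<bullet> x) / 16))\<^sup>2)"
proof -
  have eq: "(exp (- (x \<bullet> x) / 16))\<^sup>2 = exp (- ((fst x)\<^sup>2 / 8)) * exp (- ((snd x)\<^sup>2 / 8))" for x :: plane
    by (simp add: inner_prod_def power2_eq_square add_divide_distrib flip: exp_double exp_add)
  note g = integrable_gaussian_line
  have "integrable (lborel \<Otimes>\<^sub>M lborel) (\<lambda>x::plane. exp (- ((fst x)\<^sup>2 / 8)) * exp (- ((snd x)\<^sup>2 / 8)))"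
  proof (rule lborel_pair.Fubini_integrable)
    show "integrable lborel (\<lambda>x. \<integral>y. norm (exp (- ((fst (x, y::real))\<^sup>2 / 8)) * exp (- ((snd (x, y))\<^sup>2 / 8))) \<partial>lborel)"
      using g by simp
    show "AE x in lborel. integrable lborel (\<lambda>y. exp (- ((fst (x::real, y))\<^sup>2 / 8)) * exp (- ((snd (x, y))\<^sup>2 / 8)))"
      using g by simp
  qed measurable
  then show ?thesis unfolding eq by (simp add: lborel_prod)
qed

lemma L2_gaussian_bound:
  fixes f :: "plane \<Rightarrow> complex"
  assumes "f \<in> borel_measurable lborel" "AE x in lborel. norm (f x) \<le> B * exp (- (x \<bullet> x) / 16)"
  shows "f \<in> L2"
proof -
  have [measurable]: "f \<in> borel_measurable lborel" by (fact assms)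
  have "integrable lborel (\<lambda>x. (norm (f x))\<^sup>2)"
  proof (rule Bochner_Integration.integrable_bound)
    show "integrable lborel (\<lambda>x::plane. B\<^sup>2 * (exp (- (x \<bullet> x) / 16))\<^sup>2)" using integrable_gaussian_plane by simp
    show "AE x in lborel. norm ((norm (f x))\<^sup>2) \<le> norm (B\<^sup>2 * (exp (- (x \<bullet> x) / 16))\<^sup>2)"
      using assms(2)
    proof eventually_elim
      case (elim x)
      then have "(norm (f x))\<^sup>2 \<le> (B * exp (- (x \<bullet> x) / 16))\<^sup>2" by (intro power_mono) auto
      then show ?case by (simp add: power_mult_distrib)
    qed
  qed measurable
  then show ?thesis using assms(1) by (simp add: L2_def)
qed

lemma L2_norm_dominated_tendsto:
  fixes f :: "nat \<Rightarrow> plane \<Rightarrow> complex"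
  assumes f: "\<And>k. f k \<in> borel_measurable lborel"
    and bound: "\<And>k. AE x in lborel. norm (f k x) \<le> B * exp (- (x \<bullet> x) / 16)"
    and lim: "AE x in lborel. (\<lambda>k. f k x) \<longlonglongrightarrow> 0"
  shows "(\<lambda>k. (L2_norm (f k))\<^sup>2) \<longlonglongrightarrow> 0"
proof -
  have [measurable]: "f k \<in> borel_measurable lborel" for k by (fact f)
  have "(\<lambda>k. \<integral>x. (norm (f k x))\<^sup>2 \<partial>lborel) \<longlonglongrightarrow> integral\<^sup>L lborel (\<lambda>x::plane. 0 :: real)"
  proof (rule integral_dominated_convergence[where w="\<lambda>x. B\<^sup>2 * (exp (- (x \<bullet> x) / 16))\<^sup>2"])
    show "integrable lborel (\<lambda>x::plane. B\<^sup>2 * (exp (- (x \<bullet> x) / 16))\<^sup>2)" using integrable_gaussian_plane by simp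
    show "AE x in lborel. (\<lambda>k. (norm (f k x))\<^sup>2) \<longlonglongrightarrow> 0"
      using lim
    proof eventually_elim
      case (elim x)
      then have "(\<lambda>k. (norm (f k x))\<^sup>2) \<longlonglongrightarrow> (norm (0::complex))\<^sup>2" by (intro tendsto_intros)
      then show ?case by simp
    qed
    show "AE x in lborel. norm ((norm (f k x))\<^sup>2) \<le> B\<^sup>2 * (exp (- (x \<bullet> x) / 16))\<^sup>2" for k
      using bound[of k]
    proof eventually_elim
      case (elim x)
      then have "(norm (f k x))\<^sup>2 \<le> (B * exp (- (x \<bullet> x) / 16))\<^sup>2" by (intro power_mono) auto
      then show ?case by (simp add: power_mult_distrib)
    qed
  qed auto
  then show ?thesis by (simp add: L2_norm_def)
qed

lemma L2_norm_cong_AE: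
  assumes "u \<in> L2" "v \<in> L2" "AE x in lborel. u x = v x" shows "L2_norm u = L2_norm v"
proof -
  have "(L2_norm u)\<^sup>2 = (L2_norm v)\<^sup>2" unfolding L2_norm_sq by (rule L2_inner_cong) (use assms in auto)
  moreover have "L2_norm u \<ge> 0" "L2_norm v \<ge> 0" by (simp_all add: L2_norm_def)
  ultimately show ?thesis by simp
qed

section \<open>Functions with explicit weak derivatives up to second order\<close>

definition jet :: "(plane \<Rightarrow> complex) \<Rightarrow> (plane \<Rightarrow> plane \<Rightarrow> complex) \<Rightarrow> (plane \<Rightarrow> plane \<Rightarrow> plane \<Rightarrow> complex) \<Rightarrow> bool" where
  "jet u U1 U2 \<longleftrightarrow> (\<lambda>x. (norm x)\<^sup>2 *\<^sub>R u x) \<in> L2 \<and>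
     (\<forall>b\<in>Basis. has_weak_deriv b u (U1 b) \<and> (\<forall>c\<in>Basis. has_weak_deriv c (U1 b) (U2 b c)))"

lemma jet_diff:
  assumes "jet u U1 U2" "jet v V1 V2"
  shows "jet (\<lambda>x. u x + (-1) *\<^sub>R v x) (\<lambda>b x. U1 b x + (-1) *\<^sub>R V1 b x) (\<lambda>b c x. U2 b c x + (-1) *\<^sub>R V2 b c x)"
proof -
  have "(\<lambda>x. (norm x)\<^sup>2 *\<^sub>R u x + (-1) *\<^sub>R ((norm x)\<^sup>2 *\<^sub>R v x)) \<in> L2"
    using assms unfolding jet_def by (intro L2_add L2_scaleR) auto
  then have "(\<lambda>x. (norm x)\<^sup>2 *\<^sub>R (u x + (-1) *\<^sub>R v x)) \<in> L2"
    unfolding scaleR_add_right scaleR_left_commute[of "(norm x)\<^sup>2" "-1" "v x" for x] .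
  then show ?thesis
    using assms unfolding jet_def by (intro conjI ballI has_weak_deriv_add has_weak_deriv_scaleR) blast+
qed

text \<open>\<open>weak_deriv\<close> is an arbitrary choice, and so is its iteration. Uniqueness
  almost everywhere lets all membership and norm computations in \<open>X\<close> use the explicit
  derivatives of the jet.\<close>

lemma jet_weak_derivs:
  assumes "jet u U1 U2" "b \<in> Basis"
  shows "AE x in lborel. weak_deriv b u x = U1 b x" "weak_deriv b u \<in> H1"
    "c \<in> Basis \<Longrightarrow> AE x in lborel. weak_deriv c (weak_deriv b u) x = U2 b c x"
proof -
  have d: "has_weak_deriv b u (U1 b)" and d2: "\<And>c. c \<in> Basis \<Longrightarrow> has_weak_deriv c (U1 b) (U2 b c)"
    using assms by (auto simp: jet_def)
  show ae: "AE x in lborel. weak_deriv b u x = U1 b x" by (rule weak_deriv_eqI[OF d])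
  have U1: "U1 b \<in> H1" using d d2 by (auto simp: H1_def has_weak_deriv_def[of b u])
  have "has_weak_deriv b u (weak_deriv b u)"
    unfolding weak_deriv_def by (rule someI[of "has_weak_deriv b u", OF d])
  then have L: "weak_deriv b u \<in> L2" by (simp add: has_weak_deriv_def)
  show "weak_deriv b u \<in> H1" by (rule H1_cong[OF U1 L AE_sym[OF ae]])
  show "AE x in lborel. weak_deriv c (weak_deriv b u) x = U2 b c x" if "c \<in> Basis"
    using weak_deriv_cong[OF L H1_L2[OF U1] ae that] weak_deriv_eqI[OF d2[OF that]] by simp
qed

lemma jet_X_fun:
  assumes j: "jet u U1 U2"
  shows "u \<in> X_fun"
    and "(X_norm u)\<^sup>2 = (L2_norm u)\<^sup>2 + (\<Sum>b\<in>Basis. (L2_norm (U1 b))\<^sup>2) +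
      (\<Sum>b\<in>Basis. \<Sum>c\<in>Basis. (L2_norm (U2 b c))\<^sup>2) + (L2_norm (\<lambda>x. (norm x)\<^sup>2 *\<^sub>R u x))\<^sup>2"
proof -
  have "u \<in> L2" using j plane_Basis by (auto simp: jet_def has_weak_deriv_def)
  then have "u \<in> H1" using j by (auto simp: H1_def jet_def)
  then show X: "u \<in> X_fun" using j jet_weak_derivs(2)[OF j] by (auto simp: X_fun_def H2_def jet_def)
  have "L2_norm (weak_deriv b u) = L2_norm (U1 b)" if "b \<in> Basis" for b
    using j that jet_weak_derivs[OF j that] X_fun_D[OF X] by (intro L2_norm_cong_AE) (auto simp: jet_def has_weak_deriv_def)
  moreover have "L2_norm (weak_deriv c (weak_deriv b u)) = L2_norm (U2 b c)" if "b \<in> Basis" "c \<in> Basis" for b c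
    using j that jet_weak_derivs(3)[OF j that(1)] X_fun_D[OF X] by (intro L2_norm_cong_AE) (auto simp: jet_def has_weak_deriv_def)
  ultimately show "(X_norm u)\<^sup>2 = (L2_norm u)\<^sup>2 + (\<Sum>b\<in>Basis. (L2_norm (U1 b))\<^sup>2) +
      (\<Sum>b\<in>Basis. \<Sum>c\<in>Basis. (L2_norm (U2 b c))\<^sup>2) + (L2_norm (\<lambda>x. (norm x)\<^sup>2 *\<^sub>R u x))\<^sup>2"
    by (simp add: X_norm_def H2_norm_def sum_nonneg)
qed

lemma dist_abs_X:
  assumes "jet u U1 U2" "jet v V1 V2"
  shows "(dist (abs_X u) (abs_X v))\<^sup>2 = (L2_norm (\<lambda>x. u x + (-1) *\<^sub>R v x))\<^sup>2 + (\<Sum>b\<in>Basis. (L2_norm (\<lambda>x. U1 b x + (-1) *\<^sub>R V1 b x))\<^sup>2) +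
      (\<Sum>b\<in>Basis. \<Sum>c\<in>Basis. (L2_norm (\<lambda>x. U2 b c x + (-1) *\<^sub>R V2 b c x))\<^sup>2) +
      (L2_norm (\<lambda>x. (norm x)\<^sup>2 *\<^sub>R (u x + (-1) *\<^sub>R v x)))\<^sup>2"
proof -
  have X: "X_rel u u" "X_rel v v" "X_rel (\<lambda>x. (-1) *\<^sub>R v x) (\<lambda>x. (-1) *\<^sub>R v x)"
    "X_rel (\<lambda>x. u x + (-1) *\<^sub>R v x) (\<lambda>x. u x + (-1) *\<^sub>R v x)"
    unfolding X_rel_def by (intro conjI X_fun_add X_fun_scaleR jet_X_fun(1)[OF assms(1)] jet_X_fun(1)[OF assms(2)] AE_I2 refl)+
  have "dist (abs_X u) (abs_X v) = norm (abs_X u + (-1) *\<^sub>R abs_X v)" by (simp only: dist_norm minus_X_def)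
  also have "\<dots> = X_norm (\<lambda>x. u x + (-1) *\<^sub>R v x)"
    by (simp only: scaleR_X.abs_eq[OF X(2)] plus_X.abs_eq[OF X(1,3)] norm_X.abs_eq[OF X(4)])
  finally show ?thesis using jet_X_fun(2)[OF jet_diff[OF assms]] by simp
qed

subsection \<open>Vortex functions with a radial profile\<close>

definition planar :: "plane \<Rightarrow> complex" where
  "planar x = Complex (fst x) (snd x)"

lemma planar_line: "planar (x + t *\<^sub>R b) = planar x + t *\<^sub>R planar b"
  by (simp add: planar_def complex_eq_iff)

lemma norm_planar: "norm (planar x) = norm x"
  by (simp add: planar_def complex_norm norm_prod_def)

lemma continuous_on_planar [continuous_intros]:
  "continuous_on S f \<Longrightarrow> continuous_on S (\<lambda>x. planar (f x))"
  unfolding planar_def Complex_eq by (intro continuous_intros)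

definition wave :: "nat \<Rightarrow> (real \<Rightarrow> real) \<Rightarrow> plane \<Rightarrow> complex" where
  "wave m h0 x = of_real (h0 (x \<bullet> x)) * planar x ^ m"

definition wave1 :: "nat \<Rightarrow> (real \<Rightarrow> real) \<Rightarrow> (real \<Rightarrow> real) \<Rightarrow> plane \<Rightarrow> plane \<Rightarrow> complex" where
  "wave1 m h0 h1 b x = of_real (2 * (x \<bullet> b) * h1 (x \<bullet> x)) * planar x ^ m
     + of_real (h0 (x \<bullet> x)) * planar x ^ (m - 1) * (of_nat m * planar b)"

text \<open>Derivative of \<open>wave1\<close> in direction \<open>c\<close>, along which
  \<open>s\<close> changes at rate \<open>2 (x . c)\<close> and \<open>z\<close> at rate
  \<open>planar c\<close>. The truncated exponent \<open>m - 1 - 1\<close> is harmless for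
  \<open>m = 1\<close>, where its coefficient \<open>of_nat (m - 1)\<close> vanishes.\<close>

definition wave2 ::
  "nat \<Rightarrow> (real \<Rightarrow> real) \<Rightarrow> (real \<Rightarrow> real) \<Rightarrow> (real \<Rightarrow> real) \<Rightarrow> plane \<Rightarrow> plane \<Rightarrow> plane \<Rightarrow> complex" where
  "wave2 m h0 h1 h2 b c x =
     of_real (2 * (c \<bullet> b) * h1 (x \<bullet> x) + 4 * (x \<bullet> b) * (x \<bullet> c) * h2 (x \<bullet> x)) * planar x ^ m
     + of_real (2 * (x \<bullet> b) * h1 (x \<bullet> x)) * (of_nat m * planar x ^ (m - 1) * planar c)
     + (of_real (2 * (x \<bullet> c) * h1 (x \<bullet> x)) * planar x ^ (m - 1)
        + of_real (h0 (x \<bullet> x)) * (of_nat (m - 1) * planar x ^ (m - 1 - 1) * planar c)) * (of_nat m * planar b)"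

lemma radial_line_deriv:
  assumes "(h has_real_derivative h') (at (x \<bullet> x))"
  shows "((\<lambda>t. h ((x + t *\<^sub>R b) \<bullet> (x + t *\<^sub>R b))) has_real_derivative h' * (2 * (x \<bullet> b))) (at 0)"
proof -
  have "((\<lambda>t. x \<bullet> x + 2 * t * (x \<bullet> b) + t\<^sup>2 * (b \<bullet> b)) has_real_derivative 2 * (x \<bullet> b)) (at 0)"
    by (auto intro!: derivative_eq_intros)
  moreover have "(\<lambda>t. x \<bullet> x + 2 * t * (x \<bullet> b) + t\<^sup>2 * (b \<bullet> b)) = (\<lambda>t. (x + t *\<^sub>R b) \<bullet> (x + t *\<^sub>R b))"
    by (simp add: inner_add_left inner_add_right inner_commute power2_eq_square algebra_simps)
  ultimately have "((\<lambda>t. (x + t *\<^sub>R b) \<bullet> (x + t *\<^sub>R b)) has_real_derivative 2 * (x \<bullet> b)) (at 0)" by simp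
  then show ?thesis using assms DERIV_chain2[of h h' "\<lambda>t. (x + t *\<^sub>R b) \<bullet> (x + t *\<^sub>R b)" 0] by simp
qed

lemma weighted_power_line_deriv:
  assumes "((\<lambda>t. k (x + t *\<^sub>R b)) has_real_derivative k') (at 0)"
  shows "((\<lambda>t. of_real (k (x + t *\<^sub>R b)) * planar (x + t *\<^sub>R b) ^ n) has_vector_derivative
    of_real k' * planar x ^ n + of_real (k x) * (of_nat n * planar x ^ (n - 1) * planar b)) (at 0)"
proof -
  have l: "((\<lambda>t. planar (x + t *\<^sub>R b)) has_vector_derivative planar b) (at 0)"
    unfolding planar_line by (auto intro!: derivative_eq_intros)
  have "((\<lambda>z. z ^ n) has_field_derivative of_nat n * planar x ^ (n - 1)) (at (planar (x + 0 *\<^sub>R b)))"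
    by (auto intro!: derivative_eq_intros)
  from field_vector_diff_chain_at[OF l this]
  have p: "((\<lambda>t. planar (x + t *\<^sub>R b) ^ n) has_vector_derivative planar b * (of_nat n * planar x ^ (n - 1))) (at 0)"
    by (simp add: o_def)
  from has_vector_derivative_mult[OF has_vector_derivative_of_real[OF assms] p]
  show ?thesis by (simp add: mult_ac add.commute)
qed

text \<open>\<open>r \<le> 1 + r^2 \<le> N exp (r^2 / N)\<close>. The choice
  \<open>N = 16 (k + 1)\<close> makes the \<open>k\<close>-th power cost at most
  \<open>exp (r^2 / 16)\<close>, half of the available Gaussian.\<close>

lemma gaussian_absorbs_power:
  fixes r :: real
  assumes "r \<ge> 0"
  shows "r ^ k * exp (- r\<^sup>2 / 8) \<le> (16 * (real k + 1)) ^ k * exp (- r\<^sup>2 / 16)"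
proof -
  define N where "N = 16 * (real k + 1)"
  have N: "N \<ge> 16" by (simp add: N_def)
  have "0 \<le> (r - 1)\<^sup>2" by simp
  then have "r \<le> 1 + r\<^sup>2" using assms unfolding power2_diff by simp
  also have "\<dots> \<le> N * (1 + r\<^sup>2 / N)" using N by (simp add: distrib_left)
  also have "\<dots> \<le> N * exp (r\<^sup>2 / N)" using N by (intro mult_left_mono exp_ge_add_one_self) auto
  finally have "r ^ k \<le> (N * exp (r\<^sup>2 / N)) ^ k" using assms by (intro power_mono) auto
  also have "\<dots> = N ^ k * exp (real k * (r\<^sup>2 / N))" by (simp only: power_mult_distrib exp_of_nat_mult)
  also have "\<dots> \<le> N ^ k * exp (r\<^sup>2 / 16)"
  proof -
    have "real k * (r\<^sup>2 / N) \<le> r\<^sup>2 / 16"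
    proof -
      have "real k * (r\<^sup>2 * 16) \<le> N * r\<^sup>2" by (simp add: N_def algebra_simps)
      then show ?thesis using N by (simp add: field_simps)
    qed
    then show ?thesis using N by (intro mult_left_mono) auto
  qed
  finally have "r ^ k * exp (- r\<^sup>2 / 8) \<le> N ^ k * exp (r\<^sup>2 / 16) * exp (- r\<^sup>2 / 8)" by (intro mult_right_mono) auto
  also have "\<dots> = N ^ k * exp (- r\<^sup>2 / 16)" by (simp flip: exp_add)
  finally show ?thesis by (simp add: N_def)
qed

text \<open>The sum dominates the cost of absorbing any power of \<open>r\<close> up to
  \<open>m + 2\<close>, the degree reached by the weight \<open>r^2\<close>. The quadratic factor
  adds up the coefficients in \<open>wave2\<close>, the longest of the expressions.\<close>

definition wave_const :: "nat \<Rightarrow> real" where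
  "wave_const m = (\<Sum>k\<le>m + 2. (16 * (real k + 1)) ^ k) * (6 + 4 * real m + (real m)\<^sup>2)"

text \<open>In \<open>wave2\<close> the second derivative \<open>h2\<close> occurs only with the
  factor \<open>(x . b) (x . c)\<close>, which is at most \<open>s\<close>; accordingly
  \<open>s * \<bar>h2 s\<bar>\<close> is bounded, and nothing is asked of \<open>h2\<close> at the
  singular point \<open>0\<close>.\<close>

locale radial_profile =
  fixes m :: nat and h0 h1 h2 :: "real \<Rightarrow> real" and C :: real
  assumes m: "m \<ge> 1"
    and continuous_h: "continuous_on UNIV h0" "continuous_on UNIV h1"
    and measurable_h2: "h2 \<in> borel_measurable borel"
    and deriv_h: "\<And>s. s > 0 \<Longrightarrow> (h0 has_real_derivative h1 s) (at s)"
      "\<And>s. s > 0 \<Longrightarrow> (h1 has_real_derivative h2 s) (at s)"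
    and bound_h: "\<And>s. s \<ge> 0 \<Longrightarrow> \<bar>h0 s\<bar> \<le> C * exp (- s / 8)"
      "\<And>s. s \<ge> 0 \<Longrightarrow> \<bar>h1 s\<bar> \<le> C * exp (- s / 8)"
      "\<And>s. s \<ge> 0 \<Longrightarrow> s * \<bar>h2 s\<bar> \<le> C * exp (- s / 8)"
begin

lemma C_nonneg: "C \<ge> 0" using bound_h(1)[of 0] by simp

lemma wave_line_deriv:
  assumes "x \<noteq> 0"
  shows "((\<lambda>t. wave m h0 (x + t *\<^sub>R b)) has_vector_derivative wave1 m h0 h1 b x) (at 0)"
    and "((\<lambda>t. wave1 m h0 h1 b (x + t *\<^sub>R c)) has_vector_derivative wave2 m h0 h1 h2 b c x) (at 0)"
proof -
  have s: "x \<bullet> x > 0" using assms by simp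
  note r0 = radial_line_deriv[OF deriv_h(1)[OF s]] and r1 = radial_line_deriv[OF deriv_h(2)[OF s]]
  show "((\<lambda>t. wave m h0 (x + t *\<^sub>R b)) has_vector_derivative wave1 m h0 h1 b x) (at 0)"
    using weighted_power_line_deriv[of "\<lambda>x. h0 (x \<bullet> x)", OF r0, of b m]
    unfolding wave_def wave1_def by (simp add: mult_ac)
  have "((\<lambda>t. 2 * ((x + t *\<^sub>R c) \<bullet> b)) has_real_derivative 2 * (c \<bullet> b)) (at 0)"
    by (auto intro!: derivative_eq_intros simp: inner_add_left)
  from DERIV_mult[OF this r1[of c]]
  have k: "((\<lambda>t. 2 * ((x + t *\<^sub>R c) \<bullet> b) * h1 ((x + t *\<^sub>R c) \<bullet> (x + t *\<^sub>R c))) has_real_derivative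
      2 * (c \<bullet> b) * h1 (x \<bullet> x) + 4 * (x \<bullet> b) * (x \<bullet> c) * h2 (x \<bullet> x)) (at 0)"
    by (simp add: mult_ac)
  note t1 = weighted_power_line_deriv[of "\<lambda>x. 2 * (x \<bullet> b) * h1 (x \<bullet> x)", OF k, of m]
  note t2 = has_vector_derivative_mult_left[OF weighted_power_line_deriv[of "\<lambda>x. h0 (x \<bullet> x)", OF r0, of c "m - 1"], of "of_nat m * planar b"]
  from has_vector_derivative_add[OF t1 t2]
  show "((\<lambda>t. wave1 m h0 h1 b (x + t *\<^sub>R c)) has_vector_derivative wave2 m h0 h1 h2 b c x) (at 0)"
    unfolding wave1_def wave2_def by (simp add: mult_ac add.assoc)
qed

lemma wave_measurable:
  "wave m h0 \<in> borel_measurable lborel" "wave1 m h0 h1 b \<in> borel_measurable lborel" "wave2 m h0 h1 h2 b c \<in> borel_measurable lborel"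
proof -
  have [measurable]: "h0 \<in> borel_measurable borel" "h1 \<in> borel_measurable borel" "h2 \<in> borel_measurable borel"
    using continuous_h measurable_h2 by (auto intro: borel_measurable_continuous_onI)
  have [measurable]: "planar \<in> borel_measurable borel"
    by (intro borel_measurable_continuous_onI continuous_intros)
  show "wave m h0 \<in> borel_measurable lborel" "wave1 m h0 h1 b \<in> borel_measurable lborel" "wave2 m h0 h1 h2 b c \<in> borel_measurable lborel"
    unfolding wave_def[abs_def] wave1_def[abs_def] wave2_def[abs_def] by measurable
qed

lemma wave_bounds:
  fixes x :: plane
  defines "G \<equiv> C * wave_const m * exp (- (x \<bullet> x) / 16)"
  shows "norm (wave m h0 x) \<le> G" "norm ((norm x)\<^sup>2 *\<^sub>R wave m h0 x) \<le> G"
    and "b \<in> Basis \<Longrightarrow> norm (wave1 m h0 h1 b x) \<le> G"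
    and "b \<in> Basis \<Longrightarrow> c \<in> Basis \<Longrightarrow> norm (wave2 m h0 h1 h2 b c x) \<le> G"
proof -
  define r where "r = norm x"
  define S where "S = (\<Sum>k\<le>m + 2. (16 * (real k + 1)) ^ k)"
  define A where "A = C * (S * exp (- r\<^sup>2 / 16))"
  define M where "M = real m"
  define E where "E = C * exp (- r\<^sup>2 / 8)"
  have r0: "r \<ge> 0" by (simp add: r_def)
  have xx: "x \<bullet> x = r\<^sup>2" by (simp add: r_def power2_norm_eq_inner)
  have M1: "M \<ge> 1" using m by (simp add: M_def)
  have E0: "E \<ge> 0" using C_nonneg by (simp add: E_def)
  have Sk: "(16 * (real k + 1)) ^ k \<le> S" if "k \<le> m + 2" for k
    unfolding S_def by (rule member_le_sum) (use that in auto)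
  have pw: "E * r ^ k \<le> A" if "k \<le> m + 2" for k
  proof -
    have "E * r ^ k = C * (r ^ k * exp (- r\<^sup>2 / 8))" by (simp add: E_def)
    also have "\<dots> \<le> C * (S * exp (- r\<^sup>2 / 16))"
      using C_nonneg gaussian_absorbs_power[OF r0, of k] Sk[OF that]
      by (intro mult_left_mono order_trans[OF gaussian_absorbs_power[OF r0, of k]] mult_right_mono) auto
    finally show ?thesis by (simp add: A_def)
  qed
  have A0: "A \<ge> 0" using pw[of 0] E0 by simp
  have G: "G = A * (6 + 4 * M + M\<^sup>2)" by (simp add: G_def A_def wave_const_def S_def M_def xx)
  have GA: "k * A \<le> G" if "k \<le> 6 + 4 * M + M\<^sup>2" for k
    unfolding G using A0 that by (simp add: mult.commute mult_left_mono)
  have h: "\<bar>h0 (x \<bullet> x)\<bar> \<le> E" "\<bar>h1 (x \<bullet> x)\<bar> \<le> E" "r\<^sup>2 * \<bar>h2 (x \<bullet> x)\<bar> \<le> E"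
    using bound_h[of "r\<^sup>2"] by (simp_all add: xx E_def)
  have z: "norm (planar x ^ k) = r ^ k" for k by (simp add: norm_power norm_planar r_def)
  have ip: "\<bar>x \<bullet> b\<bar> \<le> r" "norm (planar b) = 1" if "b \<in> Basis" for b
    using Basis_le_norm[OF that, of x] that by (simp_all add: r_def norm_planar)
  have w: "norm (wave m h0 x) \<le> E * r ^ m"
    unfolding wave_def norm_mult z using h(1) r0 by (simp add: mult_right_mono)
  also have "\<dots> \<le> A" by (rule pw) simp
  finally show "norm (wave m h0 x) \<le> G" using GA[of 1] M1 by (simp add: add_nonneg_nonneg)
  have "norm ((norm x)\<^sup>2 *\<^sub>R wave m h0 x) \<le> r\<^sup>2 * (E * r ^ m)"
    using w by (simp add: r_def mult_left_mono)
  also have "\<dots> = E * r ^ (m + 2)" by (simp add: power2_eq_square mult_ac)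
  also have "\<dots> \<le> A" by (rule pw) simp
  finally show "norm ((norm x)\<^sup>2 *\<^sub>R wave m h0 x) \<le> G" using GA[of 1] M1 by (simp add: add_nonneg_nonneg)
  have rm: "r * r ^ (m - 1) = r ^ m" using m by (cases m) auto
  have T1: "norm (of_real (2 * (x \<bullet> b) * h1 (x \<bullet> x)) * planar x ^ k :: complex) \<le> 2 * (E * (r * r ^ k))" if "b \<in> Basis" for b k
  proof -
    have "\<bar>x \<bullet> b\<bar> * \<bar>h1 (x \<bullet> x)\<bar> \<le> r * E" using ip(1)[OF that] h(2) r0 by (intro mult_mono) auto
    then have "(\<bar>x \<bullet> b\<bar> * \<bar>h1 (x \<bullet> x)\<bar>) * r ^ k \<le> (r * E) * r ^ k" using r0 by (intro mult_right_mono) auto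
    then show ?thesis by (simp add: norm_mult z abs_mult mult_ac)
  qed
  have T0: "norm (of_real (h0 (x \<bullet> x)) * planar x ^ k :: complex) \<le> E * r ^ k" for k
    unfolding norm_mult z using h(1) r0 by (simp add: mult_right_mono)
  show "norm (wave1 m h0 h1 b x) \<le> G" if b: "b \<in> Basis"
  proof -
    have "norm (wave1 m h0 h1 b x) \<le> 2 * (E * (r * r ^ m)) + E * r ^ (m - 1) * M"
      unfolding wave1_def
      by (rule order_trans[OF norm_triangle_ineq add_mono[OF T1[OF b]]])
         (use T0[of "m - 1"] ip(2)[OF b] M1 in \<open>simp add: norm_mult M_def mult_right_mono\<close>)
    also have "\<dots> \<le> 2 * A + A * M"
      using pw[of "m + 1"] pw[of "m - 1"] M1 by (intro add_mono mult_right_mono) auto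
    also have "\<dots> = (2 + M) * A" by (simp add: algebra_simps)
    also have "\<dots> \<le> G" using M1 by (intro GA) simp
    finally show ?thesis .
  qed
  show "norm (wave2 m h0 h1 h2 b c x) \<le> G" if b: "b \<in> Basis" and c: "c \<in> Basis"
  proof -
    have cb: "\<bar>c \<bullet> b\<bar> \<le> 1" using b c by (simp add: inner_Basis)
    have bc: "\<bar>x \<bullet> b\<bar> * \<bar>x \<bullet> c\<bar> \<le> r * r" using ip(1)[OF b] ip(1)[OF c] r0 by (intro mult_mono) auto
    have "\<bar>2 * (c \<bullet> b) * h1 (x \<bullet> x) + 4 * (x \<bullet> b) * (x \<bullet> c) * h2 (x \<bullet> x)\<bar> \<le> 6 * E"
    proof -
      have "\<bar>c \<bullet> b\<bar> * \<bar>h1 (x \<bullet> x)\<bar> \<le> 1 * E" using cb h(2) by (intro mult_mono) auto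
      moreover have "(\<bar>x \<bullet> b\<bar> * \<bar>x \<bullet> c\<bar>) * \<bar>h2 (x \<bullet> x)\<bar> \<le> (r * r) * \<bar>h2 (x \<bullet> x)\<bar>" using bc by (intro mult_right_mono) auto
      moreover have "(r * r) * \<bar>h2 (x \<bullet> x)\<bar> \<le> E" using h(3) by (simp add: power2_eq_square)
      moreover have "\<bar>2 * (c \<bullet> b) * h1 (x \<bullet> x)\<bar> = 2 * (\<bar>c \<bullet> b\<bar> * \<bar>h1 (x \<bullet> x)\<bar>)"
        "\<bar>4 * (x \<bullet> b) * (x \<bullet> c) * h2 (x \<bullet> x)\<bar> = 4 * ((\<bar>x \<bullet> b\<bar> * \<bar>x \<bullet> c\<bar>) * \<bar>h2 (x \<bullet> x)\<bar>)"
        by (simp_all add: abs_mult)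
      ultimately show ?thesis
        using abs_triangle_ineq[of "2 * (c \<bullet> b) * h1 (x \<bullet> x)" "4 * (x \<bullet> b) * (x \<bullet> c) * h2 (x \<bullet> x)"] by linarith
    qed
    then have a1: "norm (of_real (2 * (c \<bullet> b) * h1 (x \<bullet> x) + 4 * (x \<bullet> b) * (x \<bullet> c) * h2 (x \<bullet> x)) * planar x ^ m :: complex) \<le> 6 * E * r ^ m"
      unfolding norm_mult z norm_of_real using r0 by (intro mult_right_mono) auto
    have a2: "norm (of_real (2 * (x \<bullet> b) * h1 (x \<bullet> x)) * (of_nat m * planar x ^ (m - 1) * planar c) :: complex) \<le> 2 * (E * r ^ m) * M"
    proof -
      have "norm (of_real (2 * (x \<bullet> b) * h1 (x \<bullet> x)) * (of_nat m * planar x ^ (m - 1) * planar c) :: complex)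
         = norm (of_real (2 * (x \<bullet> b) * h1 (x \<bullet> x)) * planar x ^ (m - 1) :: complex) * M"
        using ip(2)[OF c] by (simp add: norm_mult M_def)
      also have "\<dots> \<le> 2 * (E * r ^ m) * M" using T1[OF b, of "m - 1"] M1 unfolding rm by (intro mult_right_mono) auto
      finally show ?thesis .
    qed
    have a3: "norm ((of_real (2 * (x \<bullet> c) * h1 (x \<bullet> x)) * planar x ^ (m - 1)
        + of_real (h0 (x \<bullet> x)) * (of_nat (m - 1) * planar x ^ (m - 1 - 1) * planar c)) * (of_nat m * planar b)) \<le> (2 * (E * r ^ m) + E * r ^ (m - 1 - 1) * M) * M"
    proof -
      have "norm (of_real (h0 (x \<bullet> x)) * (of_nat (m - 1) * planar x ^ (m - 1 - 1) * planar c))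
         = norm (of_real (h0 (x \<bullet> x)) * planar x ^ (m - 1 - 1) :: complex) * real (m - 1)"
        using ip(2)[OF c] by (simp add: norm_mult)
      also have "\<dots> \<le> E * r ^ (m - 1 - 1) * M" using T0[of "m - 1 - 1"] E0 r0 by (intro mult_mono) (auto simp: M_def)
      finally have "norm (of_real (h0 (x \<bullet> x)) * (of_nat (m - 1) * planar x ^ (m - 1 - 1) * planar c)) \<le> E * r ^ (m - 1 - 1) * M" .
      moreover have "norm (of_real (2 * (x \<bullet> c) * h1 (x \<bullet> x)) * planar x ^ (m - 1) :: complex) \<le> 2 * (E * r ^ m)"
        using T1[OF c, of "m - 1"] unfolding rm .
      ultimately have "norm (of_real (2 * (x \<bullet> c) * h1 (x \<bullet> x)) * planar x ^ (m - 1)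
        + of_real (h0 (x \<bullet> x)) * (of_nat (m - 1) * planar x ^ (m - 1 - 1) * planar c)) \<le> 2 * (E * r ^ m) + E * r ^ (m - 1 - 1) * M"
        by (rule order_trans[OF norm_triangle_ineq add_mono[rotated]])
      moreover have "norm (of_nat m * planar b) = M" using ip(2)[OF b] by (simp add: norm_mult M_def)
      ultimately show ?thesis unfolding norm_mult[of _ "of_nat m * planar b"] using M1 by (simp add: mult_right_mono)
    qed
    have "norm (wave2 m h0 h1 h2 b c x) \<le> 6 * E * r ^ m + 2 * (E * r ^ m) * M + (2 * (E * r ^ m) + E * r ^ (m - 1 - 1) * M) * M"
      unfolding wave2_def by (intro order_trans[OF norm_triangle_ineq] add_mono a1 a2 a3)
    also have "\<dots> \<le> 6 * A + 2 * A * M + (2 * A + A * M) * M"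
      using pw[of m] pw[of "m - 1 - 1"] M1 by (intro add_mono mult_right_mono) auto
    also have "\<dots> = G" by (simp add: G algebra_simps power2_eq_square)
    finally show ?thesis .
  qed
qed

lemma wave_jet: "jet (wave m h0) (wave1 m h0 h1) (wave2 m h0 h1 h2)"
proof -
  have L0: "wave m h0 \<in> L2"
    by (rule L2_gaussian_bound[OF wave_measurable(1) AE_I2]) (rule wave_bounds(1))
  have [measurable]: "wave m h0 \<in> borel_measurable borel" using wave_measurable(1) by simp
  have "(\<lambda>x. (norm x)\<^sup>2 *\<^sub>R wave m h0 x) \<in> borel_measurable lborel" by measurable
  then have Lr: "(\<lambda>x. (norm x)\<^sup>2 *\<^sub>R wave m h0 x) \<in> L2"
    by (rule L2_gaussian_bound[OF _ AE_I2]) (rule wave_bounds(2))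
  have L1: "wave1 m h0 h1 b \<in> L2" if "b \<in> Basis" for b
    by (rule L2_gaussian_bound[OF wave_measurable(2) AE_I2]) (rule wave_bounds(3)[OF that])
  have L2: "wave2 m h0 h1 h2 b c \<in> L2" if "b \<in> Basis" "c \<in> Basis" for b c
    by (rule L2_gaussian_bound[OF wave_measurable(3) AE_I2]) (rule wave_bounds(4)[OF that])
  show ?thesis
    unfolding jet_def
    by (intro conjI ballI Lr has_weak_deriv_if_off_origin[OF _ L0 L1] has_weak_deriv_if_off_origin[OF _ L1 L2] wave_line_deriv)
qed

text \<open>The Laplacian of \<open>h0(s) z^m\<close>: since \<open>z^m\<close> is harmonic
  (\<open>1^2 + i^2 = 0\<close>), the term with \<open>h0\<close> drops out, and the cross term
  \<open>2 grad h0 . grad z^m\<close> contributes \<open>4 m h1 z^m\<close>.\<close>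

lemma sum_wave2: "(\<Sum>b\<in>Basis. wave2 m h0 h1 h2 b b x) = of_real (4 * ((x \<bullet> x) * h2 (x \<bullet> x) + (real m + 1) * h1 (x \<bullet> x))) * planar x ^ m"
proof -
  obtain x1 x2 where x: "x = (x1, x2)" by (cases x)
  define s where "s = x \<bullet> x"
  have s: "s = x1 * x1 + x2 * x2" by (simp add: s_def x)
  define z where "z = planar x"
  have z: "z = of_real x1 + \<i> * of_real x2" by (simp add: z_def planar_def x Complex_eq)
  have zm: "z ^ m = z * z ^ (m - 1)" using m by (cases m) auto
  have b: "planar (1, 0) = 1" "planar (0, 1) = \<i>" by (auto simp: planar_def complex_eq_iff)
  have "(\<Sum>b\<in>Basis. wave2 m h0 h1 h2 b b x) = wave2 m h0 h1 h2 (1, 0) (1, 0) x + wave2 m h0 h1 h2 (0, 1) (0, 1) x"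
    by (simp add: plane_Basis)
  also have "\<dots> = of_real (4 * h1 s + 4 * s * h2 s) * z ^ m + 4 * of_real (h1 s) * of_nat m * ((of_real x1 + \<i> * of_real x2) * z ^ (m - 1))"
    unfolding wave2_def s_def[symmetric] z_def[symmetric] b by (simp add: x s algebra_simps)
  also have "(of_real x1 + \<i> * of_real x2) * z ^ (m - 1) = z ^ m" using zm z by simp
  finally show ?thesis unfolding s_def[symmetric] z_def[symmetric] by (simp add: algebra_simps)
qed

end

subsection \<open>The branch in X\<close>

definition radial0 :: "nat \<Rightarrow> real \<times> real \<Rightarrow> real \<Rightarrow> real" where
  "radial0 m p s = fst p * profile m p s"

definition radial1 :: "nat \<Rightarrow> real \<times> real \<Rightarrow> real \<Rightarrow> real" where
  "radial1 m p s = fst p * slope m p s"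

definition radial2 :: "nat \<Rightarrow> real \<times> real \<Rightarrow> real \<Rightarrow> real" where
  "radial2 m p s = fst p * ((force m p s - (real m + 1) * slope m p s) / s)"

definition branch_fun :: "nat \<Rightarrow> real \<times> real \<Rightarrow> plane \<Rightarrow> complex" where
  "branch_fun m p = wave m (radial0 m p)"

definition branch_fun1 :: "nat \<Rightarrow> real \<times> real \<Rightarrow> plane \<Rightarrow> plane \<Rightarrow> complex" where
  "branch_fun1 m p = wave1 m (radial0 m p) (radial1 m p)"

definition branch_fun2 :: "nat \<Rightarrow> real \<times> real \<Rightarrow> plane \<Rightarrow> plane \<Rightarrow> plane \<Rightarrow> complex" where
  "branch_fun2 m p = wave2 m (radial0 m p) (radial1 m p) (radial2 m p)"

context positive_degree
begin

text \<open>One constant serves all of \<open>K\<close>. Its factor \<open>m + 2\<close> stems from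
  \<open>s H'' = f - (m + 1) H'\<close>.\<close>

lemma decaying_radial_profile:
  assumes K: "compact K" "K \<subseteq> decaying"
  obtains C where "\<And>p. p \<in> K \<Longrightarrow> radial_profile m (radial0 m p) (radial1 m p) (radial2 m p) C"
proof -
  have "bounded (fst ` K)" using K(1) by (intro compact_imp_bounded compact_continuous_image continuous_intros)
  then obtain A0 where A0: "\<And>p. p \<in> K \<Longrightarrow> \<bar>fst p\<bar> \<le> A0" unfolding bounded_iff by auto
  define A where "A = max A0 0"
  have A: "A \<ge> 0" "\<And>p. p \<in> K \<Longrightarrow> \<bar>fst p\<bar> \<le> A" using A0 by (auto simp: A_def le_max_iff_disj)
  obtain C where C: "C > 0"
    "\<And>p s. p \<in> K \<Longrightarrow> s \<ge> 0 \<Longrightarrow> \<bar>profile m p s\<bar> \<le> C * exp (- s / 8)"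
    "\<And>p s. p \<in> K \<Longrightarrow> s \<ge> 0 \<Longrightarrow> \<bar>slope m p s\<bar> \<le> C * exp (- s / 8)"
    "\<And>p s. p \<in> K \<Longrightarrow> s \<ge> 0 \<Longrightarrow> \<bar>force m p s\<bar> \<le> C * exp (- s / 8)"
    by (rule decaying_uniform_bound[OF K]) blast
  define B where "B = A * ((real m + 2) * C)"
  show ?thesis
  proof (rule that[of B], unfold_locales)
    fix p assume p: "p \<in> K"
    show "1 \<le> m" by (fact m)
    show "continuous_on UNIV (radial0 m p)" "continuous_on UNIV (radial1 m p)"
      unfolding radial0_def radial1_def
      by (intro continuous_intros continuous_profile_slice continuous_slope_slice)+
    have "slope m p \<in> borel_measurable borel" "force m p \<in> borel_measurable borel"
      by (intro borel_measurable_continuous_onI continuous_slope_slice continuous_force_slice)+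
    then show "radial2 m p \<in> borel_measurable borel" unfolding radial2_def[abs_def] by measurable
    fix s :: real
    show "(radial0 m p has_real_derivative radial1 m p s) (at s)" "(radial1 m p has_real_derivative radial2 m p s) (at s)" if "s > 0"
      unfolding radial0_def[abs_def] radial1_def[abs_def] radial2_def by (intro DERIV_cmult profile_deriv[OF m that])+
    assume s: "s \<ge> 0"
    have scale: "\<bar>fst p * v\<bar> \<le> B * exp (- s / 8)" if "\<bar>v\<bar> \<le> (real m + 2) * (C * exp (- s / 8))" for v
    proof -
      have "\<bar>fst p\<bar> * \<bar>v\<bar> \<le> A * ((real m + 2) * (C * exp (- s / 8)))"
        using A(2)[OF p] that A(1) by (intro mult_mono) auto
      then show ?thesis by (simp add: B_def abs_mult mult_ac)
    qed
    define e where "e = C * exp (- s / 8)"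
    have e: "e \<ge> 0" using C(1) by (simp add: e_def)
    have le: "e \<le> (real m + 2) * e" using e by (simp add: distrib_right)
    show "\<bar>radial0 m p s\<bar> \<le> B * exp (- s / 8)" unfolding radial0_def
      by (rule scale) (use C(2)[OF p s] le in \<open>simp add: e_def\<close>)
    show "\<bar>radial1 m p s\<bar> \<le> B * exp (- s / 8)" unfolding radial1_def
      by (rule scale) (use C(3)[OF p s] le in \<open>simp add: e_def\<close>)
    show "s * \<bar>radial2 m p s\<bar> \<le> B * exp (- s / 8)"
    proof (cases "s = 0")
      case True then show ?thesis using A(1) C(1) by (simp add: B_def)
    next
      case False
      have "\<bar>force m p s - (real m + 1) * slope m p s\<bar> \<le> \<bar>force m p s\<bar> + (real m + 1) * \<bar>slope m p s\<bar>"
        using abs_triangle_ineq4[of "force m p s" "(real m + 1) * slope m p s"] by (simp add: abs_mult)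
      also have "\<dots> \<le> e + (real m + 1) * e"
        using C(3,4)[OF p s] unfolding e_def by (intro add_mono mult_left_mono) auto
      also have "\<dots> = (real m + 2) * e" by (simp add: algebra_simps)
      finally have "\<bar>fst p * (force m p s - (real m + 1) * slope m p s)\<bar> \<le> B * exp (- s / 8)"
        by (intro scale) (simp add: e_def)
      moreover have "s * \<bar>radial2 m p s\<bar> = \<bar>fst p * (force m p s - (real m + 1) * slope m p s)\<bar>"
        using s False by (simp add: radial2_def abs_mult)
      ultimately show ?thesis by simp
    qed
  qed
qed

lemma branch_jet:
  assumes p: "p \<in> decaying"
  shows "jet (branch_fun m p) (branch_fun1 m p) (branch_fun2 m p)"
proof -
  obtain C where "\<And>q. q \<in> {p} \<Longrightarrow> radial_profile m (radial0 m q) (radial1 m q) (radial2 m q) C"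
    by (rule decaying_radial_profile[of "{p}"]) (use p in auto)
  then interpret radial_profile m "radial0 m p" "radial1 m p" "radial2 m p" C by simp
  show ?thesis unfolding branch_fun_def branch_fun1_def branch_fun2_def by (rule wave_jet)
qed

lemma branch_X_rel: "p \<in> decaying \<Longrightarrow> X_rel (branch_fun m p) (branch_fun m p)"
  using jet_X_fun(1)[OF branch_jet] by (simp add: X_rel_def)

lemma branch_stationary:
  assumes p: "p \<in> decaying"
  shows "stationary_GP (branch_fun m p) (snd p)"
proof -
  obtain C where "\<And>q. q \<in> {p} \<Longrightarrow> radial_profile m (radial0 m q) (radial1 m q) (radial2 m q) C"
    by (rule decaying_radial_profile[of "{p}"]) (use p in auto)
  then interpret radial_profile m "radial0 m p" "radial1 m p" "radial2 m p" C by simp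
  have "AE x in lborel. \<forall>b\<in>Basis. weak_deriv b (weak_deriv b (branch_fun m p)) x = branch_fun2 m p b b x"
    by (intro AE_finite_allI finite_Basis jet_weak_derivs(3)[OF branch_jet[OF p]])
  moreover have "AE x::plane in lborel. x \<noteq> 0" by (rule AE_lborel_singleton)
  ultimately show ?thesis
    unfolding stationary_GP_def
  proof eventually_elim
    case (elim x)
    define s where "s = x \<bullet> x"
    define h where "h = profile m p s"
    have s: "s > 0" using elim(2) by (simp add: s_def)
    have "laplacian (branch_fun m p) x = (\<Sum>b\<in>Basis. branch_fun2 m p b b x)"
      unfolding laplacian_def using elim(1) by (intro sum.cong) auto
    also have "\<dots> = of_real (4 * (s * radial2 m p s + (real m + 1) * radial1 m p s)) * planar x ^ m"
      unfolding branch_fun2_def s_def by (rule sum_wave2)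
    also have "4 * (s * radial2 m p s + (real m + 1) * radial1 m p s) = 4 * fst p * force m p s"
      using s by (simp add: radial2_def radial1_def field_simps)
    \<comment> \<open>By the maximum principle the minimum in \<open>potential\<close> is attained
      by its first argument, so the truncated equation is the true one.\<close>
    also have "force m p s = (s - snd p + (fst p)\<^sup>2 * s ^ m * h\<^sup>2) * h / 4"
    proof -
      have "(fst p)\<^sup>2 * \<bar>s\<bar> ^ m * h\<^sup>2 \<le> max (snd p) 0"
        using decaying_maximum_principle[OF p, of s] s by (simp add: h_def)
      then show ?thesis using s by (simp add: force_def rhs_def potential_def h_def)
    qed
    finally have lap: "laplacian (branch_fun m p) x = of_real (fst p * (s - snd p + (fst p)\<^sup>2 * s ^ m * h\<^sup>2) * h) * planar x ^ m"
      by simp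
    have u: "branch_fun m p x = of_real (fst p * h) * planar x ^ m"
      by (simp add: branch_fun_def wave_def radial0_def h_def s_def)
    have nx: "(norm x)\<^sup>2 = s" by (simp add: s_def power2_norm_eq_inner)
    have "(norm (planar x ^ m))\<^sup>2 = s ^ m"
      by (simp add: norm_power norm_planar power_mult[symmetric] mult.commute[of m]) (simp add: power_mult nx)
    then have "(norm (branch_fun m p x))\<^sup>2 = (fst p)\<^sup>2 * s ^ m * h\<^sup>2"
      unfolding u norm_mult norm_of_real power_mult_distrib power2_abs by (simp add: mult_ac)
    then show ?case unfolding lap nx by (simp add: u algebra_simps)
  qed
qed

lemma branch_angular: "angular_form m (branch_fun m p)"
proof -
  have "branch_fun m p x = exp (\<i> * of_nat m * of_real \<theta>) * of_real (radial0 m p (r\<^sup>2) * r ^ m)"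
    if x: "x = (r * cos \<theta>, r * sin \<theta>)" for x r \<theta>
  proof -
    have "x \<bullet> x = r\<^sup>2"
    proof -
      have "x \<bullet> x = (r * cos \<theta>)\<^sup>2 + (r * sin \<theta>)\<^sup>2" by (simp add: x power2_eq_square)
      also have "\<dots> = r\<^sup>2 * ((cos \<theta>)\<^sup>2 + (sin \<theta>)\<^sup>2)" by (simp only: power_mult_distrib distrib_left)
      finally show ?thesis by simp
    qed
    moreover have "planar x = of_real r * exp (\<i> * of_real \<theta>)"
      by (simp add: planar_def x complex_eq_iff exp_Euler cos_of_real sin_of_real)
    then have "planar x ^ m = of_real (r ^ m) * exp (of_nat m * (\<i> * of_real \<theta>))"
      by (simp add: power_mult_distrib exp_of_nat_mult)
    ultimately show ?thesis by (simp add: branch_fun_def wave_def mult_ac)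
  qed
  then show ?thesis unfolding angular_form_def by (intro exI[of _ "\<lambda>r. radial0 m p (r\<^sup>2) * r ^ m"]) simp
qed

text \<open>Elements of \<open>X\<close> are classes, so a nonzero value at one point is not enough:
  by continuity the function is nonzero on a nonempty open set, which is not null. The test point
  lies near but not at the origin, where \<open>z^m\<close> vanishes.\<close>

lemma branch_nonzero:
  assumes p: "p \<in> decaying" and a: "fst p \<noteq> 0"
  shows "abs_X (branch_fun m p) \<noteq> 0"
proof
  assume "abs_X (branch_fun m p) = 0"
  then have "abs_X (branch_fun m p) = abs_X (\<lambda>x. 0)" by (simp add: zero_X_def)
  then have "X_rel (branch_fun m p) (\<lambda>x. 0)"
    using Quotient3_rel[OF Quotient3_X, of "branch_fun m p" "\<lambda>x. 0"] branch_X_rel[OF p] X_fun_zero by (auto simp: X_rel_def)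
  then have ae: "AE x in lborel. branch_fun m p x = 0" by (simp add: X_rel_def)
  have c: "continuous_on UNIV (branch_fun m p)"
    unfolding branch_fun_def wave_def[abs_def] radial0_def
    by (intro continuous_intros continuous_on_compose2[OF continuous_profile_slice[of UNIV]]) auto
  define S where "S = {x. branch_fun m p x \<noteq> 0}"
  have "open S" unfolding S_def by (intro open_Collect_neq c continuous_intros)
  moreover have "S \<noteq> {}"
  proof -
    have "isCont (profile m p) 0"
      using continuous_profile_slice[of UNIV p] by (simp add: continuous_on_eq_continuous_at)
    then have "(profile m p \<longlongrightarrow> 1) (at 0)" by (simp add: isCont_def profile_0[OF m])
    then have "\<forall>\<^sub>F s in at 0. profile m p s > 0" by (rule order_tendstoD(1)) simp
    then obtain d where d: "d > 0" "\<And>s. s \<noteq> 0 \<Longrightarrow> dist s 0 < d \<Longrightarrow> profile m p s > 0"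
      unfolding eventually_at by auto
    have "profile m p (d / 2) > 0" using d by simp
    then have "profile m p (d / 2) \<noteq> 0" by simp
    then have "branch_fun m p (sqrt (d / 2), 0) \<noteq> 0"
      using d(1) a by (simp add: branch_fun_def wave_def radial0_def planar_def complex_eq_iff)
    then show ?thesis by (auto simp: S_def)
  qed
  ultimately have "\<not> negligible S" by (rule open_not_negligible)
  moreover have "negligible S"
  proof -
    have "S \<in> null_sets lborel" using AE_iff_null_sets[of S lborel] ae \<open>open S\<close> by (simp add: S_def)
    then show ?thesis by (simp add: negligible_iff_null_sets null_sets_completionI)
  qed
  ultimately show False by simp
qed

section \<open>Continuity of the branch in the norm of \<open>X\<close>\<close>

lemma tendsto_param:
  fixes f :: "real \<times> real \<Rightarrow> real \<Rightarrow> real"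
  assumes "continuous_on UNIV (\<lambda>x. f (fst x) (snd x))" "P \<longlonglongrightarrow> p"
  shows "(\<lambda>k. f (P k) s) \<longlonglongrightarrow> f p s"
proof -
  have "(\<lambda>k. (P k, s)) \<longlonglongrightarrow> (p, s)" by (rule tendsto_Pair[OF assms(2) tendsto_const])
  from continuous_on_tendsto_compose[OF assms(1) this] show ?thesis by simp
qed

lemma branch_pointwise:
  assumes P: "P \<longlonglongrightarrow> p"
  shows "(\<lambda>k. branch_fun m (P k) x) \<longlonglongrightarrow> branch_fun m p x"
    and "(\<lambda>k. branch_fun1 m (P k) b x) \<longlonglongrightarrow> branch_fun1 m p b x"
    and "x \<noteq> 0 \<Longrightarrow> (\<lambda>k. branch_fun2 m (P k) b c x) \<longlonglongrightarrow> branch_fun2 m p b c x"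
proof -
  have f: "(\<lambda>k. fst (P k)) \<longlonglongrightarrow> fst p" using P by (rule tendsto_fst)
  have r: "(\<lambda>k. radial0 m (P k) s) \<longlonglongrightarrow> radial0 m p s" "(\<lambda>k. radial1 m (P k) s) \<longlonglongrightarrow> radial1 m p s" for s
    unfolding radial0_def radial1_def
    by (intro tendsto_mult f tendsto_param[OF continuous_profile[OF m] P] tendsto_param[OF continuous_slope[OF m] P])+
  have r2: "(\<lambda>k. radial2 m (P k) s) \<longlonglongrightarrow> radial2 m p s" if "s \<noteq> 0" for s
    unfolding radial2_def
    by (intro tendsto_mult tendsto_divide tendsto_diff tendsto_const f that tendsto_param[OF continuous_force[OF m] P] tendsto_param[OF continuous_slope[OF m] P])
  show "(\<lambda>k. branch_fun m (P k) x) \<longlonglongrightarrow> branch_fun m p x" "(\<lambda>k. branch_fun1 m (P k) b x) \<longlonglongrightarrow> branch_fun1 m p b x"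
    unfolding branch_fun_def branch_fun1_def wave_def wave1_def by (intro tendsto_intros r)+
  show "(\<lambda>k. branch_fun2 m (P k) b c x) \<longlonglongrightarrow> branch_fun2 m p b c x" if "x \<noteq> 0"
    unfolding branch_fun2_def wave2_def by (intro tendsto_intros r r2) (use that in simp)
qed

text \<open>A convergent sequence together with its limit is a compact parameter set, so all its
  functions and derivatives share one Gaussian majorant. Pointwise convergence off the origin then
  gives convergence of each \<open>L2\<close> part of the norm.\<close>

lemma branch_continuous:
  shows "continuous_on (decaying) (\<lambda>p. abs_X (branch_fun m p))"
  unfolding continuous_on_sequentially
proof (intro allI ballI impI)
  fix P p
  assume p: "p \<in> decaying" and "(\<forall>n. P n \<in> decaying) \<and> P \<longlonglongrightarrow> p"
  then have P: "P n \<in> decaying" and lim: "P \<longlonglongrightarrow> p" for n by auto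
  have "compact (insert p (range P))" by (rule compact_sequence_with_limit[OF lim])
  then obtain C where C: "\<And>q. q \<in> insert p (range P) \<Longrightarrow> radial_profile m (radial0 m q) (radial1 m q) (radial2 m q) C"
    by (rule decaying_radial_profile) (use p P in auto)
  define B where "B = C * wave_const m"
  define G where "G x = exp (- (x \<bullet> x) / 16)" for x :: plane
  have bd: "norm (branch_fun m q x) \<le> B * G x" "norm ((norm x)\<^sup>2 *\<^sub>R branch_fun m q x) \<le> B * G x"
    "b \<in> Basis \<Longrightarrow> norm (branch_fun1 m q b x) \<le> B * G x"
    "b \<in> Basis \<Longrightarrow> c \<in> Basis \<Longrightarrow> norm (branch_fun2 m q b c x) \<le> B * G x"
    if "q \<in> insert p (range P)" for q x b c
    unfolding branch_fun_def branch_fun1_def branch_fun2_def B_def G_def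
    by (rule radial_profile.wave_bounds[OF C[OF that]]; assumption)+
  have meas: "branch_fun m q \<in> borel_measurable lborel" "branch_fun1 m q b \<in> borel_measurable lborel" "branch_fun2 m q b c \<in> borel_measurable lborel"
    if "q \<in> insert p (range P)" for q b c
    unfolding branch_fun_def branch_fun1_def branch_fun2_def by (rule radial_profile.wave_measurable[OF C[OF that]])+
  have step: "(\<lambda>k. (L2_norm (\<lambda>x. f (P k) x + (-1) *\<^sub>R f p x))\<^sup>2) \<longlonglongrightarrow> 0"
    if f_meas: "\<And>q. q \<in> insert p (range P) \<Longrightarrow> f q \<in> borel_measurable lborel"
      and f_bd: "\<And>q x. q \<in> insert p (range P) \<Longrightarrow> norm (f q x) \<le> B * G x"
      and f_lim: "\<And>x. x \<noteq> 0 \<Longrightarrow> (\<lambda>k. f (P k) x) \<longlonglongrightarrow> f p x"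
    for f :: "real \<times> real \<Rightarrow> plane \<Rightarrow> complex"
  proof (rule L2_norm_dominated_tendsto[where B="2 * B"])
    fix k
    have [measurable]: "f (P k) \<in> borel_measurable lborel" "f p \<in> borel_measurable lborel"
      by (rule f_meas, simp)+
    show "(\<lambda>x. f (P k) x + (-1) *\<^sub>R f p x) \<in> borel_measurable lborel" by measurable
    show "AE x in lborel. norm (f (P k) x + (-1) *\<^sub>R f p x) \<le> 2 * B * exp (- (x \<bullet> x) / 16)"
    proof (rule AE_I2)
      fix x
      show "norm (f (P k) x + (-1) *\<^sub>R f p x) \<le> 2 * B * exp (- (x \<bullet> x) / 16)"
        using norm_triangle_ineq4[of "f (P k) x" "f p x"] f_bd[of "P k" x] f_bd[of p x] by (simp add: G_def)
    qed
  next
    have "AE x::plane in lborel. x \<noteq> 0" by (rule AE_lborel_singleton)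
    then show "AE x in lborel. (\<lambda>k. f (P k) x + (-1) *\<^sub>R f p x) \<longlonglongrightarrow> 0"
    proof eventually_elim
      case (elim x)
      have "(\<lambda>k. f (P k) x + (-1) *\<^sub>R f p x) \<longlonglongrightarrow> f p x + (-1) *\<^sub>R f p x"
        by (intro tendsto_add f_lim elim tendsto_const)
      then show ?case by simp
    qed
  qed
  note bp = branch_pointwise[OF lim]
  have "(\<lambda>k. (dist (abs_X (branch_fun m (P k))) (abs_X (branch_fun m p)))\<^sup>2) \<longlonglongrightarrow> 0 + (\<Sum>b\<in>(Basis::plane set). 0) + (\<Sum>b\<in>(Basis::plane set). \<Sum>c\<in>(Basis::plane set). 0) + 0"
    unfolding dist_abs_X[OF branch_jet[OF P] branch_jet[OF p]]
  proof (intro tendsto_add tendsto_sum)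
    show "(\<lambda>k. (L2_norm (\<lambda>x. branch_fun m (P k) x + (-1) *\<^sub>R branch_fun m p x))\<^sup>2) \<longlonglongrightarrow> 0"
      by (rule step[where f = "branch_fun m"]) (rule meas(1) bd(1) bp(1); assumption?)+
    have "(\<lambda>k. (L2_norm (\<lambda>x. (norm x)\<^sup>2 *\<^sub>R branch_fun m (P k) x + (-1) *\<^sub>R ((norm x)\<^sup>2 *\<^sub>R branch_fun m p x)))\<^sup>2) \<longlonglongrightarrow> 0"
    proof (rule step[where f = "\<lambda>q x. (norm x)\<^sup>2 *\<^sub>R branch_fun m q x"])
      fix q assume q: "q \<in> insert p (range P)"
      have [measurable]: "branch_fun m q \<in> borel_measurable borel" using meas(1)[OF q] by simp
      show "(\<lambda>x. (norm x)\<^sup>2 *\<^sub>R branch_fun m q x) \<in> borel_measurable lborel" by measurable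
      show "norm ((norm x)\<^sup>2 *\<^sub>R branch_fun m q x) \<le> B * G x" for x by (rule bd(2)[OF q])
    qed (intro tendsto_scaleR tendsto_const bp)
    then show "(\<lambda>k. (L2_norm (\<lambda>x. (norm x)\<^sup>2 *\<^sub>R (branch_fun m (P k) x + (-1) *\<^sub>R branch_fun m p x)))\<^sup>2) \<longlonglongrightarrow> 0"
      unfolding scaleR_add_right scaleR_left_commute[of "(norm x)\<^sup>2" "-1" "v" for x v] .
    fix b :: plane assume b: "b \<in> Basis"
    show "(\<lambda>k. (L2_norm (\<lambda>x. branch_fun1 m (P k) b x + (-1) *\<^sub>R branch_fun1 m p b x))\<^sup>2) \<longlonglongrightarrow> 0"
      by (rule step[where f = "\<lambda>q. branch_fun1 m q b"]) (rule meas(2) bd(3) bp(2); (assumption | rule b)?)+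
    fix c :: plane assume c: "c \<in> Basis"
    show "(\<lambda>k. (L2_norm (\<lambda>x. branch_fun2 m (P k) b c x + (-1) *\<^sub>R branch_fun2 m p b c x))\<^sup>2) \<longlonglongrightarrow> 0"
      by (rule step[where f = "\<lambda>q. branch_fun2 m q b c"]) (rule meas(3) bd(4) bp(3); (assumption | rule b | rule c)?)+
  qed
  then have "(\<lambda>k. sqrt ((dist (abs_X (branch_fun m (P k))) (abs_X (branch_fun m p)))\<^sup>2)) \<longlonglongrightarrow> sqrt 0"
    by (intro tendsto_real_sqrt) simp
  then have "(\<lambda>k. dist (abs_X (branch_fun m (P k))) (abs_X (branch_fun m p))) \<longlonglongrightarrow> 0" by simp
  then show "((\<lambda>p. abs_X (branch_fun m p)) \<circ> P) \<longlonglongrightarrow> abs_X (branch_fun m p)"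
    unfolding o_def by (subst tendsto_dist_iff)
qed

end

theorem theorem1:
  fixes m0 n0 :: nat and \<omega>0 :: real
  assumes "m0 \<ge> 1" and "\<omega>0 = 2 * (real m0 + 2 * real n0 + 1)"
  shows "\<exists>C \<subseteq> solution_closure m0.
    connected C \<and> closedin (top_of_set (F_space m0 \<times> UNIV)) C \<and> (0, \<omega>0) \<in> C \<and>
    (\<not> bounded C \<or> (\<exists>\<omega>1. \<omega>1 \<noteq> \<omega>0 \<and> (0, \<omega>1) \<in> C))"
proof -
  interpret positive_degree m0 by unfold_locales (fact assms(1))
  obtain K where K: "K \<subseteq> decaying" "connected K" "(0, \<omega>0) \<in> K" "\<And>v. (0, v) \<in> K \<Longrightarrow> v = \<omega>0" "\<not> bounded (snd ` K)"
    by (rule bifurcation_curve[OF assms(2)]) blast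
  define \<Phi> where "\<Phi> p = (abs_X (branch_fun m0 p), snd p)" for p
  define T where "T = top_of_set (F_space m0 \<times> (UNIV :: real set))"
  define N where "N = {(u, \<omega>). u \<in> F_space m0 \<and> u \<noteq> 0 \<and> standing_wave u \<omega>}"
  \<comment> \<open>Taking the closure secures closedness, keeps connectedness and stays inside
    \<open>solution_closure\<close>, which is closed itself.\<close>
  define C where "C = T closure_of (\<Phi> ` K)"
  have contK: "continuous_on K \<Phi>"
    unfolding \<Phi>_def by (intro continuous_intros continuous_on_subset[OF branch_continuous K(1)])
  have inF: "\<Phi> p \<in> F_space m0 \<times> UNIV" if "p \<in> K" for p
    using has_angular_form.abs_eq[OF branch_X_rel[OF subsetD[OF K(1) that]], of m0] branch_angular[of p]
    by (simp add: \<Phi>_def F_space_def)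
  have inN: "\<Phi> p \<in> N" if p: "p \<in> K" "fst p \<noteq> 0" for p
  proof -
    note d = subsetD[OF K(1) p(1)]
    show ?thesis
      using inF[OF p(1)] branch_nonzero[OF d p(2)] standing_wave.abs_eq[OF branch_X_rel[OF d]] branch_stationary[OF d]
      by (simp add: \<Phi>_def N_def)
  qed
  have closure_eq: "T closure_of A = (F_space m0 \<times> UNIV) \<inter> closure A" if "A \<subseteq> F_space m0 \<times> UNIV" for A
    using that by (simp add: T_def closure_of_subtopology inf.absorb2)
  have Nsub: "N \<subseteq> F_space m0 \<times> UNIV" by (auto simp: N_def)
  have image_sub: "\<Phi> ` K \<subseteq> F_space m0 \<times> UNIV" using inF by blast
  have "\<Phi> p \<in> closure N" if p: "p \<in> K" for p
  proof (cases "fst p = 0")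
    case False then show ?thesis using inN[OF p] closure_subset by blast
  next
    case True
    \<comment> \<open>The trivial point \<open>(0, \<omega>0)\<close> is a limit of nontrivial
      solutions: a connected set with more than one point has no isolated point, and every other
      point of \<open>K\<close> has \<open>a \<noteq> 0\<close>.\<close>
    have "K \<noteq> {q}" for q using K(5) by auto
    then have "p islimpt K" using connected_imp_perfect[OF K(2) p] by blast
    then obtain f where f: "\<And>n. f n \<in> K - {p}" "f \<longlonglongrightarrow> p" unfolding islimpt_sequential by blast
    have "p = (0, \<omega>0)" using True p K(4)[of "snd p"] by (metis prod.collapse)
    then have "fst q \<noteq> 0" if "q \<in> K - {p}" for q using K(4)[of "snd q"] that by (metis DiffD1 DiffD2 insertI1 prod.collapse)
    then have "\<Phi> (f n) \<in> N" for n using inN f(1) by blast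
    moreover have "(\<lambda>n. \<Phi> (f n)) \<longlonglongrightarrow> \<Phi> p"
      by (rule continuous_on_tendsto_compose[OF contK f(2) p]) (use f(1) in auto)
    ultimately show ?thesis unfolding closure_sequential by (intro exI[of _ "\<lambda>n. \<Phi> (f n)"]) auto
  qed
  then have "\<Phi> ` K \<subseteq> T closure_of N" using image_sub unfolding closure_eq[OF Nsub] by blast
  then have "C \<subseteq> T closure_of N" unfolding C_def by (rule closure_of_minimal) simp
  then have "C \<subseteq> solution_closure m0" by (simp add: solution_closure_def T_def N_def)
  moreover have sub: "\<Phi> ` K \<subseteq> C" unfolding C_def closure_eq[OF image_sub] using image_sub closure_subset by blast
  moreover have "connected C"
    by (rule connected_intermediate_closure[OF connected_continuous_image[OF contK K(2)] sub])
       (simp add: C_def closure_eq[OF image_sub])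
  moreover have "closedin T C" by (simp add: C_def)
  moreover have "\<Phi> (0, \<omega>0) = (0, \<omega>0)"
  proof -
    have "branch_fun m0 (0, \<omega>0) = (\<lambda>x. 0)" by (simp add: fun_eq_iff branch_fun_def wave_def radial0_def)
    then show ?thesis by (simp add: \<Phi>_def zero_X_def)
  qed
  then have "(0, \<omega>0) \<in> C" using sub K(3) by force
  \<comment> \<open>\<open>\<Phi>\<close> keeps the \<open>\<omega>\<close> coordinate, which is
    unbounded on \<open>K\<close>; so the first alternative always occurs.\<close>
  moreover have "\<not> bounded C"
  proof
    assume "bounded C"
    then have "bounded (snd ` \<Phi> ` K)" using sub by (intro bounded_snd) (rule bounded_subset)
    then show False using K(5) by (simp add: \<Phi>_def image_image)
  qed
  ultimately show ?thesis unfolding T_def by blast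
qed

end
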